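(* For $i=1,2$, let $k_i$ be a (commutative) field and $V_i$ a $k_i$-vector space with $\dim_{k_i}(V_i)\geq 3$. Let $U_i$ be a subset of $\mathbb P(V_i)$ for $i=1,2$, and assume that $U_i$ is $\mathcal S_i$-ample for some $(3,2)$-admissible set $\mathcal S_i$ of subsets of $\mathbb P^1(k_i)$ for $i=1,2$. Let $\sigma:U_1\xrightarrow{\sim}U_2$ and $\tau:\mathbb L(V_1)_{U_1}\xrightarrow{\sim}\mathbb L(V_2)_{U_2}$ be bijections such that for each $\ell\in\mathbb L(V_1)_{U_1}$ one has $\tau(\ell)_{U_2}=\sigma(\ell_{U_1})$. Then each such $(\sigma,\tau):(U_1,\mathbb L(V_1)_{U_1})\xrightarrow{\sim}(U_2,\mathbb L(V_2)_{U_2})$ uniquely extends to a collineation $(\tilde\sigma,\tilde\tau):(\mathbb P(V_1),\mathbb L(V_1))\xrightarrow{\sim}(\mathbb P(V_2),\mathbb L(V_2))$. In particular, there exists an isomorphism $(\mu,\lambda):(k_1,V_1)\xrightarrow{\sim}(k_2,V_2)$ that induces $(\sigma,\tau):(U_1,\mathbb L(V_1)_{U_1})\xrightarrow{\sim}(U_2,\mathbb L(V_2)_{U_2})$, and such an isomorphism $(\mu,\lambda)$ is unique up to scalar multiplication.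
   Context: For a vector space $V$ over a field $k$: $\mathbb P(V)=(V\setminus\{0\})/k^{\times}$; $\mathbb L(V)$ is the set of lines of $\mathbb P(V)$ (subsets $\mathbb P(W)$ with $W\subset V$ a $2$-dimensional subspace); $\mathbb P^1(k)=\mathbb P(k^2)$; $\bar x\in\mathbb P(V)$ is the class of $x\in V\setminus\{0\}$. For $U\subset\mathbb P(V)$ and $\ell\in\mathbb L(V)$, $\ell_U=\ell\cap U$, $\ell_{U^c}=\ell\setminus\ell_U$, and $\mathbb L(V)_U=\{\ell\in\mathbb L(V)\mid\ell_U\neq\varnothing\}$. A set $\mathcal S$ of subsets of $\mathbb P^1(k)$ is $\mathrm{PGL}_2$-stable if $\gamma(S)\in\mathcal S$ for all $S\in\mathcal S$, $\gamma\in\mathrm{PGL}_2(k)$. It is $(m,n)$-admissible (integers $m,n\geq0$) if it is $\mathrm{PGL}_2$-stable and for all $0\leq m'\leq m$, $0\leq n'\leq n$, $S_1,\dots,S_{m'}\in\mathcal S$, $p_1,\dots,p_{n'}\in\mathbb P^1(k)$ one has $S_1\cup\dots\cup S_{m'}\cup\{p_1,\dots,p_{n'}\}\subsetneq\mathbb P^1(k)$. For a $\mathrm{PGL}_2$-stable $\mathcal S$ and a $1$-dimensional projective space $\ell$ over $k$, $\mathcal S_\ell=\{S\subset\ell\mid\beta(S)\in\mathcal S\text{ for some (equivalently, every) }k\text{-projective isomorphism }\beta:\ell\to\mathbb P^1(k)\}$. A subset $U\subset\mathbb P(V)$ is $\mathcal S$-ample if $U\neq\varnothing$ and, for each $\ell\in\mathbb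 L(V)$, either $\ell_U=\varnothing$ or $\ell_{U^c}\in\mathcal S_\ell$. A collineation $(\mathbb P(V_1),\mathbb L(V_1))\xrightarrow{\sim}(\mathbb P(V_2),\mathbb L(V_2))$ is a pair $(\tilde\sigma,\tilde\tau)$ of bijections $\tilde\sigma:\mathbb P(V_1)\to\mathbb P(V_2)$, $\tilde\tau:\mathbb L(V_1)\to\mathbb L(V_2)$ with $\tilde\tau(\ell)=\tilde\sigma(\ell)$ for all $\ell\in\mathbb L(V_1)$. An isomorphism $(\mu,\lambda):(k_1,V_1)\xrightarrow{\sim}(k_2,V_2)$ is a pair consisting of a field isomorphism $\mu:k_1\to k_2$ and an isomorphism of abelian groups $\lambda:V_1\to V_2$ with $\lambda(ax)=\mu(a)\lambda(x)$ for $a\in k_1$, $x\in V_1$. It induces a collineation by $\bar x\mapsto\overline{\lambda(x)}$; it induces $(\sigma,\tau)$ if this collineation restricts to $(\sigma,\tau)$. Unique up to scalar multiplication: if $(\mu,\lambda)$ and $(\mu',\lambda')$ both induce $(\sigma,\tau)$, then $\mu'=\mu$ and there is $a\in k_1^\times$ with $\lambda'(x)=\lambda(ax)$ for all $x$. *)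

theory Defs
  imports "HOL-Analysis.Analysis"
begin

text \<open>
  A vector space over a field \<open>'k\<close> is given by its scalar multiplication
  \<open>s :: 'k \<Rightarrow> 'v \<Rightarrow> 'v\<close> subject to \<^locale>\<open>vector_space\<close>; it may be infinite-dimensional.
  A point of the projective space is an equivalence class, i.e. a set of nonzero vectors.
\<close>

text \<open>
  The library's \<^const>\<open>vector_space.dim\<close> is 0 on infinite-dimensional spaces, so the lower bound is
  imposed only when the space is finitely generated.
\<close>

definition dim_at_least :: "('k::field \<Rightarrow> 'v::ab_group_add \<Rightarrow> 'v) \<Rightarrow> nat \<Rightarrow> bool" where
  "dim_at_least s n \<longleftrightarrow>
     ((\<exists>B. finite B \<and> module.span s B = UNIV) \<longrightarrow> n \<le> vector_space.dim s UNIV)"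

definition proj_rel :: "('k::field \<Rightarrow> 'v::ab_group_add \<Rightarrow> 'v) \<Rightarrow> ('v \<times> 'v) set" where
  "proj_rel s = {(x, y). x \<noteq> 0 \<and> y \<noteq> 0 \<and> (\<exists>a. a \<noteq> 0 \<and> y = s a x)}"

definition proj_space :: "('k::field \<Rightarrow> 'v::ab_group_add \<Rightarrow> 'v) \<Rightarrow> 'v set set" where
  "proj_space s = (UNIV - {0}) // proj_rel s"

definition proj_class :: "('k::field \<Rightarrow> 'v::ab_group_add \<Rightarrow> 'v) \<Rightarrow> 'v \<Rightarrow> 'v set" where
  "proj_class s x = proj_rel s `` {x}"

definition proj_sub :: "('k::field \<Rightarrow> 'v::ab_group_add \<Rightarrow> 'v) \<Rightarrow> 'v set \<Rightarrow> 'v set set" where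
  "proj_sub s W = proj_class s ` (W - {0})"

definition proj_lines :: "('k::field \<Rightarrow> 'v::ab_group_add \<Rightarrow> 'v) \<Rightarrow> 'v set set set" where
  "proj_lines s = {proj_sub s W | W. module.subspace s W \<and> vector_space.dim s W = 2}"

definition lines_meeting ::
    "('k::field \<Rightarrow> 'v::ab_group_add \<Rightarrow> 'v) \<Rightarrow> 'v set set \<Rightarrow> 'v set set set" where
  "lines_meeting s U = {l \<in> proj_lines s. l \<inter> U \<noteq> {}}"

abbreviation proj_line1 :: "('k::field ^ 2) set set" where
  "proj_line1 \<equiv> proj_space (*s)"

text \<open>
  Elements of \<open>PGL\<^sub>2(k)\<close> are represented by the maps they induce on the points of
  \<^term>\<open>proj_line1\<close>; the values of such a map elsewhere are irrelevant.
\<close>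

definition PGL2 :: "(('k::field ^ 2) set \<Rightarrow> ('k ^ 2) set) set" where
  "PGL2 = {g. \<exists>A :: 'k ^ 2 ^ 2. invertible A \<and>
                (\<forall>x. x \<noteq> 0 \<longrightarrow> g (proj_class (*s) x) = proj_class (*s) (A *v x))}"

definition PGL2_stable :: "('k::field ^ 2) set set set \<Rightarrow> bool" where
  "PGL2_stable \<S> \<longleftrightarrow> \<S> \<subseteq> Pow proj_line1 \<and> (\<forall>S\<in>\<S>. \<forall>g\<in>PGL2. g ` S \<in> \<S>)"

definition admissible :: "nat \<Rightarrow> nat \<Rightarrow> ('k::field ^ 2) set set set \<Rightarrow> bool" where
  "admissible m n \<S> \<longleftrightarrow> PGL2_stable \<S> \<and>
     (\<forall>m'\<le>m. \<forall>n'\<le>n. \<forall>S p. (\<forall>i<m'. S i \<in> \<S>) \<longrightarrow> (\<forall>j<n'. p j \<in> proj_line1) \<longrightarrow>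
        (\<Union>i<m'. S i) \<union> p ` {..<n'} \<subset> proj_line1)"

text \<open>
  \<open>k\<close>-projective isomorphisms from the line \<open>l = \<P>(W)\<close> to \<^term>\<open>proj_line1\<close>: the maps induced
  by \<open>k\<close>-linear isomorphisms \<open>f\<close> from \<open>W\<close> to \<open>k\<^sup>2\<close>. Only the values of \<open>f\<close> on \<open>W\<close> matter.
\<close>

definition line_isos :: "('k::field \<Rightarrow> 'v::ab_group_add \<Rightarrow> 'v) \<Rightarrow> 'v set set
    \<Rightarrow> ('v set \<Rightarrow> ('k ^ 2) set) set" where
  "line_isos s l = {\<beta>. \<exists>W f. module.subspace s W \<and> l = proj_sub s W \<and> bij_betw f W UNIV \<and>
     (\<forall>x\<in>W. \<forall>y\<in>W. f (x + y) = f x + f y) \<and> (\<forall>a. \<forall>x\<in>W. f (s a x) = a *s f x) \<and>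
     (\<forall>x\<in>W - {0}. \<beta> (proj_class s x) = proj_class (*s) (f x))}"

definition line_family :: "('k::field ^ 2) set set set \<Rightarrow> ('k \<Rightarrow> 'v::ab_group_add \<Rightarrow> 'v)
    \<Rightarrow> 'v set set \<Rightarrow> 'v set set set" where
  "line_family \<S> s l = {S. S \<subseteq> l \<and> (\<exists>\<beta>\<in>line_isos s l. \<beta> ` S \<in> \<S>)}"

definition ample :: "('k::field ^ 2) set set set \<Rightarrow> ('k \<Rightarrow> 'v::ab_group_add \<Rightarrow> 'v)
    \<Rightarrow> 'v set set \<Rightarrow> bool" where
  "ample \<S> s U \<longleftrightarrow> U \<subseteq> proj_space s \<and> U \<noteq> {} \<and>
     (\<forall>l\<in>proj_lines s. l \<inter> U = {} \<or> l - (l \<inter> U) \<in> line_family \<S> s l)"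

definition collineation :: "('k1::field \<Rightarrow> 'v1::ab_group_add \<Rightarrow> 'v1)
    \<Rightarrow> ('k2::field \<Rightarrow> 'v2::ab_group_add \<Rightarrow> 'v2)
    \<Rightarrow> ('v1 set \<Rightarrow> 'v2 set) \<Rightarrow> ('v1 set set \<Rightarrow> 'v2 set set) \<Rightarrow> bool" where
  "collineation s1 s2 \<sigma> \<tau> \<longleftrightarrow>
     bij_betw \<sigma> (proj_space s1) (proj_space s2) \<and>
     bij_betw \<tau> (proj_lines s1) (proj_lines s2) \<and>
     (\<forall>l\<in>proj_lines s1. \<tau> l = \<sigma> ` l)"

definition restricts_to :: "('k1::field \<Rightarrow> 'v1::ab_group_add \<Rightarrow> 'v1) \<Rightarrow> 'v1 set set
    \<Rightarrow> ('v1 set \<Rightarrow> 'v2 set) \<Rightarrow> ('v1 set set \<Rightarrow> 'v2 set set)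
    \<Rightarrow> ('v1 set \<Rightarrow> 'v2 set) \<Rightarrow> ('v1 set set \<Rightarrow> 'v2 set set) \<Rightarrow> bool" where
  "restricts_to s1 U1 \<sigma>' \<tau>' \<sigma> \<tau> \<longleftrightarrow>
     (\<forall>p\<in>U1. \<sigma>' p = \<sigma> p) \<and> (\<forall>l\<in>lines_meeting s1 U1. \<tau>' l = \<tau> l)"

definition semilinear_iso :: "('k1::field \<Rightarrow> 'v1::ab_group_add \<Rightarrow> 'v1)
    \<Rightarrow> ('k2::field \<Rightarrow> 'v2::ab_group_add \<Rightarrow> 'v2) \<Rightarrow> ('k1 \<Rightarrow> 'k2) \<Rightarrow> ('v1 \<Rightarrow> 'v2) \<Rightarrow> bool" where
  "semilinear_iso s1 s2 \<mu> lam \<longleftrightarrow>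
     bij \<mu> \<and> \<mu> 1 = 1 \<and> (\<forall>a b. \<mu> (a + b) = \<mu> a + \<mu> b) \<and> (\<forall>a b. \<mu> (a * b) = \<mu> a * \<mu> b) \<and>
     bij lam \<and> (\<forall>x y. lam (x + y) = lam x + lam y) \<and> (\<forall>a x. lam (s1 a x) = s2 (\<mu> a) (lam x))"

text \<open>
  The collineation \<open>(\<sigma>', \<tau>')\<close> below is determined by \<open>lam\<close> on points and lines.
\<close>

definition induces :: "('k1::field \<Rightarrow> 'v1::ab_group_add \<Rightarrow> 'v1)
    \<Rightarrow> ('k2::field \<Rightarrow> 'v2::ab_group_add \<Rightarrow> 'v2) \<Rightarrow> 'v1 set set \<Rightarrow> ('v1 \<Rightarrow> 'v2)
    \<Rightarrow> ('v1 set \<Rightarrow> 'v2 set) \<Rightarrow> ('v1 set set \<Rightarrow> 'v2 set set) \<Rightarrow> bool" where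
  "induces s1 s2 U1 lam \<sigma> \<tau> \<longleftrightarrow>
     (\<exists>\<sigma>' \<tau>'. collineation s1 s2 \<sigma>' \<tau>' \<and>
        (\<forall>x. x \<noteq> 0 \<longrightarrow> \<sigma>' (proj_class s1 x) = proj_class s2 (lam x)) \<and>
        restricts_to s1 U1 \<sigma>' \<tau>' \<sigma> \<tau>)"

end

theory Submission
  imports Defs
begin

text \<open>
  A line that meets \<open>U\<^sub>1\<close> contains at least two points of it, so \<open>\<tau>\<close> is determined by \<open>\<sigma>\<close>, and the
  hypothesis on \<open>\<tau>\<close> says exactly that \<open>\<sigma>\<close> preserves and reflects collinearity. The problem is to
  extend \<open>\<sigma>\<close> to a point \<open>p\<close> outside \<open>U\<^sub>1\<close>. The image of \<open>p\<close> has to lie on \<open>\<tau>(l)\<close> for every line \<open>l\<close>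
  through \<open>p\<close> that meets \<open>U\<^sub>1\<close>, and there are at least two such lines, so everything hinges on the
  concurrency of all these \<open>\<tau>(l)\<close>. It follows from Desargues' theorem: given three lines through
  \<open>p\<close>, admissibility supplies two triangles with vertices in \<open>U\<^sub>1\<close>, in perspective from \<open>p\<close> with
  one vertex of each on every given line, such that the three points of the axis at which
  corresponding sides meet are also in \<open>U\<^sub>1\<close>. The seven lines of this configuration that avoid \<open>p\<close>
  carry three of its points each, these collinearities survive under \<open>\<sigma>\<close>, and the converse of Desargues' theorem yields the concurrency (\<open>three_images_concur\<close>,
  \<open>extends_exists\<close>). The numbers 3 and 2 are the ones needed for the last choice: a point that has
  to lie in \<open>U\<^sub>1\<close> together with two perspective images, and to avoid two degenerate positions.

  The extended map preserves collinearity. This is immediate on lines that meet \<open>U\<^sub>1\<close>. A line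
  missing \<open>U\<^sub>1\<close> is turned into the axis of two triangles with vertices and centre in \<open>U\<^sub>1\<close>, and
  Desargues' theorem is applied to the image (\<open>extends_collinear\<close>). The situation is symmetric in
  the two spaces and the two extensions are mutually inverse (\<open>extends_sym\<close>), so a collineation
  results. The fundamental theorem of projective geometry, proved here for spaces of arbitrary, possibly
  infinite dimension, turns it into a semilinear isomorphism (\<open>fundamental_theorem\<close>).

  Uniqueness of the extension holds because a point is the intersection of two lines that meet
  \<open>U\<^sub>1\<close> (\<open>extension_unique\<close>). Uniqueness of the semilinear map up to a scalar is the usual
  comparison of the factors at \<open>x\<close>, \<open>y\<close> and \<open>x + y\<close> (\<open>semilinear_unique\<close>).

  All arguments about incidence are carried out with representing vectors, since this makes the
  perspectivities linear: the points of three lines that correspond under two perspectivities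
  have the form \<open>a x\<^sub>i + b y\<^sub>i\<close> with one common parameter \<open>(a : b)\<close>.
\<close>

section \<open>Independent vectors, lines, and Desargues' theorem\<close>

text \<open>
  A point of the projective space is represented by a nonzero vector. In these terms \<open>indep2\<close> means
  that two points are distinct and \<open>indep3\<close> that three points are not collinear. Both are stated for
  tuples instead of sets because a set forgets repetitions, which have to count as dependent.
\<close>

definition indep2 :: "('k::field \<Rightarrow> 'v::ab_group_add \<Rightarrow> 'v) \<Rightarrow> 'v \<Rightarrow> 'v \<Rightarrow> bool" where
  "indep2 s x y \<longleftrightarrow> (\<forall>a b. s a x + s b y = 0 \<longrightarrow> a = 0 \<and> b = 0)"

definition indep3 :: "('k::field \<Rightarrow> 'v::ab_group_add \<Rightarrow> 'v) \<Rightarrow> 'v \<Rightarrow> 'v \<Rightarrow> 'v \<Rightarrow> bool" where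
  "indep3 s x y z \<longleftrightarrow> (\<forall>a b c. s a x + s b y + s c z = 0 \<longrightarrow> a = 0 \<and> b = 0 \<and> c = 0)"

text \<open>
  The plane spanned by the two vectors, whose projectivisation is the projective line that joins the
  two points.
\<close>

definition line :: "('k::field \<Rightarrow> 'v::ab_group_add \<Rightarrow> 'v) \<Rightarrow> 'v \<Rightarrow> 'v \<Rightarrow> 'v set" where
  "line s x y = {s a x + s b y | a b. True}"

locale lin = vector_space s
  for s :: "'k::field \<Rightarrow> 'v::ab_group_add \<Rightarrow> 'v" (infixr "\<cdot>" 75)
begin

lemma indep2D: "indep2 s x y \<Longrightarrow> a \<cdot> x + b \<cdot> y = 0 \<Longrightarrow> a = 0 \<and> b = 0"
  unfolding indep2_def by blast

lemma indep2_eqD: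
  assumes "indep2 s x y" "a \<cdot> x + b \<cdot> y = c \<cdot> x + d \<cdot> y"
  shows "a = c \<and> b = d"
proof -
  have "(a - c) \<cdot> x + (b - d) \<cdot> y = 0" using assms(2) by (simp add: algebra_simps)
  from indep2D[OF assms(1) this] show ?thesis by simp
qed

lemma indep3D: "indep3 s x y z \<Longrightarrow> a \<cdot> x + b \<cdot> y + c \<cdot> z = 0 \<Longrightarrow> a = 0 \<and> b = 0 \<and> c = 0"
  unfolding indep3_def by blast

lemma indep3_eqD:
  assumes "indep3 s x y z" "a \<cdot> x + b \<cdot> y + c \<cdot> z = a' \<cdot> x + b' \<cdot> y + c' \<cdot> z"
  shows "a = a' \<and> b = b' \<and> c = c'"
proof -
  have "(a - a') \<cdot> x + (b - b') \<cdot> y + (c - c') \<cdot> z = 0" using assms(2) by (simp add: algebra_simps)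
  from indep3D[OF assms(1) this] show ?thesis by simp
qed

lemma indep2_sym: "indep2 s x y \<Longrightarrow> indep2 s y x"
  unfolding indep2_def by (metis add.commute)

lemma indep3_rot: "indep3 s x y z \<Longrightarrow> indep3 s y z x"
  unfolding indep3_def by (metis add.commute add.left_commute)

lemma indep2_nonzero: "indep2 s x y \<Longrightarrow> x \<noteq> 0 \<and> y \<noteq> 0"
  unfolding indep2_def by (metis add_0 add.right_neutral scale_zero_left scale_zero_right zero_neq_one)

lemma indep3_imp_indep2:
  assumes "indep3 s x y z" shows "indep2 s x y"
  unfolding indep2_def
proof (intro allI impI)
  fix a b assume "a \<cdot> x + b \<cdot> y = 0"
  then have "a \<cdot> x + b \<cdot> y + 0 \<cdot> z = 0" by simp
  from indep3D[OF assms this] show "a = 0 \<and> b = 0" by simp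
qed

lemma not_indep2_iff:
  assumes "x \<noteq> 0" shows "\<not> indep2 s x y \<longleftrightarrow> (\<exists>a. y = a \<cdot> x)"
proof
  assume "\<not> indep2 s x y"
  then obtain a b where ab: "a \<cdot> x + b \<cdot> y = 0" "\<not> (a = 0 \<and> b = 0)" unfolding indep2_def by blast
  have b: "b \<noteq> 0" using ab assms by auto
  have "b \<cdot> y = - (a \<cdot> x)" using ab(1) by (simp add: add_eq_0_iff)
  then have "inverse b \<cdot> b \<cdot> y = inverse b \<cdot> (- (a \<cdot> x))" by simp
  then have "y = (- (inverse b * a)) \<cdot> x" using b by (simp del: right_inverse)
  then show "\<exists>a. y = a \<cdot> x" ..
next
  assume "\<exists>a. y = a \<cdot> x"
  then obtain a where "y = a \<cdot> x" ..
  then have "a \<cdot> x + (-1) \<cdot> y = 0" by simp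
  then show "\<not> indep2 s x y" using indep2D by fastforce
qed

lemma not_indep2E:
  assumes "\<not> indep2 s x y" "x \<noteq> 0" "y \<noteq> 0"
  obtains a where "a \<noteq> 0" "y = a \<cdot> x"
  using assms not_indep2_iff[of x y] by (metis scale_zero_left)

lemma indep2_scale_iff: "c \<noteq> 0 \<Longrightarrow> indep2 s (c \<cdot> x) y \<longleftrightarrow> indep2 s x y"
proof (cases "x = 0")
  case True then show ?thesis using indep2_nonzero by fastforce
next
  case x: False
  assume c: "c \<noteq> 0"
  have "(\<exists>a. y = a \<cdot> c \<cdot> x) \<longleftrightarrow> (\<exists>a. y = a \<cdot> x)" (is "?l = ?r")
  proof
    assume ?l then show ?r by (metis scale_scale)
  next
    assume ?r then obtain a where "y = a \<cdot> x" ..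
    then have "y = (a / c) \<cdot> c \<cdot> x" using c by simp
    then show ?l ..
  qed
  then show ?thesis using not_indep2_iff[of x y] not_indep2_iff[of "c \<cdot> x" y] x c by auto
qed

lemma par_trans:
  assumes "\<not> indep2 s x y" "\<not> indep2 s y z" "y \<noteq> 0"
  shows "\<not> indep2 s x z"
proof (cases "x = 0")
  case True then show ?thesis using indep2_nonzero by blast
next
  case False
  obtain a b where "y = a \<cdot> x" "z = b \<cdot> y" using assms not_indep2_iff False by metis
  then have "z = (b * a) \<cdot> x" by simp
  then show ?thesis using not_indep2_iff[OF False] by blast
qed

lemma lineI: "a \<cdot> x + b \<cdot> y \<in> line s x y"
  unfolding line_def by blast

lemma lineE: assumes "z \<in> line s x y" obtains a b where "z = a \<cdot> x + b \<cdot> y"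
  using assms unfolding line_def by blast

lemma line_left: "x \<in> line s x y" and line_right: "y \<in> line s x y"
  using lineI[of 1 x 0 y] lineI[of 0 x 1 y] by auto

lemma line_add: assumes "u \<in> line s x y" "v \<in> line s x y" shows "u + v \<in> line s x y"
proof -
  obtain a b c d where "u = a \<cdot> x + b \<cdot> y" "v = c \<cdot> x + d \<cdot> y" using assms by (metis lineE)
  then have "u + v = (a + c) \<cdot> x + (b + d) \<cdot> y" by (simp add: algebra_simps)
  then show ?thesis using lineI by metis
qed

lemma line_scale: assumes "u \<in> line s x y" shows "c \<cdot> u \<in> line s x y"
proof -
  obtain a b where "u = a \<cdot> x + b \<cdot> y" using assms by (metis lineE)
  then have "c \<cdot> u = (c * a) \<cdot> x + (c * b) \<cdot> y" by (simp add: algebra_simps)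
  then show ?thesis using lineI by metis
qed

lemma line_comb: "u \<in> line s x y \<Longrightarrow> v \<in> line s x y \<Longrightarrow> a \<cdot> u + b \<cdot> v \<in> line s x y"
  by (simp add: line_add line_scale)

lemma line_scale_iff: "c \<noteq> 0 \<Longrightarrow> c \<cdot> u \<in> line s x y \<longleftrightarrow> u \<in> line s x y"
  using line_scale[of u x y c] line_scale[of "c \<cdot> u" x y "inverse c"] by auto

lemma line_subspace: "subspace (line s x y)"
  by (rule subspaceI) (use lineI[of 0 x 0 y] line_add line_scale in auto)

lemma line_diff: "u \<in> line s x y \<Longrightarrow> v \<in> line s x y \<Longrightarrow> u - v \<in> line s x y"
  using line_subspace subspace_diff by blast

lemma line_sub: "u \<in> line s x y \<Longrightarrow> v \<in> line s x y \<Longrightarrow> line s u v \<subseteq> line s x y"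
  using line_comb by (metis lineE subsetI)

text \<open>
  Cramer's rule: the coefficients of \<open>u\<close>, \<open>v\<close> in terms of \<open>x\<close>, \<open>y\<close> have nonzero determinant, for
  otherwise \<open>u\<close> and \<open>v\<close> would be dependent. Every statement that a projective line is determined by
  two of its points is reduced to this.
\<close>

lemma line_eqI:
  assumes u: "u \<in> line s x y" and v: "v \<in> line s x y" and i: "indep2 s u v"
  shows "line s u v = line s x y"
proof -
  obtain a b where u': "u = a \<cdot> x + b \<cdot> y" using u by (metis lineE)
  obtain c d where v': "v = c \<cdot> x + d \<cdot> y" using v by (metis lineE)
  let ?D = "a * d - b * c"
  have e1: "d \<cdot> u + (- b) \<cdot> v = ?D \<cdot> x" unfolding u' v' by (simp add: algebra_simps)
  have e2: "(- c) \<cdot> u + a \<cdot> v = ?D \<cdot> y" unfolding u' v' by (simp add: algebra_simps)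
  have D: "?D \<noteq> 0"
  proof
    assume D: "?D = 0"
    have "d = 0 \<and> b = 0" using indep2D[OF i, of d "- b"] e1 D by simp
    moreover have "c = 0 \<and> a = 0" using indep2D[OF i, of "- c" a] e2 D by simp
    ultimately show False using u' indep2_nonzero[OF i] by simp
  qed
  have "x \<in> line s u v" "y \<in> line s u v"
    using e1 e2 lineI[of d u "- b" v] lineI[of "- c" u a v] line_scale_iff[OF D] by metis+
  then show ?thesis using line_sub u v by blast
qed

lemma indep3_iff: "indep2 s x y \<Longrightarrow> indep3 s x y z \<longleftrightarrow> z \<notin> line s x y"
proof
  assume i: "indep3 s x y z"
  show "z \<notin> line s x y"
  proof
    assume "z \<in> line s x y"
    then obtain a b where "z = a \<cdot> x + b \<cdot> y" by (metis lineE)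
    then have "a \<cdot> x + b \<cdot> y + (-1) \<cdot> z = 0" by simp
    from indep3D[OF i this] show False by simp
  qed
next
  assume i: "indep2 s x y" and z: "z \<notin> line s x y"
  show "indep3 s x y z" unfolding indep3_def
  proof (intro allI impI)
    fix a b c assume e: "a \<cdot> x + b \<cdot> y + c \<cdot> z = 0"
    have c: "c = 0"
    proof (rule ccontr)
      assume c: "c \<noteq> 0"
      have "c \<cdot> z = (- a) \<cdot> x + (- b) \<cdot> y" using e by (simp add: eq_diff_eq eq_neg_iff_add_eq_0 algebra_simps)
      then show False using z lineI line_scale_iff[OF c] by metis
    qed
    then show "a = 0 \<and> b = 0 \<and> c = 0" using indep2D[OF i, of a b] e by simp
  qed
qed

lemma indep3_notin: "indep3 s x y z \<Longrightarrow> z \<notin> line s x y"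
  using indep3_iff indep3_imp_indep2 by blast

lemma indep3_pairs:
  assumes "indep3 s x y z" shows "indep2 s x y" "indep2 s x z" "indep2 s y z"
  using assms indep3_imp_indep2 indep3_rot indep2_sym by blast+

lemma three_on_line: "p \<in> line s x y \<Longrightarrow> q \<in> line s x y \<Longrightarrow> r \<in> line s x y \<Longrightarrow> \<not> indep3 s p q r"
  using line_eqI indep3_iff indep3_imp_indep2 by blast

lemma meet_unique:
  assumes "p \<in> line s x y" "q \<in> line s x y" "p \<in> line s u v" "q \<in> line s u v" "u \<notin> line s x y"
  shows "\<not> indep2 s p q"
  using assms line_eqI line_left by metis

lemma indep2_off_line: assumes "p \<noteq> 0" "z \<notin> line s p q" shows "indep2 s p z"
proof (rule ccontr)
  assume "\<not> indep2 s p z"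
  then obtain a where "z = a \<cdot> p" using not_indep2_iff[OF assms(1)] by blast
  then show False using assms line_scale[OF line_left] by blast
qed

lemma indep2_comb:
  assumes "indep2 s x y" "b \<noteq> 0" shows "indep2 s x (a \<cdot> x + b \<cdot> y)"
  unfolding indep2_def
proof (intro allI impI)
  fix c d assume "c \<cdot> x + d \<cdot> (a \<cdot> x + b \<cdot> y) = 0"
  then have "(c + d * a) \<cdot> x + (d * b) \<cdot> y = 0" by (simp add: algebra_simps)
  from indep2D[OF assms(1) this] show "c = 0 \<and> d = 0" using assms(2) by auto
qed

text \<open>
  Scale the axis points \<open>C\<^sub>i\<^sub>j\<close> so that their linear relation becomes a vanishing sum. As the
  \<open>A\<^sub>i\<close> are independent, comparing coefficients shows that, after scaling the \<open>A\<^sub>i\<close> and up to cyclic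
  signs, \<open>C\<^sub>i\<^sub>j = A\<^sub>i - A\<^sub>j\<close>. The same holds for the \<open>B\<^sub>i\<close>. Hence
  \<open>A\<^sub>1 - B\<^sub>1 = A\<^sub>2 - B\<^sub>2 = A\<^sub>3 - B\<^sub>3\<close>, and this vector is the centre. The
  computation is the same for planar and for spatial configurations.
\<close>

lemma desargues_converse:
  assumes A: "indep3 s A1 A2 A3" and B: "indep3 s B1 B2 B3"
    and AB: "indep2 s A1 B1" "indep2 s A2 B2" "indep2 s A3 B3"
    and C12: "C12 \<in> line s A1 A2" "C12 \<in> line s B1 B2" "C12 \<noteq> 0"
    and C13: "C13 \<in> line s A1 A3" "C13 \<in> line s B1 B3" "C13 \<noteq> 0"
    and C23: "C23 \<in> line s A2 A3" "C23 \<in> line s B2 B3" "C23 \<noteq> 0"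
    and C: "\<not> indep3 s C12 C13 C23"
  shows "\<exists>q. q \<noteq> 0 \<and> q \<in> line s A1 B1 \<and> q \<in> line s A2 B2 \<and> q \<in> line s A3 B3"
proof -
  obtain x y z where xyz: "x \<cdot> C12 + y \<cdot> C13 + z \<cdot> C23 = 0" "\<not> (x = 0 \<and> y = 0 \<and> z = 0)"
    using C unfolding indep3_def by blast
  let ?C12 = "x \<cdot> C12" and ?C13 = "y \<cdot> C13" and ?C23 = "z \<cdot> C23"
  \<comment> \<open>The scaled axis points may vanish individually, but not all of them.\<close>
  have nz: "\<not> (?C12 = 0 \<and> ?C13 = 0 \<and> ?C23 = 0)" using xyz(2) C12(3) C13(3) C23(3) by auto
  have coef: "\<exists>a b c. ?C12 = a \<cdot> X1 + b \<cdot> X2 \<and> ?C13 = (- a) \<cdot> X1 + c \<cdot> X3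
        \<and> ?C23 = (- b) \<cdot> X2 + (- c) \<cdot> X3"
    if X: "indep3 s X1 X2 X3" "C12 \<in> line s X1 X2" "C13 \<in> line s X1 X3" "C23 \<in> line s X2 X3"
    for X1 X2 X3
  proof -
    obtain a b where 1: "?C12 = a \<cdot> X1 + b \<cdot> X2" using line_scale[OF X(2)] by (metis lineE)
    obtain a' c where 2: "?C13 = a' \<cdot> X1 + c \<cdot> X3" using line_scale[OF X(3)] by (metis lineE)
    obtain b' c' where 3: "?C23 = b' \<cdot> X2 + c' \<cdot> X3" using line_scale[OF X(4)] by (metis lineE)
    have "(a + a') \<cdot> X1 + (b + b') \<cdot> X2 + (c + c') \<cdot> X3 = 0"
      using xyz(1) unfolding 1 2 3 by (simp add: algebra_simps)
    from indep3D[OF X(1) this] have "a' = - a" "b' = - b" "c' = - c"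
      by (simp_all add: eq_neg_iff_add_eq_0 add.commute)
    then show ?thesis using 1 2 3 by blast
  qed
  obtain a b c where a: "?C12 = a \<cdot> A1 + b \<cdot> A2" "?C13 = (- a) \<cdot> A1 + c \<cdot> A3"
      "?C23 = (- b) \<cdot> A2 + (- c) \<cdot> A3"
    using coef[OF A C12(1) C13(1) C23(1)] by blast
  obtain a' b' c' where b: "?C12 = a' \<cdot> B1 + b' \<cdot> B2" "?C13 = (- a') \<cdot> B1 + c' \<cdot> B3"
      "?C23 = (- b') \<cdot> B2 + (- c') \<cdot> B3"
    using coef[OF B C12(2) C13(2) C23(2)] by blast
  let ?q = "a \<cdot> A1 + (- a') \<cdot> B1"
  have q2: "?q = (- b) \<cdot> A2 + b' \<cdot> B2" using a(1) b(1) by (simp add: algebra_simps)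
  have q3: "?q = c \<cdot> A3 + (- c') \<cdot> B3" using a(2) b(2) by (simp add: algebra_simps)
  have "?q \<noteq> 0"
  proof
    assume q: "?q = 0"
    have "a = 0" "b = 0" "c = 0"
      using indep2D[OF AB(1) q] indep2D[OF AB(2), of "- b" b'] indep2D[OF AB(3), of c "- c'"] q q2 q3
      by auto
    then show False using a nz by simp
  qed
  then show ?thesis using lineI q2 q3 by metis
qed

text \<open>
  After scaling, \<open>O' = A\<^sub>i - B\<^sub>i\<close> for all \<open>i\<close>, so that \<open>A\<^sub>i - A\<^sub>j = B\<^sub>i - B\<^sub>j\<close> represents the point
  where corresponding sides meet. The three differences have sum zero up to signs.
\<close>

lemma desargues:
  assumes O1: "O' \<in> line s A1 B1" and O2: "O' \<in> line s A2 B2" and O3: "O' \<in> line s A3 B3"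
    and OA: "indep2 s O' A1" "indep2 s O' A2" "indep2 s O' A3"
    and A: "indep3 s A1 A2 O'" "indep3 s A1 A3 O'" "indep3 s A2 A3 O'"
    and OB: "indep2 s O' B1" "indep2 s O' B2" "indep2 s O' B3"
    and P: "P \<in> line s A1 A2" "P \<in> line s B1 B2"
    and Q: "Q \<in> line s A1 A3" "Q \<in> line s B1 B3"
    and R: "R \<in> line s A2 A3" "R \<in> line s B2 B3"
  shows "\<not> indep3 s P Q R"
proof
  assume PQR: "indep3 s P Q R"
  have coef: "\<exists>a b. O' = a \<cdot> X + b \<cdot> Y \<and> a \<noteq> 0 \<and> b \<noteq> 0"
    if h: "O' \<in> line s X Y" "indep2 s O' X" "indep2 s O' Y" for X Y
  proof -
    obtain a b where e: "O' = a \<cdot> X + b \<cdot> Y" using h(1) by (metis lineE)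
    have "a \<noteq> 0" using indep2D[OF h(3), of 1 "- b"] e by auto
    moreover have "b \<noteq> 0" using indep2D[OF h(2), of 1 "- a"] e by auto
    ultimately show ?thesis using e by blast
  qed
  obtain a1 b1 where 1: "O' = a1 \<cdot> A1 + b1 \<cdot> B1" "a1 \<noteq> 0" "b1 \<noteq> 0" using coef O1 OA OB by metis
  obtain a2 b2 where 2: "O' = a2 \<cdot> A2 + b2 \<cdot> B2" "a2 \<noteq> 0" "b2 \<noteq> 0" using coef O2 OA OB by metis
  obtain a3 b3 where 3: "O' = a3 \<cdot> A3 + b3 \<cdot> B3" "a3 \<noteq> 0" "b3 \<noteq> 0" using coef O3 OA OB by metis
  \<comment> \<open>Corresponding sides are distinct lines because the centre lies on neither, so they meet in one point only.\<close>
  have key: "\<exists>c. c \<noteq> 0 \<and> a \<cdot> X + (- a') \<cdot> X' = c \<cdot> Z"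
    if e: "O' = a \<cdot> X + b \<cdot> Y" "O' = a' \<cdot> X' + b' \<cdot> Y'" "a \<noteq> 0" and i: "indep3 s X X' O'"
      and Z: "Z \<in> line s X X'" "Z \<in> line s Y Y'" "Z \<noteq> 0" for X X' Y Y' Z a a' b b'
  proof -
    let ?W = "a \<cdot> X + (- a') \<cdot> X'"
    have W: "?W = (- b) \<cdot> Y + b' \<cdot> Y'" using e(1,2) by (simp add: algebra_simps)
    have "\<not> indep2 s Z ?W"
    proof
      assume i2: "indep2 s Z ?W"
      have "line s Z ?W = line s X X'" by (rule line_eqI[OF Z(1) lineI i2])
      moreover have "line s Z ?W = line s Y Y'"
        using line_eqI[OF Z(2) _ i2] W lineI by metis
      ultimately have "Y \<in> line s X X'" using line_left by simp
      then have "O' \<in> line s X X'" using line_comb[OF line_left, of Y X X'] e(1) by metis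
      then show False using indep3_notin[OF i] by simp
    qed
    moreover have "?W \<noteq> 0" using indep2D[OF indep3_imp_indep2[OF i]] e(3) by blast
    ultimately show ?thesis using not_indep2E Z(3) by metis
  qed
  have nz: "P \<noteq> 0" "Q \<noteq> 0" "R \<noteq> 0" using indep3_pairs[OF PQR] indep2_nonzero by auto
  obtain p where p: "p \<noteq> 0" "a1 \<cdot> A1 + (- a2) \<cdot> A2 = p \<cdot> P"
    using key[OF 1(1) 2(1) 1(2) A(1) P nz(1)] by blast
  obtain q where q: "q \<noteq> 0" "a1 \<cdot> A1 + (- a3) \<cdot> A3 = q \<cdot> Q"
    using key[OF 1(1) 3(1) 1(2) A(2) Q nz(2)] by blast
  obtain r where r: "r \<noteq> 0" "a2 \<cdot> A2 + (- a3) \<cdot> A3 = r \<cdot> R"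
    using key[OF 2(1) 3(1) 2(2) A(3) R nz(3)] by blast
  have "p \<cdot> P + (- q) \<cdot> Q + r \<cdot> R = 0" unfolding scale_minus_left p(2)[symmetric] q(2)[symmetric] r(2)[symmetric] by simp
  from indep3D[OF PQR this] p show False by simp
qed

end

section \<open>The fundamental theorem of projective geometry\<close>

lemma surjI_ex: "(\<And>y. \<exists>x. h x = y) \<Longrightarrow> surj h"
  unfolding surj_def by metis

text \<open>
  A collineation lifted to representing vectors by an arbitrary choice of representatives. Mapping
  \<open>0\<close> to \<open>0\<close> makes the incidence conditions meaningful for all vectors.
\<close>

locale collinearity_map = V1: lin s1 + V2: lin s2
  for s1 :: "'k1::field \<Rightarrow> 'v1::ab_group_add \<Rightarrow> 'v1" (infixr "\<cdot>\<^sub>1" 75)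
    and s2 :: "'k2::field \<Rightarrow> 'v2::ab_group_add \<Rightarrow> 'v2" (infixr "\<cdot>\<^sub>2" 75) +
  fixes f :: "'v1 \<Rightarrow> 'v2"
  assumes f_zero: "f 0 = 0"
    and f_indep2: "indep2 s2 (f x) (f y) \<longleftrightarrow> indep2 s1 x y"
    and f_indep3: "indep3 s2 (f x) (f y) (f z) \<longleftrightarrow> indep3 s1 x y z"
    and f_surj: "w \<noteq> 0 \<Longrightarrow> \<exists>x. x \<noteq> 0 \<and> \<not> indep2 s2 w (f x)"
    and dim3: "\<exists>z. z \<notin> line s1 x y"
begin

lemma exists_indep2: "x \<noteq> 0 \<Longrightarrow> \<exists>y. indep2 s1 x y"
  using dim3[of x x] V1.indep2_off_line by blast

lemma f_nonzero: "x \<noteq> 0 \<Longrightarrow> f x \<noteq> 0"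
  using exists_indep2[of x] f_indep2 V2.indep2_nonzero by blast

lemma f_line: assumes "indep2 s1 x y" "z \<in> line s1 x y" shows "f z \<in> line s2 (f x) (f y)"
  using assms V1.indep3_iff V2.indep3_iff f_indep2 f_indep3 by metis

end

text \<open>
  A reference vector \<open>e\<close> together with a complementary hyperplane, the kernel of \<open>\<phi>\<close>. The points
  represented by \<open>e + x\<close> with \<open>\<phi> x = 0\<close> form an affine chart.
\<close>

locale collinearity_map_frame = collinearity_map +
  fixes e and \<phi>
  assumes \<phi>_e: "\<phi> e = 1"
    and \<phi>_add: "\<phi> (x + y) = \<phi> x + \<phi> y"
    and \<phi>_scale: "\<phi> (a \<cdot>\<^sub>1 x) = a * \<phi> x"
begin

lemma \<phi>_zero: "\<phi> 0 = 0"
  using \<phi>_scale[of 0 0] by simp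

lemma \<phi>_diff: "\<phi> (x - y) = \<phi> x - \<phi> y"
  using \<phi>_add[of "x - y" y] by simp

lemma e_nonzero: "e \<noteq> 0"
  using \<phi>_e \<phi>_zero by fastforce

lemma indep2_e: assumes "\<phi> x = 0" "x \<noteq> 0" shows "indep2 s1 e x"
  unfolding indep2_def
proof (intro allI impI)
  fix a b assume h: "a \<cdot>\<^sub>1 e + b \<cdot>\<^sub>1 x = 0"
  have "\<phi> (a \<cdot>\<^sub>1 e + b \<cdot>\<^sub>1 x) = 0" unfolding h by (rule \<phi>_zero)
  then have "a = 0" by (simp add: \<phi>_add \<phi>_scale \<phi>_e assms)
  with h show "a = 0 \<and> b = 0" using assms by simp
qed

lemma indep3_e: assumes "\<phi> x = 0" "\<phi> y = 0" "indep2 s1 x y" shows "indep3 s1 e x y"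
  unfolding indep3_def
proof (intro allI impI)
  fix a b c assume h: "a \<cdot>\<^sub>1 e + b \<cdot>\<^sub>1 x + c \<cdot>\<^sub>1 y = 0"
  have "\<phi> (a \<cdot>\<^sub>1 e + b \<cdot>\<^sub>1 x + c \<cdot>\<^sub>1 y) = 0" unfolding h by (rule \<phi>_zero)
  then have "a = 0" by (simp add: \<phi>_add \<phi>_scale \<phi>_e assms)
  with h show "a = 0 \<and> b = 0 \<and> c = 0" using V1.indep2D[OF assms(3), of b c] by simp
qed

lemma exists_H_indep2: assumes "\<phi> x = 0" "x \<noteq> 0" shows "\<exists>z. \<phi> z = 0 \<and> indep2 s1 x z"
proof -
  obtain z where z: "z \<notin> line s1 e x" using dim3 by blast
  let ?z = "z - \<phi> z \<cdot>\<^sub>1 e"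
  have "\<phi> ?z = 0" by (simp add: \<phi>_diff \<phi>_scale \<phi>_e)
  moreover have "indep2 s1 x ?z"
  proof (rule ccontr)
    assume "\<not> indep2 s1 x ?z"
    then obtain a where "?z = a \<cdot>\<^sub>1 x" using V1.not_indep2_iff assms by blast
    then have "z = \<phi> z \<cdot>\<^sub>1 e + a \<cdot>\<^sub>1 x" by (simp add: algebra_simps)
    then show False using z V1.lineI by metis
  qed
  ultimately show ?thesis by blast
qed

lemma exists_H_nonzero: "\<exists>x. \<phi> x = 0 \<and> x \<noteq> 0"
proof -
  obtain y where y: "indep2 s1 e y" using exists_indep2[OF e_nonzero] by blast
  let ?x = "y - \<phi> y \<cdot>\<^sub>1 e"
  have "\<phi> ?x = 0" by (simp add: \<phi>_diff \<phi>_scale \<phi>_e)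
  moreover have "?x \<noteq> 0"
  proof
    assume "?x = 0"
    then have "y = \<phi> y \<cdot>\<^sub>1 e" by simp
    then show False using y V1.not_indep2_iff[OF e_nonzero] by blast
  qed
  ultimately show ?thesis by blast
qed

text \<open>
  The choice of representatives of \<open>f\<close> on the hyperplane that makes \<open>f\<close> look linear in the affine
  chart: \<open>e + x\<close> goes to the point of \<open>f e + g x\<close>. Such a representative exists by \<open>g_spec\<close> if
  \<open>\<phi> x = 0\<close>.
\<close>

definition g where
  "g x = (SOME w. (\<exists>c. w = c \<cdot>\<^sub>2 f x) \<and> \<not> indep2 s2 (f e + w) (f (e + x)))"

lemma e_plus_nonzero: "\<phi> x = 0 \<Longrightarrow> e + x \<noteq> 0"
  using \<phi>_add[of e x] \<phi>_e \<phi>_zero by fastforce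

lemma g_spec:
  assumes x: "\<phi> x = 0"
  shows "\<exists>c. g x = c \<cdot>\<^sub>2 f x" and "\<not> indep2 s2 (f e + g x) (f (e + x))"
proof -
  have "\<exists>w. (\<exists>c. w = c \<cdot>\<^sub>2 f x) \<and> \<not> indep2 s2 (f e + w) (f (e + x))"
  proof (cases "x = 0")
    case True
    then show ?thesis using f_indep2[of e e] V1.not_indep2_iff[OF e_nonzero, of e]
      by (intro exI[of _ 0]) (auto simp: f_zero intro: exI[of _ 1])
  next
    case False
    note i = indep2_e[OF x False]
    have "f (e + x) \<in> line s2 (f e) (f x)"
      using f_line[OF i] V1.line_add[OF V1.line_left V1.line_right] by blast
    then obtain a b where ab: "f (e + x) = a \<cdot>\<^sub>2 f e + b \<cdot>\<^sub>2 f x" by (metis V2.lineE)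
    \<comment> \<open>If the coefficient of \<open>f e\<close> vanished, \<open>e + x\<close> and \<open>x\<close> would have the same image point.\<close>
    have a: "a \<noteq> 0"
    proof
      assume "a = 0"
      then have "f (e + x) = b \<cdot>\<^sub>2 f x" using ab by simp
      then have "\<not> indep2 s1 x (e + x)" using V2.not_indep2_iff[OF f_nonzero[OF False]] f_indep2 by blast
      then obtain c where "e + x = c \<cdot>\<^sub>1 x" using V1.not_indep2_iff[OF False] by blast
      then have "\<phi> (e + x) = 0" by (simp add: \<phi>_scale x)
      then show False by (simp add: \<phi>_add \<phi>_e x)
    qed
    then have "f (e + x) = a \<cdot>\<^sub>2 (f e + (b / a) \<cdot>\<^sub>2 f x)" using ab by (simp add: algebra_simps)
    moreover have "f e + (b / a) \<cdot>\<^sub>2 f x \<noteq> 0"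
      using calculation f_nonzero[OF e_plus_nonzero[OF x]] by auto
    ultimately show ?thesis using V2.not_indep2_iff by blast
  qed
  from someI_ex[OF this] show "\<exists>c. g x = c \<cdot>\<^sub>2 f x" "\<not> indep2 s2 (f e + g x) (f (e + x))"
    unfolding g_def by blast+
qed

lemma g_zero: "g 0 = 0"
  using g_spec(1)[OF \<phi>_zero] f_zero by auto

lemma g_nonzero: assumes x: "\<phi> x = 0" "x \<noteq> 0" shows "g x \<noteq> 0"
proof
  assume "g x = 0"
  then have "\<not> indep2 s1 e (e + x)" using g_spec(2)[OF x(1)] f_indep2 by simp
  then obtain c where c: "e + x = c \<cdot>\<^sub>1 e" using V1.not_indep2_iff[OF e_nonzero] by blast
  have "c = 1" using arg_cong[OF c, of \<phi>] by (simp add: \<phi>_add \<phi>_scale \<phi>_e x)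
  then show False using c x by simp
qed

lemma g_multiple: assumes x: "\<phi> x = 0" "x \<noteq> 0" shows "\<exists>c. c \<noteq> 0 \<and> g x = c \<cdot>\<^sub>2 f x"
  using g_spec(1)[OF x(1)] g_nonzero[OF x] by (metis V2.scale_zero_left)

lemma fe_plus_nonzero: assumes x: "\<phi> x = 0" shows "f e + g x \<noteq> 0"
proof (cases "x = 0")
  case True then show ?thesis using g_zero f_nonzero[OF e_nonzero] by simp
next
  case False
  obtain c where "g x = c \<cdot>\<^sub>2 f x" using g_spec(1)[OF x] by blast
  moreover have "indep2 s2 (f e) (f x)" using indep2_e[OF x False] f_indep2 by blast
  ultimately show ?thesis using V2.indep2D[of "f e" "f x" 1 c] by auto
qed

lemma f_e_plus: assumes x: "\<phi> x = 0" shows "\<exists>t. t \<noteq> 0 \<and> f (e + x) = t \<cdot>\<^sub>2 (f e + g x)"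
  using V2.not_indep2E[OF g_spec(2)[OF x] fe_plus_nonzero[OF x] f_nonzero[OF e_plus_nonzero[OF x]]] by metis

lemma g_indep3: assumes "\<phi> x = 0" "\<phi> y = 0" "indep2 s1 x y" shows "indep3 s2 (f e) (g x) (g y)"
  unfolding indep3_def
proof (intro allI impI)
  have nz: "x \<noteq> 0" "y \<noteq> 0" using V1.indep2_nonzero[OF assms(3)] by simp_all
  fix a b c assume h: "a \<cdot>\<^sub>2 f e + b \<cdot>\<^sub>2 g x + c \<cdot>\<^sub>2 g y = 0"
  obtain u where u: "u \<noteq> 0" "g x = u \<cdot>\<^sub>2 f x" using g_multiple[OF assms(1)] nz by metis
  obtain v where v: "v \<noteq> 0" "g y = v \<cdot>\<^sub>2 f y" using g_multiple[OF assms(2)] nz by metis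
  have i: "indep3 s2 (f e) (f x) (f y)" using f_indep3 indep3_e[OF assms] by blast
  have "a = 0 \<and> b * u = 0 \<and> c * v = 0" using V2.indep3D[OF i, of a "b * u" "c * v"] h u v by simp
  then show "a = 0 \<and> b = 0 \<and> c = 0" using u v by simp
qed

text \<open>
  The point of \<open>e + x + y\<close> is the intersection of the line joining \<open>e + x\<close> to \<open>y\<close> and the line
  joining \<open>e + y\<close> to \<open>x\<close>. In the image these lines meet in \<open>f e + g x + g y\<close>.
\<close>

lemma g_add_indep:
  assumes x: "\<phi> x = 0" and y: "\<phi> y = 0" and i: "indep2 s1 x y" shows "g (x + y) = g x + g y"
proof -
  have xy: "\<phi> (x + y) = 0" using x y by (simp add: \<phi>_add)
  have nz: "x \<noteq> 0" "y \<noteq> 0" using V1.indep2_nonzero i by blast+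
  obtain u where u: "u \<noteq> 0" "g x = u \<cdot>\<^sub>2 f x" using g_multiple[OF x] nz by metis
  obtain v where v: "v \<noteq> 0" "g y = v \<cdot>\<^sub>2 f y" using g_multiple[OF y] nz by metis
  have "f (x + y) \<in> line s2 (f x) (f y)"
    using f_line[OF i V1.line_add[OF V1.line_left V1.line_right]] .
  then have "g (x + y) \<in> line s2 (f x) (f y)" using g_spec(1)[OF xy] V2.line_scale by metis
  then obtain b c where "g (x + y) = b \<cdot>\<^sub>2 f x + c \<cdot>\<^sub>2 f y" by (metis V2.lineE)
  then have bc: "g (x + y) = (b / u) \<cdot>\<^sub>2 g x + (c / v) \<cdot>\<^sub>2 g y" using u v by simp
  obtain t where t: "t \<noteq> 0" "f (e + (x + y)) = t \<cdot>\<^sub>2 (f e + g (x + y))" using f_e_plus[OF xy] by blast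
  have key: "\<exists>p q. f (e + (x + y)) = p \<cdot>\<^sub>2 f e + p \<cdot>\<^sub>2 g x + q \<cdot>\<^sub>2 g y"
    if x: "\<phi> x = 0" and y: "\<phi> y = 0" and i: "indep2 s1 x y" for x y
  proof -
    note i3 = indep3_e[OF x y i]
    have "indep2 s1 (e + x) y" unfolding indep2_def
    proof (intro allI impI)
      fix a b assume "a \<cdot>\<^sub>1 (e + x) + b \<cdot>\<^sub>1 y = 0"
      then have "a \<cdot>\<^sub>1 e + a \<cdot>\<^sub>1 x + b \<cdot>\<^sub>1 y = 0" by (simp add: algebra_simps)
      from V1.indep3D[OF i3 this] show "a = 0 \<and> b = 0" by simp
    qed
    from f_line[OF this V1.line_add[OF V1.line_left V1.line_right]]
    obtain p q where pq: "f (e + x + y) = p \<cdot>\<^sub>2 f (e + x) + q \<cdot>\<^sub>2 f y" by (metis V2.lineE)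
    obtain t where t: "t \<noteq> 0" "f (e + x) = t \<cdot>\<^sub>2 (f e + g x)" using f_e_plus[OF x] by blast
    obtain v where v: "v \<noteq> 0" "g y = v \<cdot>\<^sub>2 f y" using g_multiple[OF y] V1.indep2_nonzero[OF i] by metis
    have "f (e + (x + y)) = (p * t) \<cdot>\<^sub>2 f e + (p * t) \<cdot>\<^sub>2 g x + (q / v) \<cdot>\<^sub>2 g y"
      using pq t v by (simp add: algebra_simps)
    then show ?thesis by blast
  qed
  obtain p q where 1: "f (e + (x + y)) = p \<cdot>\<^sub>2 f e + p \<cdot>\<^sub>2 g x + q \<cdot>\<^sub>2 g y" using key[OF x y i] by blast
  obtain p' q' where 2: "f (e + (x + y)) = p' \<cdot>\<^sub>2 f e + q' \<cdot>\<^sub>2 g x + p' \<cdot>\<^sub>2 g y"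
    using key[OF y x V1.indep2_sym[OF i]] by (auto simp: ac_simps)
  have 3: "f (e + (x + y)) = t \<cdot>\<^sub>2 f e + (t * (b / u)) \<cdot>\<^sub>2 g x + (t * (c / v)) \<cdot>\<^sub>2 g y"
    using t bc by (simp add: algebra_simps)
  note gi = g_indep3[OF x y i]
  have "t = p \<and> t * (b / u) = p \<and> t * (c / v) = q" using V2.indep3_eqD[OF gi] 1 3 by metis
  moreover have "t = p' \<and> t * (b / u) = q' \<and> t * (c / v) = p'" using V2.indep3_eqD[OF gi] 2 3 by metis
  ultimately have "t * (b / u) = t * 1" "t * (c / v) = t * 1" by auto
  then have 4: "b / u = 1" "c / v = 1" unfolding mult_left_cancel[OF t(1)] by auto
  show ?thesis using bc unfolding 4 V2.scale_one .
qed

text \<open>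
  When \<open>x\<close> and \<open>y\<close> are dependent, compare two ways of computing \<open>g (x + y + z)\<close> for a vector \<open>z\<close>
  of the hyperplane that is independent of them, which exists in dimension at least three.
\<close>

lemma g_add: assumes x: "\<phi> x = 0" and y: "\<phi> y = 0" shows "g (x + y) = g x + g y"
proof (cases "x = 0 \<or> y = 0 \<or> indep2 s1 x y")
  case True then show ?thesis using g_zero g_add_indep x y by auto
next
  case False
  then have nz: "x \<noteq> 0" "y \<noteq> 0" and d: "\<not> indep2 s1 x y" by auto
  obtain z where z: "\<phi> z = 0" "indep2 s1 x z" using exists_H_indep2[OF x nz(1)] by blast
  have yz: "indep2 s1 y z" using V1.par_trans[OF d _ nz(2)] z(2) by blast
  have xy: "\<phi> (x + y) = 0" "\<phi> (y + z) = 0" using x y z by (simp_all add: \<phi>_add)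
  obtain a where a: "y = a \<cdot>\<^sub>1 x" using d V1.not_indep2_iff[OF nz(1)] by blast
  have "indep2 s1 x (y + z)" using V1.indep2_comb[OF z(2), of 1 a] a by simp
  then have "g (x + (y + z)) = g x + g (y + z)" using g_add_indep x xy by blast
  then have 1: "g (x + y + z) = g x + g y + g z" using g_add_indep[OF y z(1) yz] by (simp add: add.assoc)
  have 2: "g (x + y + z) = g (x + y) + g z"
  proof (cases "x + y = 0")
    case True then show ?thesis using g_zero by simp
  next
    case False
    have e: "x + y = (1 + a) \<cdot>\<^sub>1 x" using a by (simp add: algebra_simps)
    have "1 + a \<noteq> 0" using e False by auto
    then have "indep2 s1 (x + y) z" using V1.indep2_scale_iff z(2) unfolding e by blast
    then show ?thesis using g_add_indep[OF xy(1) z(1)] by blast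
  qed
  show ?thesis using 1 2 by simp
qed

lemma \<phi>_H_scale: "\<phi> x = 0 \<Longrightarrow> \<phi> (a \<cdot>\<^sub>1 x) = 0" by (simp add: \<phi>_scale)

lemma g_scale_exists: assumes x: "\<phi> x = 0" "x \<noteq> 0" shows "\<exists>m. g (a \<cdot>\<^sub>1 x) = m \<cdot>\<^sub>2 g x"
proof (cases "a = 0")
  case True then show ?thesis using g_zero by (intro exI[of _ 0]) simp
next
  case False
  have "\<not> indep2 s1 x (a \<cdot>\<^sub>1 x)" using V1.not_indep2_iff[OF x(2)] by blast
  then obtain b where b: "f (a \<cdot>\<^sub>1 x) = b \<cdot>\<^sub>2 f x" using V2.not_indep2_iff[OF f_nonzero[OF x(2)]] f_indep2 by blast
  obtain u where u: "u \<noteq> 0" "g x = u \<cdot>\<^sub>2 f x" using g_multiple[OF x] by metis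
  obtain c where c: "g (a \<cdot>\<^sub>1 x) = c \<cdot>\<^sub>2 f (a \<cdot>\<^sub>1 x)" using g_spec(1)[OF \<phi>_H_scale[OF x(1)]] by blast
  have "g (a \<cdot>\<^sub>1 x) = (c * b / u) \<cdot>\<^sub>2 g x" using b u c by simp
  then show ?thesis ..
qed

text \<open>
  The factor by which \<open>g\<close> scales along \<open>x\<close> equals the one along \<open>y\<close>, because both have to equal the one
  along \<open>x + y\<close>. This is what makes the map of scalars independent of the vector.
\<close>

lemma g_scale_transfer:
  assumes x: "\<phi> x = 0" and y: "\<phi> y = 0" and i: "indep2 s1 x y" and m: "g (a \<cdot>\<^sub>1 x) = m \<cdot>\<^sub>2 g x"
  shows "g (a \<cdot>\<^sub>1 y) = m \<cdot>\<^sub>2 g y"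
proof -
  have nz: "x \<noteq> 0" "y \<noteq> 0" using V1.indep2_nonzero i by blast+
  have xy: "\<phi> (x + y) = 0" using x y by (simp add: \<phi>_add)
  have xyn: "x + y \<noteq> 0" using V1.indep2D[OF i, of 1 1] by auto
  obtain m1 where m1: "g (a \<cdot>\<^sub>1 y) = m1 \<cdot>\<^sub>2 g y" using g_scale_exists[OF y nz(2)] by blast
  obtain m2 where m2: "g (a \<cdot>\<^sub>1 (x + y)) = m2 \<cdot>\<^sub>2 g (x + y)" using g_scale_exists[OF xy xyn] by blast
  have "g (a \<cdot>\<^sub>1 (x + y)) = m \<cdot>\<^sub>2 g x + m1 \<cdot>\<^sub>2 g y"
    using g_add[OF \<phi>_H_scale[OF x] \<phi>_H_scale[OF y]] m m1 by (simp add: V1.scale_right_distrib)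
  moreover have "g (a \<cdot>\<^sub>1 (x + y)) = m2 \<cdot>\<^sub>2 g x + m2 \<cdot>\<^sub>2 g y"
    using m2 g_add[OF x y] by (simp add: V2.scale_right_distrib)
  ultimately have "m = m2 \<and> m1 = m2"
    using V2.indep2_eqD[OF V2.indep3_pairs(3)[OF g_indep3[OF x y i]]] by metis
  then show ?thesis using m1 by simp
qed

lemma scalar_map: "\<exists>\<mu>. \<forall>a x. \<phi> x = 0 \<longrightarrow> g (a \<cdot>\<^sub>1 x) = \<mu> a \<cdot>\<^sub>2 g x"
proof -
  obtain x0 where x0: "\<phi> x0 = 0" and x0n: "x0 \<noteq> 0" using exists_H_nonzero by blast
  obtain \<mu> where \<mu>: "g (a \<cdot>\<^sub>1 x0) = \<mu> a \<cdot>\<^sub>2 g x0" for a using g_scale_exists[OF x0 x0n] by metis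
  have "g (a \<cdot>\<^sub>1 x) = \<mu> a \<cdot>\<^sub>2 g x" if x: "\<phi> x = 0" for a x
  proof (cases "x = 0")
    case True then show ?thesis using g_zero by simp
  next
    case xn: False
    show ?thesis
    proof (cases "indep2 s1 x0 x")
      case True then show ?thesis using g_scale_transfer x0 x \<mu> by blast
    next
      case False
      obtain z where z: "\<phi> z = 0" "indep2 s1 x0 z" using exists_H_indep2[OF x0 x0n] by blast
      have "indep2 s1 z x" using V1.par_trans[OF False] xn z(2) V1.indep2_sym by blast
      then show ?thesis using g_scale_transfer[OF x0 z(1) z(2) \<mu>] g_scale_transfer[OF z(1) x] by blast
    qed
  qed
  then show ?thesis by blast
qed

text \<open>
  The map \<open>g\<close> is semilinear on the hyperplane, and \<open>e \<mapsto> f e\<close> extends it to the whole space. That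
  the map of scalars is onto comes from the surjectivity of \<open>f\<close> on a line through the point of \<open>e\<close>.
\<close>

theorem frame_semilinear:
  "\<exists>\<mu> lam. semilinear_iso s1 s2 \<mu> lam \<and> (\<forall>x. x \<noteq> 0 \<longrightarrow> \<not> indep2 s2 (lam x) (f x))"
proof -
  obtain \<mu> where \<mu>: "\<And>a x. \<phi> x = 0 \<Longrightarrow> g (a \<cdot>\<^sub>1 x) = \<mu> a \<cdot>\<^sub>2 g x" using scalar_map by blast
  obtain x0 where x0: "\<phi> x0 = 0" and x0n: "x0 \<noteq> 0" using exists_H_nonzero by blast
  have gx0: "g x0 \<noteq> 0" using g_nonzero x0 x0n by blast
  have ex0: "indep2 s2 (f e) (f x0)" using indep2_e[OF x0 x0n] f_indep2 by blast
  obtain u where u: "u \<noteq> 0" "g x0 = u \<cdot>\<^sub>2 f x0" using g_multiple[OF x0 x0n] by metis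
  have \<mu>1: "\<mu> 1 = 1"
    using \<mu>[OF x0, of 1] gx0 V2.scale_right_imp_eq[of "g x0" 1 "\<mu> 1"] by simp
  have \<mu>_add: "\<mu> (a + b) = \<mu> a + \<mu> b" for a b
  proof -
    have "\<mu> (a + b) \<cdot>\<^sub>2 g x0 = g (a \<cdot>\<^sub>1 x0 + b \<cdot>\<^sub>1 x0)" using \<mu>[OF x0] by (simp add: V1.scale_left_distrib flip: \<mu>[OF x0])
    also have "\<dots> = (\<mu> a + \<mu> b) \<cdot>\<^sub>2 g x0"
      using g_add[OF \<phi>_H_scale[OF x0] \<phi>_H_scale[OF x0]] \<mu>[OF x0] by (simp add: V2.scale_left_distrib)
    finally show ?thesis using gx0 V2.scale_right_imp_eq by blast
  qed
  have \<mu>_mult: "\<mu> (a * b) = \<mu> a * \<mu> b" for a b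
  proof -
    have "\<mu> (a * b) \<cdot>\<^sub>2 g x0 = (\<mu> a * \<mu> b) \<cdot>\<^sub>2 g x0"
      using \<mu>[OF x0, of "a * b"] \<mu>[OF \<phi>_H_scale[OF x0], of a b] \<mu>[OF x0, of b] by simp
    then show ?thesis using gx0 V2.scale_right_imp_eq by blast
  qed
  have "\<mu> 0 + 0 = \<mu> 0 + \<mu> 0" using \<mu>_add[of 0 0] by (simp only: add_0_right)
  then have \<mu>0: "\<mu> 0 = 0" by (simp only: add_left_cancel)
  have \<mu>nz: "\<mu> a \<noteq> 0" if "a \<noteq> 0" for a using \<mu>_mult[of a "inverse a"] \<mu>1 that by auto
  have "inj \<mu>"
  proof (rule injI)
    fix a b assume h: "\<mu> a = \<mu> b"
    have "\<mu> (a - b) = 0" using \<mu>_add[of "a - b" b] h by simp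
    then show "a = b" using \<mu>nz[of "a - b"] by auto
  qed
  moreover have "surj \<mu>"
  proof (rule surjI_ex)
    fix b
    show "\<exists>a. \<mu> a = b"
    proof -
      let ?w = "f e + b \<cdot>\<^sub>2 g x0"
      have w: "?w \<noteq> 0" using V2.indep2D[OF ex0, of 1 "b * u"] u by auto
      obtain v where v: "v \<noteq> 0" "\<not> indep2 s2 ?w (f v)" using f_surj[OF w] by blast
      obtain t where t: "t \<noteq> 0" "f v = t \<cdot>\<^sub>2 ?w" using V2.not_indep2E[OF v(2) w f_nonzero[OF v(1)]] by blast
      have fv: "f v = t \<cdot>\<^sub>2 f e + (t * b * u) \<cdot>\<^sub>2 f x0" using t u by (simp add: V2.scale_right_distrib mult.assoc)
      have "v \<in> line s1 e x0"
        using V1.indep3_iff[OF indep2_e[OF x0 x0n]] V2.indep3_iff[OF ex0] f_indep3 V2.lineI fv by metis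
      then obtain c d where cd: "v = c \<cdot>\<^sub>1 e + d \<cdot>\<^sub>1 x0" by (metis V1.lineE)
      have c: "c \<noteq> 0"
      proof
        assume "c = 0"
        then have "\<not> indep2 s1 x0 v" using cd V1.not_indep2_iff[OF x0n] by auto
        then obtain r where "f v = r \<cdot>\<^sub>2 f x0" using V2.not_indep2_iff[OF f_nonzero[OF x0n]] f_indep2 by blast
        then have "0 \<cdot>\<^sub>2 f e + r \<cdot>\<^sub>2 f x0 = t \<cdot>\<^sub>2 f e + (t * b * u) \<cdot>\<^sub>2 f x0" using fv by simp
        then show False using V2.indep2_eqD[OF ex0] t(1) by metis
      qed
      let ?a = "d / c"
      have v': "v = c \<cdot>\<^sub>1 (e + ?a \<cdot>\<^sub>1 x0)" using cd c by (simp add: V1.scale_right_distrib)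
      have en: "e + ?a \<cdot>\<^sub>1 x0 \<noteq> 0" using e_plus_nonzero[OF \<phi>_H_scale[OF x0]] .
      have "\<not> indep2 s2 (f (e + ?a \<cdot>\<^sub>1 x0)) (f v)" using V1.not_indep2_iff[OF en] v' f_indep2 by blast
      then have "\<not> indep2 s2 (f e + g (?a \<cdot>\<^sub>1 x0)) (f v)"
        using V2.par_trans g_spec(2)[OF \<phi>_H_scale[OF x0]] f_nonzero[OF en] by blast
      then obtain r where r: "f v = r \<cdot>\<^sub>2 (f e + g (?a \<cdot>\<^sub>1 x0))"
        using V2.not_indep2_iff fe_plus_nonzero[OF \<phi>_H_scale[OF x0]] by blast
      have "r \<cdot>\<^sub>2 f e + (r * \<mu> ?a * u) \<cdot>\<^sub>2 f x0 = t \<cdot>\<^sub>2 f e + (t * b * u) \<cdot>\<^sub>2 f x0"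
        using r fv \<mu>[OF x0] u by (simp add: V2.scale_right_distrib mult.assoc)
      from V2.indep2_eqD[OF ex0 this] have "\<mu> ?a = b" using t u by auto
      then show ?thesis ..
    qed
  qed
  ultimately have bij\<mu>: "bij \<mu>" by (rule bijI)
  define lam where "lam v = \<mu> (\<phi> v) \<cdot>\<^sub>2 f e + g (v - \<phi> v \<cdot>\<^sub>1 e)" for v
  have H: "\<phi> (v - \<phi> v \<cdot>\<^sub>1 e) = 0" for v by (simp add: \<phi>_diff \<phi>_scale \<phi>_e)
  have lam_add: "lam (v + w) = lam v + lam w" for v w
  proof -
    have "v + w - \<phi> (v + w) \<cdot>\<^sub>1 e = (v - \<phi> v \<cdot>\<^sub>1 e) + (w - \<phi> w \<cdot>\<^sub>1 e)" by (simp add: \<phi>_add algebra_simps)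
    then show ?thesis unfolding lam_def using g_add[OF H H] by (simp add: \<phi>_add \<mu>_add algebra_simps)
  qed
  have lam_scale: "lam (a \<cdot>\<^sub>1 v) = \<mu> a \<cdot>\<^sub>2 lam v" for a v
  proof -
    have "a \<cdot>\<^sub>1 v - \<phi> (a \<cdot>\<^sub>1 v) \<cdot>\<^sub>1 e = a \<cdot>\<^sub>1 (v - \<phi> v \<cdot>\<^sub>1 e)" by (simp add: \<phi>_scale algebra_simps)
    then show ?thesis unfolding lam_def using \<mu>[OF H, of a] by (simp add: \<phi>_scale \<mu>_mult algebra_simps)
  qed
  have lam_f: "lam v \<noteq> 0 \<and> \<not> indep2 s2 (lam v) (f v)" if v: "v \<noteq> 0" for v
  proof (cases "\<phi> v = 0")
    case True
    then have l: "lam v = g v" unfolding lam_def by (simp add: \<mu>0)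
    then obtain c where "lam v = c \<cdot>\<^sub>2 f v" using g_spec(1)[OF True] by metis
    then have "\<not> indep2 s2 (lam v) (f v)" using V2.not_indep2_iff[OF f_nonzero[OF v]] V2.indep2_sym by blast
    then show ?thesis using l g_nonzero[OF True v] by simp
  next
    case False
    let ?c = "\<phi> v" and ?x = "inverse (\<phi> v) \<cdot>\<^sub>1 (v - \<phi> v \<cdot>\<^sub>1 e)"
    have x: "\<phi> ?x = 0" using \<phi>_H_scale[OF H] .
    have v': "v = ?c \<cdot>\<^sub>1 (e + ?x)" using False by (simp add: algebra_simps)
    have "lam v = \<mu> ?c \<cdot>\<^sub>2 (f e + g ?x)"
      unfolding lam_def using \<mu>[OF x, of ?c] False by (simp add: V2.scale_right_distrib)
    then have 1: "lam v \<noteq> 0" and 2: "\<not> indep2 s2 (lam v) (f (e + ?x))"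
      using fe_plus_nonzero[OF x] \<mu>nz[OF False] g_spec(2)[OF x] V2.indep2_scale_iff by auto
    have "\<not> indep2 s1 (e + ?x) v" using V1.not_indep2_iff[OF e_plus_nonzero[OF x]] v' by blast
    then show ?thesis using 1 V2.par_trans[OF 2] f_indep2 f_nonzero[OF e_plus_nonzero[OF x]] by blast
  qed
  have "inj lam"
  proof (rule injI)
    fix v w assume h: "lam v = lam w"
    have "lam (v - w) = 0" using lam_add[of "v - w" w] h by simp
    then show "v = w" using lam_f[of "v - w"] by auto
  qed
  moreover have "surj lam"
  proof (rule surjI_ex)
    fix w
    show "\<exists>v. lam v = w"
    proof (cases "w = 0")
      case True then show ?thesis using lam_add[of 0 0] by auto
    next
      case False
      obtain v where v: "v \<noteq> 0" "\<not> indep2 s2 w (f v)" using f_surj[OF False] by blast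
      have "\<not> indep2 s2 (lam v) w"
        using V2.par_trans[OF v(2) _ f_nonzero[OF v(1)]] lam_f[OF v(1)] V2.indep2_sym by blast
      then obtain b where "w = b \<cdot>\<^sub>2 lam v" using V2.not_indep2_iff lam_f[OF v(1)] by blast
      moreover obtain a where "\<mu> a = b" using bij\<mu> by (metis bij_pointE)
      ultimately show ?thesis using lam_scale by metis
    qed
  qed
  ultimately have "bij lam" by (rule bijI)
  then have "semilinear_iso s1 s2 \<mu> lam"
    unfolding semilinear_iso_def using bij\<mu> \<mu>1 \<mu>_add \<mu>_mult lam_add lam_scale by blast
  then show ?thesis using lam_f by blast
qed

end

context collinearity_map
begin

text \<open>
  A coordinate function of a basis that contains \<open>e\<close> serves as \<open>\<phi>\<close>.
\<close>

theorem fundamental_theorem: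
  "\<exists>\<mu> lam. semilinear_iso s1 s2 \<mu> lam \<and> (\<forall>x. x \<noteq> 0 \<longrightarrow> \<not> indep2 s2 (lam x) (f x))"
proof -
  obtain e where "e \<notin> line s1 0 0" using dim3 by blast
  then have e: "e \<noteq> 0" using V1.line_scale[OF V1.line_left, of 0 0 0] by auto
  define B where "B = V1.extend_basis {e}"
  have i: "V1.independent {e}" using e by (simp add: V1.dependent_single)
  have B: "V1.independent B" "e \<in> B" "V1.span B = UNIV"
    unfolding B_def using V1.independent_extend_basis[OF i] V1.extend_basis_superset[OF i]
      V1.span_extend_basis[OF i] by auto
  interpret collinearity_map_frame s1 s2 f e "\<lambda>v. V1.representation B v e"
  proof
    show "V1.representation B e e = 1" using V1.representation_basis[OF B(1,2)] by simp
    show "V1.representation B (x + y) e = V1.representation B x e + V1.representation B y e" for x y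
      using V1.representation_add[OF B(1)] B(3) by simp
    show "V1.representation B (a \<cdot>\<^sub>1 x) e = a * V1.representation B x e" for a x
      using V1.representation_scale[OF B(1)] B(3) by simp
  qed
  show ?thesis by (rule frame_semilinear)
qed

end

section \<open>Ample cones of vectors\<close>

text \<open>
  The vectors that represent the points of an ample set. The assumption \<open>common_parameter\<close> is the form
  in which admissibility is used: three lines that meet the set are parametrised by the same
  projective line, and some parameter \<open>(a : b)\<close> gives points of the set on all three and differs
  from two prescribed parameters \<open>(c\<^sub>1 : d\<^sub>1)\<close> and \<open>(c\<^sub>2 : d\<^sub>2)\<close>. In particular \<open>(a, b) \<noteq> (0, 0)\<close>.
\<close>

locale ample_cone = lin s
  for s :: "'k::field \<Rightarrow> 'v::ab_group_add \<Rightarrow> 'v" (infixr "\<cdot>" 75) +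
  fixes C :: "'v set"
  assumes zero_notin: "0 \<notin> C"
    and cone_scale: "x \<in> C \<Longrightarrow> a \<noteq> 0 \<Longrightarrow> a \<cdot> x \<in> C"
    and cone_nonempty: "C \<noteq> {}"
    and dim3: "\<exists>z. z \<notin> line s x y"
    and common_parameter:
      "\<lbrakk>indep2 s x1 y1; indep2 s x2 y2; indep2 s x3 y3;
        line s x1 y1 \<inter> C \<noteq> {}; line s x2 y2 \<inter> C \<noteq> {}; line s x3 y3 \<inter> C \<noteq> {};
        c1 \<noteq> 0 \<or> d1 \<noteq> 0; c2 \<noteq> 0 \<or> d2 \<noteq> 0\<rbrakk>
       \<Longrightarrow> \<exists>a b. a \<cdot> x1 + b \<cdot> y1 \<in> C \<and> a \<cdot> x2 + b \<cdot> y2 \<in> C \<and> a \<cdot> x3 + b \<cdot> y3 \<in> C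
               \<and> a * d1 \<noteq> b * c1 \<and> a * d2 \<noteq> b * c2"
begin

lemma cone_scale_iff: "a \<noteq> 0 \<Longrightarrow> a \<cdot> x \<in> C \<longleftrightarrow> x \<in> C"
  using cone_scale[of x a] cone_scale[of "a \<cdot> x" "inverse a"] by auto

lemma cone_nonzero: "x \<in> C \<Longrightarrow> x \<noteq> 0"
  using zero_notin by blast

lemma indep2_outside: assumes "p \<noteq> 0" "p \<notin> C" "x \<in> C" shows "indep2 s p x"
proof (rule ccontr)
  assume "\<not> indep2 s p x"
  then obtain a where "a \<noteq> 0" "x = a \<cdot> p" using not_indep2E assms cone_nonzero by metis
  then show False using cone_scale_iff assms by blast
qed

lemma one_parameter:
  assumes "indep2 s x y" "line s x y \<inter> C \<noteq> {}" "c1 \<noteq> 0 \<or> d1 \<noteq> 0" "c2 \<noteq> 0 \<or> d2 \<noteq> 0"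
  shows "\<exists>a b. a \<cdot> x + b \<cdot> y \<in> C \<and> a * d1 \<noteq> b * c1 \<and> a * d2 \<noteq> b * c2"
  using common_parameter[OF assms(1,1,1,2,2,2,3,4)] by blast

lemma interior_point:
  assumes "indep2 s x y" "line s x y \<inter> C \<noteq> {}"
  shows "\<exists>a b. a \<noteq> 0 \<and> b \<noteq> 0 \<and> a \<cdot> x + b \<cdot> y \<in> C"
  using one_parameter[OF assms, of 1 0 0 1] by auto

lemma meets_left: "x \<in> C \<Longrightarrow> line s x y \<inter> C \<noteq> {}"
  using line_left[of x y] by blast

lemma meets_right: "y \<in> C \<Longrightarrow> line s x y \<inter> C \<noteq> {}"
  using line_right[of y x] by blast

text \<open>
  If a point \<open>c\<close> of the set happens to lie on the given line, join it to a point off that line. The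
  joining line meets the set in \<open>c\<close>, hence in further points.
\<close>

lemma exists_off_line: "\<exists>z. z \<in> C \<and> z \<notin> line s u v"
proof -
  obtain c where c: "c \<in> C" using cone_nonempty by blast
  show ?thesis
  proof (cases "c \<in> line s u v")
    case True
    obtain z where z: "z \<notin> line s u v" using dim3 by blast
    have i: "indep2 s c z"
    proof (rule ccontr)
      assume "\<not> indep2 s c z"
      then obtain a where "z = a \<cdot> c" using not_indep2_iff[OF cone_nonzero[OF c]] by blast
      then show False using z True line_scale by blast
    qed
    obtain a b where ab: "a \<noteq> 0" "b \<noteq> 0" "a \<cdot> c + b \<cdot> z \<in> C"
      using interior_point[OF i meets_left[OF c]] by metis
    have "a \<cdot> c + b \<cdot> z \<notin> line s u v"
    proof
      assume "a \<cdot> c + b \<cdot> z \<in> line s u v"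
      then have "a \<cdot> c + b \<cdot> z - a \<cdot> c \<in> line s u v" using line_diff line_scale True by blast
      then show False using z line_scale_iff[OF ab(2)] by simp
    qed
    then show ?thesis using ab by blast
  qed (use c in blast)
qed

lemma cone_line_through:
  assumes "indep2 s p x" "x \<in> C"
  obtains y where "y \<in> C" "indep2 s x y" "p \<in> line s x y" "line s x y = line s p x"
proof -
  obtain a b where ab: "a \<noteq> 0" "b \<noteq> 0" "a \<cdot> p + b \<cdot> x \<in> C"
    using interior_point[OF assms(1) meets_right[OF assms(2)]] by metis
  have "indep2 s x (b \<cdot> x + a \<cdot> p)" by (rule indep2_comb[OF indep2_sym[OF assms(1)] ab(1)])
  then have i: "indep2 s x (a \<cdot> p + b \<cdot> x)" by (simp add: add.commute)
  have e: "line s x (a \<cdot> p + b \<cdot> x) = line s p x" by (rule line_eqI[OF line_right lineI i])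
  show thesis using that[OF ab(3) i _ e] e line_left by simp
qed

lemma cone_line_basis:
  assumes pq: "indep2 s p q" and m: "line s p q \<inter> C \<noteq> {}"
  shows "\<exists>x y. x \<in> C \<and> y \<in> C \<and> indep2 s x y \<and> line s x y = line s p q"
proof -
  obtain x where x: "x \<in> C" "x \<in> line s p q" using m by blast
  show ?thesis
  proof (cases "indep2 s p x")
    case True
    have "line s p x = line s p q" by (rule line_eqI[OF line_left x(2) True])
    then show ?thesis using cone_line_through[OF True x(1)] x(1) by metis
  next
    case False
    have i: "indep2 s q x"
      using par_trans[OF False] indep2_sym pq cone_nonzero[OF x(1)] by blast
    have "line s q x = line s p q" by (rule line_eqI[OF line_right x(2) i])
    then show ?thesis using cone_line_through[OF i x(1)] x(1) by metis
  qed
qed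

text \<open>
  Two lines determine a point as their intersection, so the image of \<open>p\<close> is controlled by two
  lines that meet the set.
\<close>

lemma two_lines:
  assumes "p \<noteq> 0"
  obtains x y u v where "x \<in> C" "y \<in> C" "u \<in> C" "v \<in> C" "indep2 s x y" "indep2 s u v"
    "p \<in> line s x y" "p \<in> line s u v" "u \<notin> line s x y"
proof -
  obtain x where x: "x \<in> C" "x \<notin> line s p p" using exists_off_line by blast
  note px = indep2_off_line[OF assms x(2)]
  obtain y where y: "y \<in> C" "indep2 s x y" "p \<in> line s x y" "line s x y = line s p x"
    using cone_line_through[OF px x(1)] by blast
  obtain u where u: "u \<in> C" "u \<notin> line s p x" using exists_off_line by blast
  note pu = indep2_off_line[OF assms u(2)]
  obtain v where v: "v \<in> C" "indep2 s u v" "p \<in> line s u v" using cone_line_through[OF pu u(1)] by metis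
  show thesis using that x y u v by blast
qed

text \<open>
  Two triangles in perspective from \<open>p\<close>, with vertices \<open>a\<^sub>i\<close> and \<open>t p + a\<^sub>i\<close> on the given lines.
  Corresponding sides meet in \<open>a\<^sub>i - a\<^sub>j\<close>, so these differences have to lie in the set as well. Every
  choice is one instance of \<open>common_parameter\<close>: the first side provides \<open>a\<^sub>1 - a\<^sub>2\<close>; scaling
  \<open>a\<^sub>3\<close> adjusts \<open>a\<^sub>1 - a\<^sub>3\<close> and \<open>a\<^sub>2 - a\<^sub>3\<close> simultaneously; and \<open>t\<close> moves the three vertices of the second
  triangle at once. The last step needs the full strength, three lines and two excluded
  parameters, namely \<open>t = 0\<close> and the value for which the second triangle degenerates.
\<close>

lemma desargues_configuration:
  assumes p: "p \<noteq> 0" "p \<notin> C" and x: "x1 \<in> C" "x2 \<in> C" "x3 \<in> C"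
    and i: "indep3 s p x1 x2" "indep3 s p x1 x3" "indep3 s p x2 x3"
  obtains a1 a2 a3 t where "t \<noteq> 0"
    "a1 \<in> C" "a2 \<in> C" "a3 \<in> C"
    "a1 \<in> line s p x1" "a2 \<in> line s p x2" "a3 \<in> line s p x3"
    "a1 - a2 \<in> C" "a1 - a3 \<in> C" "a2 - a3 \<in> C"
    "t \<cdot> p + a1 \<in> C" "t \<cdot> p + a2 \<in> C" "t \<cdot> p + a3 \<in> C"
    "indep3 s a1 a2 a3" "indep3 s (t \<cdot> p + a1) (t \<cdot> p + a2) (t \<cdot> p + a3)"
proof -
  have x12: "indep2 s x1 x2" using indep3_pairs[OF i(1)] by blast
  have px3: "indep2 s p x3" using indep3_pairs[OF i(2)] by blast
  \<comment> \<open>The given points may be collinear; then the third one is moved along its line.\<close>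
  obtain y3 where y3: "y3 \<in> C" "y3 \<in> line s p x3" "y3 \<notin> line s x1 x2"
  proof (cases "x3 \<in> line s x1 x2")
    case False then show thesis using that x line_right by blast
  next
    case True
    obtain a b where ab: "a \<noteq> 0" "b \<noteq> 0" "a \<cdot> p + b \<cdot> x3 \<in> C"
      using interior_point[OF px3 meets_right[OF x(3)]] by metis
    have "a \<cdot> p + b \<cdot> x3 \<notin> line s x1 x2"
    proof
      assume "a \<cdot> p + b \<cdot> x3 \<in> line s x1 x2"
      then have "a \<cdot> p + b \<cdot> x3 - b \<cdot> x3 \<in> line s x1 x2" using line_diff line_scale True by blast
      then have "p \<in> line s x1 x2" using line_scale_iff[OF ab(1)] by simp
      then show False using three_on_line[OF _ line_left line_right] i(1) by blast
    qed
    then show thesis using that ab lineI by blast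
  qed
  obtain \<alpha> \<beta> where ab: "\<alpha> \<noteq> 0" "\<beta> \<noteq> 0" "\<alpha> \<cdot> x1 + \<beta> \<cdot> x2 \<in> C"
    using interior_point[OF x12 meets_left[OF x(1)]] by metis
  define a1 where "a1 = \<alpha> \<cdot> x1"
  define a2 where "a2 = (- \<beta>) \<cdot> x2"
  have a1: "a1 \<in> C" "a1 \<in> line s p x1" and a2: "a2 \<in> C" "a2 \<in> line s p x2"
    unfolding a1_def a2_def using x ab by (auto intro: cone_scale line_scale line_right simp del: scale_minus_left)
  have a12: "a1 - a2 \<in> C" unfolding a1_def a2_def using ab by simp
  have i123: "indep3 s x1 x2 y3" using indep3_iff[OF x12] y3 by blast
  have ay: "indep3 s a1 a2 y3" unfolding indep3_def
  proof (intro allI impI)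
    fix a b c assume "a \<cdot> a1 + b \<cdot> a2 + c \<cdot> y3 = 0"
    then have "(a * \<alpha>) \<cdot> x1 + (b * (- \<beta>)) \<cdot> x2 + c \<cdot> y3 = 0" unfolding a1_def a2_def by simp
    from indep3D[OF i123 this] show "a = 0 \<and> b = 0 \<and> c = 0" using ab by simp
  qed
  note a1y = indep3_pairs(2)[OF ay] and a2y = indep3_pairs(3)[OF ay]
  obtain \<gamma> \<delta> where gd: "\<gamma> \<noteq> 0" "\<delta> \<noteq> 0" "\<gamma> \<cdot> a1 + \<delta> \<cdot> y3 \<in> C" "\<gamma> \<cdot> a2 + \<delta> \<cdot> y3 \<in> C"
    using common_parameter[OF a1y a2y a2y meets_left[OF a1(1)] meets_left[OF a2(1)] meets_left[OF a2(1)], of 1 0 0 1] by auto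
  define a3 where "a3 = (- (\<delta> / \<gamma>)) \<cdot> y3"
  have a3: "a3 \<in> C" "a3 \<in> line s p x3"
    unfolding a3_def using y3 gd by (auto intro: cone_scale line_scale simp del: scale_minus_left)
  have "\<gamma> \<cdot> (a1 - a3) = \<gamma> \<cdot> a1 + \<delta> \<cdot> y3" "\<gamma> \<cdot> (a2 - a3) = \<gamma> \<cdot> a2 + \<delta> \<cdot> y3"
    unfolding a3_def using gd(1) by (simp_all add: scale_right_distrib scale_right_diff_distrib)
  then have a13: "a1 - a3 \<in> C" and a23: "a2 - a3 \<in> C" using gd cone_scale_iff by metis+
  have a: "indep3 s a1 a2 a3" unfolding indep3_def
  proof (intro allI impI)
    fix a b c assume "a \<cdot> a1 + b \<cdot> a2 + c \<cdot> a3 = 0"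
    then have "a \<cdot> a1 + b \<cdot> a2 + (c * (- (\<delta> / \<gamma>))) \<cdot> y3 = 0" unfolding a3_def by simp
    from indep3D[OF ay this] show "a = 0 \<and> b = 0 \<and> c = 0" using gd by simp
  qed
  \<comment> \<open>If \<open>p = u\<^sub>1 a\<^sub>1 + u\<^sub>2 a\<^sub>2 + u\<^sub>3 a\<^sub>3\<close>, the second triangle has determinant \<open>1 + t (u\<^sub>1 + u\<^sub>2 + u\<^sub>3)\<close>
    relative to the first one. If \<open>p\<close> is not in their span, there is no degeneration and any \<open>\<sigma>\<close> will do.\<close>
  obtain \<sigma> where \<sigma>: "\<And>u1 u2 u3. p = u1 \<cdot> a1 + u2 \<cdot> a2 + u3 \<cdot> a3 \<Longrightarrow> u1 + u2 + u3 = \<sigma>"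
  proof (cases "\<exists>u1 u2 u3. p = u1 \<cdot> a1 + u2 \<cdot> a2 + u3 \<cdot> a3")
    case True
    then obtain u1 u2 u3 where u: "p = u1 \<cdot> a1 + u2 \<cdot> a2 + u3 \<cdot> a3" by blast
    show thesis
    proof (rule that[of "u1 + u2 + u3"])
      fix v1 v2 v3 assume "p = v1 \<cdot> a1 + v2 \<cdot> a2 + v3 \<cdot> a3"
      with u have "v1 \<cdot> a1 + v2 \<cdot> a2 + v3 \<cdot> a3 = u1 \<cdot> a1 + u2 \<cdot> a2 + u3 \<cdot> a3" by simp
      from indep3_eqD[OF a this] show "v1 + v2 + v3 = u1 + u2 + u3" by simp
    qed
  qed blast
  note pa1 = indep2_outside[OF p a1(1)] and pa2 = indep2_outside[OF p a2(1)] and pa3 = indep2_outside[OF p a3(1)]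
  obtain \<kappa> \<mu> where lm: "\<kappa> \<cdot> p + \<mu> \<cdot> a1 \<in> C" "\<kappa> \<cdot> p + \<mu> \<cdot> a2 \<in> C" "\<kappa> \<cdot> p + \<mu> \<cdot> a3 \<in> C"
      "\<kappa> * 1 \<noteq> \<mu> * 0" "\<kappa> * (- \<sigma>) \<noteq> \<mu> * 1"
    using common_parameter[OF pa1 pa2 pa3 meets_right[OF a1(1)] meets_right[OF a2(1)] meets_right[OF a3(1)], of 0 1 1 "- \<sigma>"] by auto
  have \<mu>: "\<mu> \<noteq> 0"
  proof
    assume "\<mu> = 0" then have "\<kappa> \<cdot> p \<in> C" using lm by simp
    then show False using p lm(4) cone_scale_iff by simp
  qed
  define t where "t = \<kappa> / \<mu>"
  have t: "t \<noteq> 0" unfolding t_def using lm \<mu> by simp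
  have b: "t \<cdot> p + x \<in> C" if "\<kappa> \<cdot> p + \<mu> \<cdot> x \<in> C" for x
  proof -
    have "\<mu> \<cdot> (t \<cdot> p + x) = \<kappa> \<cdot> p + \<mu> \<cdot> x" unfolding t_def using \<mu> by (simp add: scale_right_distrib)
    then show ?thesis using that cone_scale_iff[OF \<mu>] by metis
  qed
  have t\<sigma>: "1 + t * \<sigma> \<noteq> 0"
  proof
    assume h: "1 + t * \<sigma> = 0"
    have "\<mu> * (1 + t * \<sigma>) = \<mu> + \<kappa> * \<sigma>" unfolding t_def using \<mu> by (simp add: field_simps)
    then have "\<kappa> * \<sigma> = - \<mu>" using h by (simp add: add_eq_0_iff)
    then have "\<kappa> * (- \<sigma>) = \<mu> * 1" by simp
    then show False using lm by simp
  qed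
  have "indep3 s (t \<cdot> p + a1) (t \<cdot> p + a2) (t \<cdot> p + a3)" unfolding indep3_def
  proof (intro allI impI)
    fix x y z assume h: "x \<cdot> (t \<cdot> p + a1) + y \<cdot> (t \<cdot> p + a2) + z \<cdot> (t \<cdot> p + a3) = 0"
    let ?w = "x + y + z"
    have e: "(?w * t) \<cdot> p + (x \<cdot> a1 + y \<cdot> a2 + z \<cdot> a3) = 0" using h by (simp add: algebra_simps)
    have w: "?w = 0"
    proof (rule ccontr)
      assume w: "?w \<noteq> 0"
      let ?r = "- inverse (?w * t)"
      have "(?w * t) \<cdot> p = - (x \<cdot> a1 + y \<cdot> a2 + z \<cdot> a3)" using e by (simp add: add_eq_0_iff)
      then have "inverse (?w * t) \<cdot> (?w * t) \<cdot> p = inverse (?w * t) \<cdot> (- (x \<cdot> a1 + y \<cdot> a2 + z \<cdot> a3))" by simp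
      moreover have "inverse (?w * t) * (?w * t) = 1" using w t by (intro left_inverse) simp
      ultimately have "p = (?r * x) \<cdot> a1 + (?r * y) \<cdot> a2 + (?r * z) \<cdot> a3"
        by (simp add: scale_right_distrib scale_right_diff_distrib del: inverse_mult_distrib)
      then have "?r * x + ?r * y + ?r * z = \<sigma>" by (rule \<sigma>)
      then have "\<sigma> = ?r * ?w" by (simp add: algebra_simps)
      moreover have "1 + t * (- inverse (W * t) * W) = 0" if "W \<noteq> 0" for W
        using that t by (simp add: field_simps)
      ultimately have "1 + t * \<sigma> = 0" using w by metis
      then show False using t\<sigma> by simp
    qed
    then have "x \<cdot> a1 + y \<cdot> a2 + z \<cdot> a3 = 0" using e by simp
    from indep3D[OF a this] show "x = 0 \<and> y = 0 \<and> z = 0" .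
  qed
  then show thesis using that[OF t a1(1) a2(1) a3(1) a1(2) a2(2) a3(2) a12 a13 a23 b b b a] lm by blast
qed

text \<open>
  For a line that misses the set, the axis is given, and the triangles and their centre are
  chosen. With a common scaling \<open>c\<close> the sides of both triangles are \<open>c p\<close>, \<open>c q\<close> and
  \<open>c (q - p)\<close>. The centre \<open>o'\<close> has nonzero coordinates with respect to the first triangle, which keeps
  it off the sides; the second triangle is obtained from the first by adding a multiple of \<open>o'\<close>.
\<close>

lemma desargues_configuration_axis:
  assumes i: "indep2 s p q" and d: "line s p q \<inter> C = {}"
  obtains a1 a2 a3 o' b1 b2 b3 c where "c \<noteq> 0"
    "a1 \<in> C" "a2 \<in> C" "a3 \<in> C" "b1 \<in> C" "b2 \<in> C" "b3 \<in> C" "o' \<in> C"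
    "a1 - a2 = c \<cdot> p" "a1 - a3 = c \<cdot> q"
    "b1 - b2 = c \<cdot> p" "b1 - b3 = c \<cdot> q"
    "o' \<in> line s a1 b1" "o' \<in> line s a2 b2" "o' \<in> line s a3 b3"
    "indep2 s o' b1" "indep2 s o' b2" "indep2 s o' b3"
    "indep2 s a1 b1" "indep2 s a2 b2" "indep2 s a3 b3"
    "indep3 s a1 a2 o'" "indep3 s a1 a3 o'" "indep3 s a2 a3 o'"
proof -
  have notin: "u \<notin> C" if "u \<in> line s p q" for u using d that by blast
  obtain a1 where a1: "a1 \<in> C" using cone_nonempty by blast
  have pq0: "p \<noteq> 0" "q \<noteq> 0" using indep2_nonzero[OF i] by blast+
  have a1n: "a1 \<notin> line s p q" using notin a1 by blast
  have i3: "indep3 s p q a1" using indep3_iff[OF i] a1n by blast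
  have ap: "indep2 s a1 p" and aq: "indep2 s a1 q" using indep3_pairs[OF i3] indep2_sym by blast+
  obtain \<alpha> \<beta> where ab: "\<alpha> \<cdot> a1 + \<beta> \<cdot> p \<in> C" "\<alpha> \<cdot> a1 + \<beta> \<cdot> q \<in> C" "\<beta> \<noteq> 0"
    using common_parameter[OF ap aq aq meets_left[OF a1] meets_left[OF a1] meets_left[OF a1], of 1 0 1 0] by auto
  \<comment> \<open>The line through \<open>p\<close> and \<open>q\<close> misses the set.\<close>
  have \<alpha>: "\<alpha> \<noteq> 0"
  proof
    assume "\<alpha> = 0" then have "\<beta> \<cdot> p \<in> C" using ab by simp
    then show False using notin line_scale line_left by blast
  qed
  define c where "c = - (\<beta> / \<alpha>)"
  have c: "c \<noteq> 0" unfolding c_def using \<alpha> ab by simp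
  define a2 where "a2 = a1 - c \<cdot> p"
  define a3 where "a3 = a1 - c \<cdot> q"
  have "\<alpha> \<cdot> a2 = \<alpha> \<cdot> a1 + \<beta> \<cdot> p" "\<alpha> \<cdot> a3 = \<alpha> \<cdot> a1 + \<beta> \<cdot> q"
    unfolding a2_def a3_def c_def using \<alpha> by (simp_all add: scale_right_distrib)
  then have a2: "a2 \<in> C" and a3: "a3 \<in> C" using ab cone_scale_iff[OF \<alpha>] by metis+
  have a: "indep3 s a1 a2 a3" unfolding indep3_def
  proof (intro allI impI)
    fix x y z assume "x \<cdot> a1 + y \<cdot> a2 + z \<cdot> a3 = 0"
    then have "(- (y * c)) \<cdot> p + (- (z * c)) \<cdot> q + (x + y + z) \<cdot> a1 = 0"
      unfolding a2_def a3_def by (simp add: algebra_simps)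
    from indep3D[OF i3 this] show "x = 0 \<and> y = 0 \<and> z = 0" using c by auto
  qed
  obtain \<gamma> \<delta> where gd: "\<gamma> \<noteq> 0" "\<delta> \<noteq> 0" "\<gamma> \<cdot> a2 + \<delta> \<cdot> a3 \<in> C"
    using interior_point[OF indep3_pairs(3)[OF a] meets_left[OF a2]] by metis
  let ?x = "\<gamma> \<cdot> a2 + \<delta> \<cdot> a3"
  have ax: "indep2 s a1 ?x" unfolding indep2_def
  proof (intro allI impI)
    fix u v assume "u \<cdot> a1 + v \<cdot> ?x = 0"
    then have "u \<cdot> a1 + (v * \<gamma>) \<cdot> a2 + (v * \<delta>) \<cdot> a3 = 0" by (simp add: algebra_simps)
    from indep3D[OF a this] show "u = 0 \<and> v = 0" using gd by simp
  qed
  obtain \<epsilon> \<zeta> where ez: "\<epsilon> \<noteq> 0" "\<zeta> \<noteq> 0" "\<epsilon> \<cdot> a1 + \<zeta> \<cdot> ?x \<in> C"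
    using interior_point[OF ax meets_left[OF a1]] by metis
  define o' where "o' = \<epsilon> \<cdot> a1 + \<zeta> \<cdot> ?x"
  have o_C: "o' \<in> C" using ez unfolding o'_def by simp
  have o_eq: "o' = \<epsilon> \<cdot> a1 + (\<zeta> * \<gamma>) \<cdot> a2 + (\<zeta> * \<delta>) \<cdot> a3" unfolding o'_def by (simp add: algebra_simps)
  have oi: "indep3 s a1 a2 o'" "indep3 s a1 a3 o'" "indep3 s a2 a3 o'"
  proof -
    show "indep3 s a1 a2 o'" unfolding indep3_def
    proof (intro allI impI)
      fix x y z assume "x \<cdot> a1 + y \<cdot> a2 + z \<cdot> o' = 0"
      then have "(x + z * \<epsilon>) \<cdot> a1 + (y + z * (\<zeta> * \<gamma>)) \<cdot> a2 + (z * (\<zeta> * \<delta>)) \<cdot> a3 = 0"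
        unfolding o_eq by (simp add: algebra_simps)
      from indep3D[OF a this] show "x = 0 \<and> y = 0 \<and> z = 0" using ez gd by auto
    qed
    show "indep3 s a1 a3 o'" unfolding indep3_def
    proof (intro allI impI)
      fix x y z assume "x \<cdot> a1 + y \<cdot> a3 + z \<cdot> o' = 0"
      then have "(x + z * \<epsilon>) \<cdot> a1 + (z * (\<zeta> * \<gamma>)) \<cdot> a2 + (y + z * (\<zeta> * \<delta>)) \<cdot> a3 = 0"
        unfolding o_eq by (simp add: algebra_simps)
      from indep3D[OF a this] show "x = 0 \<and> y = 0 \<and> z = 0" using ez gd by auto
    qed
    show "indep3 s a2 a3 o'" unfolding indep3_def
    proof (intro allI impI)
      fix x y z assume "x \<cdot> a2 + y \<cdot> a3 + z \<cdot> o' = 0"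
      then have "(z * \<epsilon>) \<cdot> a1 + (x + z * (\<zeta> * \<gamma>)) \<cdot> a2 + (y + z * (\<zeta> * \<delta>)) \<cdot> a3 = 0"
        unfolding o_eq by (simp add: algebra_simps)
      from indep3D[OF a this] show "x = 0 \<and> y = 0 \<and> z = 0" using ez gd by auto
    qed
  qed
  have ao: "indep2 s a1 o'" "indep2 s a2 o'" "indep2 s a3 o'" using oi indep3_pairs by blast+
  obtain \<kappa> \<mu> where lm: "\<kappa> \<cdot> a1 + \<mu> \<cdot> o' \<in> C" "\<kappa> \<cdot> a2 + \<mu> \<cdot> o' \<in> C" "\<kappa> \<cdot> a3 + \<mu> \<cdot> o' \<in> C" "\<kappa> \<noteq> 0" "\<mu> \<noteq> 0"
    using common_parameter[OF ao meets_left[OF a1] meets_left[OF a2] meets_left[OF a3], of 1 0 0 1] by auto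
  let ?t = "\<mu> / \<kappa>"
  have t: "?t \<noteq> 0" using lm by simp
  have b: "x + ?t \<cdot> o' \<in> C" if "\<kappa> \<cdot> x + \<mu> \<cdot> o' \<in> C" for x
  proof -
    have "\<kappa> \<cdot> (x + ?t \<cdot> o') = \<kappa> \<cdot> x + \<mu> \<cdot> o'" using lm by (simp add: scale_right_distrib)
    then show ?thesis using that cone_scale_iff[OF lm(4)] by metis
  qed
  have bo: "o' \<in> line s x (x + ?t \<cdot> o')" for x
  proof -
    have "?t \<cdot> o' \<in> line s x (x + ?t \<cdot> o')" using line_diff[OF line_right[of "x + ?t \<cdot> o'" x] line_left] by simp
    then show ?thesis using line_scale_iff[OF t] by blast
  qed
  have bi: "indep2 s o' (x + ?t \<cdot> o')" "indep2 s x (x + ?t \<cdot> o')" if "indep2 s x o'" for x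
    using indep2_comb[OF indep2_sym[OF that], of 1 ?t] indep2_comb[OF that t, of 1]
    by (simp_all add: add.commute)
  show thesis
    by (rule that[OF c a1 a2 a3 b[OF lm(1)] b[OF lm(2)] b[OF lm(3)] o_C _ _ _ _ bo bo bo bi(1)[OF ao(1)]
         bi(1)[OF ao(2)] bi(1)[OF ao(3)] bi(2)[OF ao(1)] bi(2)[OF ao(2)] bi(2)[OF ao(3)] oi])
      (simp_all add: a2_def a3_def)
qed

end

section \<open>Extending a collinearity-preserving map off an ample cone\<close>

text \<open>
  A map that preserves and reflects collinearity on an ample set, lifted to representing vectors.
\<close>

locale cone_morphism = V1: ample_cone s1 C1 + V2: lin s2
  for s1 :: "'k1::field \<Rightarrow> 'v1::ab_group_add \<Rightarrow> 'v1" (infixr "\<cdot>\<^sub>1" 75) and C1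
    and s2 :: "'k2::field \<Rightarrow> 'v2::ab_group_add \<Rightarrow> 'v2" (infixr "\<cdot>\<^sub>2" 75) +
  fixes h :: "'v1 \<Rightarrow> 'v2"
  assumes h_indep2: "\<lbrakk>x \<in> C1; y \<in> C1\<rbrakk> \<Longrightarrow> indep2 s2 (h x) (h y) \<longleftrightarrow> indep2 s1 x y"
    and h_indep3: "\<lbrakk>x \<in> C1; y \<in> C1; z \<in> C1\<rbrakk> \<Longrightarrow> indep3 s2 (h x) (h y) (h z) \<longleftrightarrow> indep3 s1 x y z"
begin

lemma h_line:
  assumes "x \<in> C1" "y \<in> C1" "z \<in> C1" "indep2 s1 x y"
  shows "h z \<in> line s2 (h x) (h y) \<longleftrightarrow> z \<in> line s1 x y"
  using assms h_indep2 h_indep3 V1.indep3_iff V2.indep3_iff by metis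

text \<open>
  The image of a line that meets the ample set does not depend on the two points used to span it.
\<close>

lemma h_line_eq:
  assumes "x \<in> C1" "y \<in> C1" "u \<in> C1" "v \<in> C1" "indep2 s1 x y" "indep2 s1 u v"
    and "u \<in> line s1 x y" "v \<in> line s1 x y"
  shows "line s2 (h u) (h v) = line s2 (h x) (h y)"
  using V2.line_eqI h_line h_indep2 assms by metis

lemma h_nonzero: assumes "x \<in> C1" shows "h x \<noteq> 0"
proof -
  obtain y where y: "y \<in> C1" "y \<notin> line s1 x x" using V1.exists_off_line by blast
  then have "indep2 s1 x y" using V1.indep2_off_line V1.cone_nonzero[OF assms] by blast
  then show ?thesis using h_indep2[OF assms y(1)] V2.indep2_nonzero by blast
qed

text \<open>
  The relation that \<open>q\<close> represents the image of \<open>p\<close>: it lies on the image of every line through \<open>p\<close>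
  that meets the ample set. For points of the set this is consistent with \<open>h\<close>, so no case
  distinction is needed.
\<close>

definition extends where
  "extends p q \<longleftrightarrow> q \<noteq> 0 \<and>
     (\<forall>x\<in>C1. \<forall>y\<in>C1. indep2 s1 x y \<longrightarrow> p \<in> line s1 x y \<longrightarrow> q \<in> line s2 (h x) (h y))"

lemma extendsD:
  "extends p q \<Longrightarrow> x \<in> C1 \<Longrightarrow> y \<in> C1 \<Longrightarrow> indep2 s1 x y \<Longrightarrow> p \<in> line s1 x y \<Longrightarrow> q \<in> line s2 (h x) (h y)"
  unfolding extends_def by blast

lemma extends_nonzero: "extends p q \<Longrightarrow> q \<noteq> 0"
  unfolding extends_def by blast

lemma extends_self: "p \<in> C1 \<Longrightarrow> extends p (h p)"
  unfolding extends_def using h_nonzero h_line by blast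

lemma extends_scale: "c \<noteq> 0 \<Longrightarrow> extends (c \<cdot>\<^sub>1 p) q \<longleftrightarrow> extends p q"
  unfolding extends_def using V1.line_scale_iff by simp

lemma extends_unique:
  assumes "p \<noteq> 0" "extends p q" "extends p q'"
  shows "\<not> indep2 s2 q q'"
proof -
  obtain x y u v where *: "x \<in> C1" "y \<in> C1" "u \<in> C1" "v \<in> C1" "indep2 s1 x y" "indep2 s1 u v"
    "p \<in> line s1 x y" "p \<in> line s1 u v" "u \<notin> line s1 x y" using V1.two_lines[OF assms(1)] by metis
  have u: "h u \<notin> line s2 (h x) (h y)" using h_line * by blast
  show ?thesis
    using V2.meet_unique[OF _ _ _ _ u] extendsD[OF assms(2)] extendsD[OF assms(3)] * by metis
qed

text \<open>
  The configuration of \<open>desargues_configuration\<close> has all its points except \<open>p\<close> in the ample set, so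
  its image satisfies the hypotheses of the converse of Desargues' theorem, whose centre is the
  point \<open>q\<close>.
\<close>

lemma three_images_concur:
  assumes p: "p \<noteq> 0" "p \<notin> C1" and x: "x1 \<in> C1" "x2 \<in> C1" "x3 \<in> C1"
    and i: "indep3 s1 p x1 x2" "indep3 s1 p x1 x3" "indep3 s1 p x2 x3"
  shows "\<exists>q. q \<noteq> 0 \<and> (\<forall>x\<in>{x1, x2, x3}. \<forall>u\<in>C1. \<forall>v\<in>C1. indep2 s1 u v \<longrightarrow> line s1 u v = line s1 p x
            \<longrightarrow> q \<in> line s2 (h u) (h v))"
proof -
  obtain a1 a2 a3 t where t: "t \<noteq> 0"
    and a: "a1 \<in> C1" "a2 \<in> C1" "a3 \<in> C1"
    and ax: "a1 \<in> line s1 p x1" "a2 \<in> line s1 p x2" "a3 \<in> line s1 p x3"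
    and c: "a1 - a2 \<in> C1" "a1 - a3 \<in> C1" "a2 - a3 \<in> C1"
    and b: "t \<cdot>\<^sub>1 p + a1 \<in> C1" "t \<cdot>\<^sub>1 p + a2 \<in> C1" "t \<cdot>\<^sub>1 p + a3 \<in> C1"
    and ai: "indep3 s1 a1 a2 a3" and bi: "indep3 s1 (t \<cdot>\<^sub>1 p + a1) (t \<cdot>\<^sub>1 p + a2) (t \<cdot>\<^sub>1 p + a3)"
    using V1.desargues_configuration[OF p x i] by metis
  let ?b1 = "t \<cdot>\<^sub>1 p + a1" and ?b2 = "t \<cdot>\<^sub>1 p + a2" and ?b3 = "t \<cdot>\<^sub>1 p + a3"
  have ab: "indep2 s1 y (t \<cdot>\<^sub>1 p + y)" if "y \<in> C1" for y
    using V1.indep2_comb[OF V1.indep2_sym[OF V1.indep2_outside[OF p that]] t, of 1] by (simp add: add.commute)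
  have dl: "y - z \<in> line s1 y z" for y z
    by (rule V1.line_diff[OF V1.line_left V1.line_right])
  have dl': "y - z \<in> line s1 (t \<cdot>\<^sub>1 p + y) (t \<cdot>\<^sub>1 p + z)" for y z
    using dl[of "t \<cdot>\<^sub>1 p + y" "t \<cdot>\<^sub>1 p + z"] by simp
  note aij = V1.indep3_pairs[OF ai] and bij = V1.indep3_pairs[OF bi]
  have "\<exists>q. q \<noteq> 0 \<and> q \<in> line s2 (h a1) (h ?b1) \<and> q \<in> line s2 (h a2) (h ?b2) \<and> q \<in> line s2 (h a3) (h ?b3)"
  proof (rule V2.desargues_converse)
    show "indep3 s2 (h a1) (h a2) (h a3)" using ai a h_indep3 by blast
    show "indep3 s2 (h ?b1) (h ?b2) (h ?b3)" using bi b h_indep3 by blast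
    show "indep2 s2 (h a1) (h ?b1)" "indep2 s2 (h a2) (h ?b2)" "indep2 s2 (h a3) (h ?b3)"
      using ab a b h_indep2 by blast+
    show "h (a1 - a2) \<in> line s2 (h a1) (h a2)" "h (a1 - a2) \<in> line s2 (h ?b1) (h ?b2)"
      "h (a1 - a3) \<in> line s2 (h a1) (h a3)" "h (a1 - a3) \<in> line s2 (h ?b1) (h ?b3)"
      "h (a2 - a3) \<in> line s2 (h a2) (h a3)" "h (a2 - a3) \<in> line s2 (h ?b2) (h ?b3)"
      using h_line a b c aij bij dl dl' by simp_all
    show "h (a1 - a2) \<noteq> 0" "h (a1 - a3) \<noteq> 0" "h (a2 - a3) \<noteq> 0" using h_nonzero c by blast+
    have "1 \<cdot>\<^sub>1 (a1 - a2) + (-1) \<cdot>\<^sub>1 (a1 - a3) + 1 \<cdot>\<^sub>1 (a2 - a3) = 0" by simp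
    then have "\<not> indep3 s1 (a1 - a2) (a1 - a3) (a2 - a3)" using V1.indep3D by fastforce
    then show "\<not> indep3 s2 (h (a1 - a2)) (h (a1 - a3)) (h (a2 - a3))" using h_indep3 c by blast
  qed
  then obtain q where q: "q \<noteq> 0" "q \<in> line s2 (h a1) (h ?b1)" "q \<in> line s2 (h a2) (h ?b2)" "q \<in> line s2 (h a3) (h ?b3)"
    by blast
  have "q \<in> line s2 (h u) (h v)"
    if y: "y \<in> C1" "t \<cdot>\<^sub>1 p + y \<in> C1" "y \<in> line s1 p x" "q \<in> line s2 (h y) (h (t \<cdot>\<^sub>1 p + y))"
      and uv: "u \<in> C1" "v \<in> C1" "indep2 s1 u v" "line s1 u v = line s1 p x" for u v y x
  proof -
    have "t \<cdot>\<^sub>1 p + y \<in> line s1 u v" unfolding uv(4)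
      by (rule V1.line_add[OF V1.line_scale[OF V1.line_left] y(3)])
    then have "line s2 (h y) (h (t \<cdot>\<^sub>1 p + y)) = line s2 (h u) (h v)"
      using h_line_eq[OF uv(1,2) y(1,2) uv(3) ab[OF y(1)]] y(3) uv(4) by simp
    then show ?thesis using y(4) by simp
  qed
  then show ?thesis using q a b ax by (intro exI[of _ q]) auto
qed

text \<open>
  Fix two lines through \<open>p\<close>. Their images meet in one point only, and by \<open>three_images_concur\<close> the
  image of every third line passes through that point. To obtain the point itself some third
  line is needed; it is taken in the plane of the first two.
\<close>

lemma extends_exists:
  assumes p: "p \<noteq> 0" shows "\<exists>q. extends p q"
proof (cases "p \<in> C1")
  case True then show ?thesis using extends_self by blast
next
  case False
  obtain x1 where x1: "x1 \<in> C1" using V1.cone_nonempty by blast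
  have px1: "indep2 s1 p x1" using V1.indep2_outside[OF p False x1] .
  obtain x2 where x2: "x2 \<in> C1" "x2 \<notin> line s1 p x1" using V1.exists_off_line by blast
  have px2: "indep2 s1 p x2" using V1.indep2_outside[OF p False x2(1)] .
  have i12: "indep3 s1 p x1 x2" using V1.indep3_iff[OF px1] x2 by blast
  have x12: "indep2 s1 x1 x2" using V1.indep3_pairs[OF i12] by blast
  obtain y1 where y1: "y1 \<in> C1" "indep2 s1 x1 y1" "p \<in> line s1 x1 y1" "line s1 x1 y1 = line s1 p x1"
    using V1.cone_line_through[OF px1 x1] by blast
  obtain y2 where y2: "y2 \<in> C1" "indep2 s1 x2 y2" "p \<in> line s1 x2 y2" "line s1 x2 y2 = line s1 p x2"
    using V1.cone_line_through[OF px2 x2(1)] by blast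
  have "h x2 \<notin> line s2 (h x1) (h y1)" using h_line[OF x1 y1(1) x2(1) y1(2)] x2(2) y1(4) by simp
  note meet = V2.meet_unique[OF _ _ _ _ this, where v = "h y2"]
  have third: "\<exists>q. q \<noteq> 0 \<and> q \<in> line s2 (h x1) (h y1) \<and> q \<in> line s2 (h x2) (h y2) \<and>
      (\<forall>u\<in>C1. \<forall>v\<in>C1. indep2 s1 u v \<longrightarrow>
        line s1 u v = line s1 p x1 \<or> line s1 u v = line s1 p x2 \<or> line s1 u v = line s1 p x3 \<longrightarrow> q \<in> line s2 (h u) (h v))"
    if x3: "x3 \<in> C1" "x3 \<notin> line s1 p x1" "x3 \<notin> line s1 p x2" for x3
  proof -
    have i: "indep3 s1 p x1 x3" "indep3 s1 p x2 x3" using V1.indep3_iff px1 px2 x3 by blast+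
    obtain q where "q \<noteq> 0" and
      q: "\<And>x u v. x \<in> {x1, x2, x3} \<Longrightarrow> u \<in> C1 \<Longrightarrow> v \<in> C1 \<Longrightarrow> indep2 s1 u v \<Longrightarrow> line s1 u v = line s1 p x
            \<Longrightarrow> q \<in> line s2 (h u) (h v)" using three_images_concur[OF p False x1 x2(1) x3(1) i12 i] by metis
    have "q \<in> line s2 (h x1) (h y1)" by (rule q[of x1]) (use x1 y1 in auto)
    moreover have "q \<in> line s2 (h x2) (h y2)" by (rule q[of x2]) (use x2 y2 in auto)
    ultimately show ?thesis using \<open>q \<noteq> 0\<close> q by (intro exI[of _ q]) auto
  qed
  obtain a b where ab: "a \<noteq> 0" "b \<noteq> 0" "a \<cdot>\<^sub>1 x1 + b \<cdot>\<^sub>1 x2 \<in> C1"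
    using V1.interior_point[OF x12 V1.meets_left[OF x1]] by metis
  let ?x3 = "a \<cdot>\<^sub>1 x1 + b \<cdot>\<^sub>1 x2"
  have x3: "?x3 \<notin> line s1 p x1" "?x3 \<notin> line s1 p x2"
  proof -
    show "?x3 \<notin> line s1 p x1"
    proof
      assume "?x3 \<in> line s1 p x1"
      then have "?x3 - a \<cdot>\<^sub>1 x1 \<in> line s1 p x1" by (rule V1.line_diff[OF _ V1.line_scale[OF V1.line_right]])
      then show False using x2 V1.line_scale_iff[OF ab(2)] by simp
    qed
    show "?x3 \<notin> line s1 p x2"
    proof
      assume "?x3 \<in> line s1 p x2"
      then have "?x3 - b \<cdot>\<^sub>1 x2 \<in> line s1 p x2" by (rule V1.line_diff[OF _ V1.line_scale[OF V1.line_right]])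
      then have "x1 \<in> line s1 p x2" using V1.line_scale_iff[OF ab(1)] by simp
      then show False using i12 V1.three_on_line[OF V1.line_left _ V1.line_right] by blast
    qed
  qed
  obtain q where q: "q \<noteq> 0" "q \<in> line s2 (h x1) (h y1)" "q \<in> line s2 (h x2) (h y2)"
    and q12: "\<And>u v. u \<in> C1 \<Longrightarrow> v \<in> C1 \<Longrightarrow> indep2 s1 u v \<Longrightarrow>
        line s1 u v = line s1 p x1 \<or> line s1 u v = line s1 p x2 \<Longrightarrow> q \<in> line s2 (h u) (h v)"
    using third[OF ab(3) x3] by metis
  have "q \<in> line s2 (h u) (h v)" if uv: "u \<in> C1" "v \<in> C1" "indep2 s1 u v" "p \<in> line s1 u v" for u v
  proof -
    have pu: "indep2 s1 p u" using V1.indep2_outside[OF p False uv(1)] .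
    have e: "line s1 u v = line s1 p u" using V1.line_eqI[OF uv(4) V1.line_left pu] by simp
    show ?thesis
    proof (cases "u \<in> line s1 p x1 \<or> u \<in> line s1 p x2")
      case True
      then have "line s1 u v = line s1 p x1 \<or> line s1 u v = line s1 p x2"
        using V1.line_eqI[OF V1.line_left _ pu] e by auto
      then show ?thesis using q12[OF uv(1-3)] by blast
    next
      case False
      then obtain q' where q': "q' \<noteq> 0" "q' \<in> line s2 (h x1) (h y1)" "q' \<in> line s2 (h x2) (h y2)"
        and uv': "q' \<in> line s2 (h u) (h v)" using third[OF uv(1)] uv(1-3) e by blast
      obtain c where "q = c \<cdot>\<^sub>2 q'" using meet[OF q'(2) q(2) q'(3) q(3)] V2.not_indep2_iff[OF q'(1)] by blast
      then show ?thesis using V2.line_scale[OF uv'] by simp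
    qed
  qed
  then have "extends p q" unfolding extends_def using q(1) by blast
  then show ?thesis ..
qed

text \<open>
  Desargues' theorem for the image of the configuration of \<open>desargues_configuration_axis\<close>. The
  points \<open>p'\<close>, \<open>q'\<close>, \<open>r'\<close> lie on the images of corresponding sides, since these sides meet the ample set.
\<close>

lemma extends_collinear_axis:
  assumes i: "indep2 s1 p q" and d: "line s1 p q \<inter> C1 = {}"
    and e: "extends p p'" "extends q q'" "extends (q - p) r'"
  shows "\<not> indep3 s2 p' q' r'"
proof -
  obtain a1 a2 a3 o' b1 b2 b3 c where c: "c \<noteq> 0"
    and C: "a1 \<in> C1" "a2 \<in> C1" "a3 \<in> C1" "b1 \<in> C1" "b2 \<in> C1" "b3 \<in> C1" "o' \<in> C1"
    and a: "a1 - a2 = c \<cdot>\<^sub>1 p" "a1 - a3 = c \<cdot>\<^sub>1 q"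
    and b: "b1 - b2 = c \<cdot>\<^sub>1 p" "b1 - b3 = c \<cdot>\<^sub>1 q"
    and ol: "o' \<in> line s1 a1 b1" "o' \<in> line s1 a2 b2" "o' \<in> line s1 a3 b3"
    and ob: "indep2 s1 o' b1" "indep2 s1 o' b2" "indep2 s1 o' b3"
    and ab: "indep2 s1 a1 b1" "indep2 s1 a2 b2" "indep2 s1 a3 b3"
    and oi: "indep3 s1 a1 a2 o'" "indep3 s1 a1 a3 o'" "indep3 s1 a2 a3 o'"
  proof (rule V1.desargues_configuration_axis[OF i d], goal_cases)
    case 1
    show thesis by (rule 1(1)[OF 1(2-)])
  qed
  have r: "a2 - a3 = c \<cdot>\<^sub>1 (q - p)" "b2 - b3 = c \<cdot>\<^sub>1 (q - p)"
  proof -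
    have "a2 - a3 = (a1 - a3) - (a1 - a2)" "b2 - b3 = (b1 - b3) - (b1 - b2)" by simp_all
    then show "a2 - a3 = c \<cdot>\<^sub>1 (q - p)" "b2 - b3 = c \<cdot>\<^sub>1 (q - p)"
      unfolding a b by (simp_all add: V1.scale_right_diff_distrib)
  qed
  have side: "w' \<in> line s2 (h x) (h y)" if "x \<in> C1" "y \<in> C1" "x - y = c \<cdot>\<^sub>1 w" "extends w w'" "w \<noteq> 0" "w \<notin> C1" for x y w w'
  proof -
    have l: "w \<in> line s1 x y"
      using V1.line_diff[OF V1.line_left V1.line_right, of x y] that(3) V1.line_scale_iff[OF c] by metis
    have "indep2 s1 x (1 \<cdot>\<^sub>1 x + (- c) \<cdot>\<^sub>1 w)"
      using V1.indep2_comb[of x w "- c" 1] c V1.indep2_sym[OF V1.indep2_outside[OF that(5,6,1)]] by simp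
    moreover have "1 \<cdot>\<^sub>1 x + (- c) \<cdot>\<^sub>1 w = y" using that(3) by (simp flip: that(3))
    ultimately show ?thesis using extendsD[OF that(4,1,2) _ l] by simp
  qed
  have nz: "p \<noteq> 0" "q \<noteq> 0" "q - p \<noteq> 0"
    using V1.indep2_nonzero[OF i] V1.indep2D[OF i, of 1 "-1"] by auto
  have out: "p \<notin> C1" "q \<notin> C1" "q - p \<notin> C1"
    using d V1.line_left[of p q] V1.line_right[of q p] V1.line_diff[OF V1.line_right V1.line_left, of q p] by auto
  have ao: "indep2 s1 o' a1" "indep2 s1 o' a2" "indep2 s1 o' a3"
    using V1.indep3_pairs[OF oi(1)] V1.indep3_pairs[OF oi(3)] V1.indep2_sym by simp_all
  show ?thesis
  proof (rule V2.desargues)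
    show "h o' \<in> line s2 (h a1) (h b1)" "h o' \<in> line s2 (h a2) (h b2)" "h o' \<in> line s2 (h a3) (h b3)"
      using ol ab h_line C by simp_all
    show "indep2 s2 (h o') (h a1)" "indep2 s2 (h o') (h a2)" "indep2 s2 (h o') (h a3)"
      "indep2 s2 (h o') (h b1)" "indep2 s2 (h o') (h b2)" "indep2 s2 (h o') (h b3)"
      using ao ob h_indep2 C by simp_all
    show "indep3 s2 (h a1) (h a2) (h o')" "indep3 s2 (h a1) (h a3) (h o')" "indep3 s2 (h a2) (h a3) (h o')"
      using oi h_indep3 C by simp_all
    show "p' \<in> line s2 (h a1) (h a2)" "p' \<in> line s2 (h b1) (h b2)"
      using side[OF _ _ _ e(1) nz(1) out(1)] C a b by simp_all
    show "q' \<in> line s2 (h a1) (h a3)" "q' \<in> line s2 (h b1) (h b3)"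
      using side[OF _ _ _ e(2) nz(2) out(2)] C a b by simp_all
    show "r' \<in> line s2 (h a2) (h a3)" "r' \<in> line s2 (h b2) (h b3)"
      using side[OF _ _ _ e(3) nz(3) out(3)] C r by simp_all
  qed
qed

lemma extends_collinear:
  assumes nz: "p \<noteq> 0" "q \<noteq> 0" "r \<noteq> 0" and e: "extends p p'" "extends q q'" "extends r r'"
    and d: "\<not> indep3 s1 p q r"
  shows "\<not> indep3 s2 p' q' r'"
proof -
  have par: "\<not> indep2 s2 w' z'" if wz: "\<not> indep2 s1 w z" "w \<noteq> 0" "z \<noteq> 0" and ww: "extends w w'" and zz: "extends z z'" for w z w' z'
  proof -
    obtain c where c: "c \<noteq> 0" "z = c \<cdot>\<^sub>1 w" using V1.not_indep2E[OF wz] by blast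
    have "extends w z'" using zz extends_scale[OF c(1)] c(2) by simp
    then show ?thesis using extends_unique[OF wz(2) ww] by blast
  qed
  show ?thesis
  proof (cases "indep2 s1 p q \<and> indep2 s1 p r \<and> indep2 s1 q r")
    case False
    then show ?thesis using par nz e V2.indep3_pairs by blast
  next
    case True
    then have r: "r \<in> line s1 p q" using d V1.indep3_iff by blast
    show ?thesis
    proof (cases "line s1 p q \<inter> C1 = {}")
      case False
      then obtain x y where x: "x \<in> C1" and y: "y \<in> C1" "indep2 s1 x y" "line s1 x y = line s1 p q"
        using V1.cone_line_basis True by blast
      have "p' \<in> line s2 (h x) (h y)" "q' \<in> line s2 (h x) (h y)" "r' \<in> line s2 (h x) (h y)"
        using extendsD[OF e(1) x y(1,2)] extendsD[OF e(2) x y(1,2)] extendsD[OF e(3) x y(1,2)]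
          V1.line_left[of p q] V1.line_right[of q p] r y(3) by auto
      then show ?thesis by (rule V2.three_on_line)
    next
      case disj: True
      obtain a b where ab: "r = a \<cdot>\<^sub>1 p + b \<cdot>\<^sub>1 q" using r by (metis V1.lineE)
      have a: "a \<noteq> 0"
      proof
        assume "a = 0" then have "\<not> indep2 s1 q r" using ab V1.not_indep2_iff[OF nz(2)] by auto
        then show False using True by blast
      qed
      have b: "b \<noteq> 0"
      proof
        assume "b = 0" then have "\<not> indep2 s1 p r" using ab V1.not_indep2_iff[OF nz(1)] by auto
        then show False using True by blast
      qed
      \<comment> \<open>Rescaled representatives for which the third point is the difference of the other two.\<close>
      let ?p = "(- a) \<cdot>\<^sub>1 p" and ?q = "b \<cdot>\<^sub>1 q"
      have rr: "r = ?q - ?p" using ab by simp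
      have a': "- a \<noteq> 0" using a by simp
      have "indep2 s1 ?p q" using True V1.indep2_scale_iff[OF a'] by blast
      then have i: "indep2 s1 ?p ?q" using V1.indep2_scale_iff[OF b] V1.indep2_sym by blast
      have "line s1 ?p ?q \<subseteq> line s1 p q"
        by (rule V1.line_sub[OF V1.line_scale[OF V1.line_left] V1.line_scale[OF V1.line_right]])
      then have "line s1 ?p ?q \<inter> C1 = {}" using disj by blast
      moreover have "extends ?p p'" "extends ?q q'" using e extends_scale[OF a'] extends_scale[OF b] by blast+
      moreover have "extends (?q - ?p) r'" using e(3) rr by simp
      ultimately show ?thesis using extends_collinear_axis[OF i] by blast
    qed
  qed
qed

end

locale cone_iso =
  fwd: cone_morphism s1 C1 s2 h + bwd: cone_morphism s2 C2 s1 h'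
  for s1 :: "'k1::field \<Rightarrow> 'v1::ab_group_add \<Rightarrow> 'v1" (infixr "\<cdot>\<^sub>1" 75) and C1
    and s2 :: "'k2::field \<Rightarrow> 'v2::ab_group_add \<Rightarrow> 'v2" (infixr "\<cdot>\<^sub>2" 75) and C2 h h' +
  assumes h_in: "x \<in> C1 \<Longrightarrow> h x \<in> C2" and h'_in: "y \<in> C2 \<Longrightarrow> h' y \<in> C1"
    and h'_h: "x \<in> C1 \<Longrightarrow> \<not> indep2 s1 (h' (h x)) x"
    and h_h': "y \<in> C2 \<Longrightarrow> \<not> indep2 s2 (h (h' y)) y"
begin

text \<open>
  The point \<open>p'\<close> that the inverse map assigns to \<open>q\<close> lies on every line through \<open>p\<close> that meets the
  ample set, because \<open>q\<close> lies on the image of that line. Two such lines meet only in \<open>p\<close>.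
\<close>

lemma extends_sym_fwd:
  assumes p: "p \<noteq> 0" and e: "fwd.extends p q"
  shows "bwd.extends q p"
proof -
  have q: "q \<noteq> 0" using fwd.extends_nonzero[OF e] .
  obtain p' where p': "bwd.extends q p'" using bwd.extends_exists[OF q] by blast
  have p'n: "p' \<noteq> 0" using bwd.extends_nonzero[OF p'] .
  obtain x y u v where *: "x \<in> C1" "y \<in> C1" "u \<in> C1" "v \<in> C1" "indep2 s1 x y" "indep2 s1 u v"
    "p \<in> line s1 x y" "p \<in> line s1 u v" "u \<notin> line s1 x y" using fwd.V1.two_lines[OF p] by metis
  have key: "p' \<in> line s1 x y" if xy: "x \<in> C1" "y \<in> C1" "indep2 s1 x y" "p \<in> line s1 x y" for x y
  proof -
    have "q \<in> line s2 (h x) (h y)" using fwd.extendsD[OF e xy] .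
    moreover have i: "indep2 s2 (h x) (h y)" using fwd.h_indep2 xy by blast
    ultimately have 1: "p' \<in> line s1 (h' (h x)) (h' (h y))"
      using bwd.extendsD[OF p' h_in[OF xy(1)] h_in[OF xy(2)]] by blast
    have par: "h' (h z) \<in> line s1 x y" if z: "z \<in> C1" "z \<in> line s1 x y" for z
    proof -
      obtain a where "h' (h z) = a \<cdot>\<^sub>1 z"
        using h'_h[OF z(1)] fwd.V1.not_indep2_iff[OF fwd.V1.cone_nonzero[OF z(1)]] fwd.V1.indep2_sym by blast
      then show ?thesis using fwd.V1.line_scale[OF z(2)] by simp
    qed
    show ?thesis
      using 1 fwd.V1.line_sub[OF par[OF xy(1) fwd.V1.line_left] par[OF xy(2) fwd.V1.line_right]] by blast
  qed
  have "\<not> indep2 s1 p' p"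
    using fwd.V1.meet_unique[OF key[OF *(1,2,5,7)] *(7) key[OF *(3,4,6,8)] *(8,9)] .
  then obtain c where "c \<noteq> 0" "p = c \<cdot>\<^sub>1 p'" using fwd.V1.not_indep2E[OF _ p'n p] by blast
  then show ?thesis using p' p unfolding bwd.extends_def by (simp add: fwd.V1.line_scale)
qed

end

sublocale cone_iso \<subseteq> rev: cone_iso s2 C2 s1 C1 h' h
  by unfold_locales (use h_in h'_in h'_h h_h' in auto)

context cone_iso
begin

lemma extends_sym: "p \<noteq> 0 \<Longrightarrow> q \<noteq> 0 \<Longrightarrow> fwd.extends p q \<longleftrightarrow> bwd.extends q p"
  using extends_sym_fwd rev.extends_sym_fwd by blast

text \<open>
  The value at \<open>0\<close> is chosen to fit \<open>collinearity_map\<close>.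
\<close>

definition ext where "ext p = (if p = 0 then 0 else SOME q. fwd.extends p q)"

lemma ext_extends: "p \<noteq> 0 \<Longrightarrow> fwd.extends p (ext p)"
  unfolding ext_def using someI_ex[OF fwd.extends_exists] by simp

lemma ext_zero: "ext 0 = 0" by (simp add: ext_def)

lemma ext_nonzero: "p \<noteq> 0 \<Longrightarrow> ext p \<noteq> 0"
  using fwd.extends_nonzero[OF ext_extends] .

lemma ext_back: "p \<noteq> 0 \<Longrightarrow> bwd.extends (ext p) p"
  using extends_sym ext_extends ext_nonzero by blast

sublocale collinearity_map s1 s2 ext
proof
  show "ext 0 = 0" by (rule ext_zero)
  show i3: "indep3 s2 (ext x) (ext y) (ext z) \<longleftrightarrow> indep3 s1 x y z" for x y z
  proof (cases "x \<noteq> 0 \<and> y \<noteq> 0 \<and> z \<noteq> 0")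
    case True
    then have "indep3 s2 (ext x) (ext y) (ext z) \<Longrightarrow> indep3 s1 x y z"
      using fwd.extends_collinear[OF _ _ _ ext_extends ext_extends ext_extends] by blast
    moreover have "indep3 s1 x y z \<Longrightarrow> indep3 s2 (ext x) (ext y) (ext z)"
      using bwd.extends_collinear[OF ext_nonzero ext_nonzero ext_nonzero ext_back ext_back ext_back] True by blast
    ultimately show ?thesis by blast
  next
    case False
    then show ?thesis using ext_zero fwd.V1.indep3_pairs fwd.V2.indep3_pairs
      fwd.V1.indep2_nonzero fwd.V2.indep2_nonzero by metis
  qed
  show "indep2 s2 (ext x) (ext y) \<longleftrightarrow> indep2 s1 x y" for x y
  proof (cases "x \<noteq> 0 \<and> y \<noteq> 0")
    case True
    have "\<not> indep2 s2 (ext x) (ext y)" if d: "\<not> indep2 s1 x y"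
    proof -
      obtain c where c: "c \<noteq> 0" "y = c \<cdot>\<^sub>1 x" using fwd.V1.not_indep2E[OF d] True by blast
      have "fwd.extends x (ext y)" using ext_extends[of y] fwd.extends_scale[OF c(1)] c(2) True by simp
      then show ?thesis using fwd.extends_unique ext_extends True by blast
    qed
    moreover have "\<not> indep2 s1 x y" if d: "\<not> indep2 s2 (ext x) (ext y)"
    proof -
      obtain c where c: "c \<noteq> 0" "ext y = c \<cdot>\<^sub>2 ext x" using fwd.V2.not_indep2E[OF d] True ext_nonzero by blast
      have "bwd.extends (ext x) y" using ext_back[of y] bwd.extends_scale[OF c(1)] c(2) True by simp
      then show ?thesis using bwd.extends_unique ext_back True ext_nonzero by blast
    qed
    ultimately show ?thesis by blast
  next
    case False
    then show ?thesis using ext_zero fwd.V1.indep2_nonzero fwd.V2.indep2_nonzero by metis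
  qed
  show "\<exists>x. x \<noteq> 0 \<and> \<not> indep2 s2 w (ext x)" if w: "w \<noteq> 0" for w
  proof -
    obtain x where x: "bwd.extends w x" using bwd.extends_exists[OF w] by blast
    have xn: "x \<noteq> 0" using bwd.extends_nonzero[OF x] .
    have "fwd.extends x w" using extends_sym[OF xn w] x by blast
    then show ?thesis using fwd.extends_unique ext_extends xn by blast
  qed
  show "\<exists>z. z \<notin> line s1 x y" for x y by (rule fwd.V1.dim3)
qed

theorem semilinear_extension:
  "\<exists>\<mu> lam. semilinear_iso s1 s2 \<mu> lam \<and> (\<forall>x\<in>C1. \<not> indep2 s2 (lam x) (h x))"
proof -
  obtain \<mu> lam where 1: "semilinear_iso s1 s2 \<mu> lam"
    and 2: "\<And>x. x \<noteq> 0 \<Longrightarrow> \<not> indep2 s2 (lam x) (ext x)" using fundamental_theorem by blast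
  have "\<not> indep2 s2 (lam x) (h x)" if x: "x \<in> C1" for x
  proof -
    have xn: "x \<noteq> 0" using fwd.V1.cone_nonzero[OF x] .
    have "\<not> indep2 s2 (ext x) (h x)"
      using fwd.extends_unique[OF xn ext_extends[OF xn] fwd.extends_self[OF x]] .
    then show ?thesis using fwd.V2.par_trans[OF 2[OF xn]] ext_nonzero[OF xn] by blast
  qed
  then show ?thesis using 1 by blast
qed

end

section \<open>Projective points and lines in terms of vectors\<close>

context lin
begin

lemma mem_proj_class: "y \<in> proj_class s x \<longleftrightarrow> x \<noteq> 0 \<and> y \<noteq> 0 \<and> \<not> indep2 s x y"
proof (cases "x = 0 \<or> y = 0")
  case True then show ?thesis unfolding proj_class_def proj_rel_def by auto
next
  case False
  then have "(\<exists>a. a \<noteq> 0 \<and> y = a \<cdot> x) \<longleftrightarrow> \<not> indep2 s x y" using not_indep2_iff[of x y] by auto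
  then show ?thesis using False unfolding proj_class_def proj_rel_def by simp
qed

lemma proj_class_eq_iff:
  assumes "x \<noteq> 0" "y \<noteq> 0" shows "proj_class s x = proj_class s y \<longleftrightarrow> \<not> indep2 s x y"
proof
  assume "proj_class s x = proj_class s y"
  moreover have "\<not> indep2 s y y" using not_indep2_iff[OF assms(2), of y] by (metis scale_one)
  ultimately show "\<not> indep2 s x y" using mem_proj_class assms by blast
next
  assume xy: "\<not> indep2 s x y"
  then have yx: "\<not> indep2 s y x" using indep2_sym by blast
  have "z \<in> proj_class s x \<longleftrightarrow> z \<in> proj_class s y" for z
    unfolding mem_proj_class using par_trans[OF yx] par_trans[OF xy] assms by blast
  then show "proj_class s x = proj_class s y" by blast
qed

lemma proj_class_scale: "a \<noteq> 0 \<Longrightarrow> x \<noteq> 0 \<Longrightarrow> proj_class s (a \<cdot> x) = proj_class s x"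
  using proj_class_eq_iff[of "a \<cdot> x" x] indep2_scale_iff[of a x x] proj_class_eq_iff[of x x] by simp

lemma proj_space_eq: "proj_space s = proj_class s ` (UNIV - {0})"
  unfolding proj_space_def proj_class_def quotient_def by auto

lemma proj_spaceE: assumes "P \<in> proj_space s" obtains x where "x \<noteq> 0" "P = proj_class s x"
  using assms unfolding proj_space_eq by auto

lemma proj_class_mem_proj_sub:
  assumes W: "subspace W" and z: "z \<noteq> 0"
  shows "proj_class s z \<in> proj_sub s W \<longleftrightarrow> z \<in> W"
proof
  assume "proj_class s z \<in> proj_sub s W"
  then obtain w where w: "w \<in> W" "w \<noteq> 0" "proj_class s w = proj_class s z" unfolding proj_sub_def by auto
  then obtain a where "z = a \<cdot> w" using proj_class_eq_iff[OF w(2) z] not_indep2_iff[OF w(2)] by blast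
  then show "z \<in> W" using subspace_scale[OF W w(1)] by simp
qed (use z in \<open>auto simp: proj_sub_def\<close>)

lemma proj_sub_inj:
  assumes "subspace W" "subspace W'" "proj_sub s W = proj_sub s W'" shows "W = W'"
proof -
  have "z \<in> W \<longleftrightarrow> z \<in> W'" for z
    using proj_class_mem_proj_sub[OF assms(1)] proj_class_mem_proj_sub[OF assms(2)] assms(3)
      subspace_0[OF assms(1)] subspace_0[OF assms(2)] by (cases "z = 0") auto
  then show ?thesis by blast
qed

lemma span_pair: "span {x, y} = line s x y"
proof -
  have "z \<in> span {x, y} \<longleftrightarrow> z \<in> line s x y" for z
  proof -
    have "z \<in> span {x, y} \<longleftrightarrow> (\<exists>a b. z - a \<cdot> x = b \<cdot> y)" by (auto simp: span_insert)
    also have "\<dots> \<longleftrightarrow> (\<exists>a b. z = a \<cdot> x + b \<cdot> y)" by (metis add_diff_cancel_left' add.commute diff_add_cancel)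
    finally show ?thesis unfolding line_def by blast
  qed
  then show ?thesis by blast
qed

lemma independent_pair: "independent {x, y} \<and> x \<noteq> y \<longleftrightarrow> indep2 s x y"
proof (cases "x = y \<or> x = 0")
  case True
  then show ?thesis using indep2_nonzero not_indep2_iff[of x x] dependent_zero[of "{x, y}"]
    by (metis insertI1 scale_one)
next
  case False
  have "independent {y, x} \<longleftrightarrow> y \<notin> span {x}" using False by (auto simp: independent_insert)
  also have "\<dots> \<longleftrightarrow> indep2 s x y" using not_indep2_iff[of x y] False by (auto simp: span_singleton)
  finally show ?thesis using False by (simp add: insert_commute)
qed

text \<open>
  Translates the subspaces of dimension 2 used for projective lines into spans of independent pairs.
\<close>

lemma proj_lines_eq: "proj_lines s = {proj_sub s (line s x y) | x y. indep2 s x y}"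
proof -
  have "subspace W \<and> dim W = 2 \<longleftrightarrow> (\<exists>x y. indep2 s x y \<and> W = line s x y)" for W
  proof
    assume W: "subspace W \<and> dim W = 2"
    obtain B where B: "B \<subseteq> W" "independent B" "W \<subseteq> span B" "card B = 2" using basis_exists[of W] W by metis
    obtain x y where xy: "B = {x, y}" "x \<noteq> y" using B(4) by (auto simp: card_2_iff)
    have "W = span B" using B W span_minimal[of B W] by blast
    then show "\<exists>x y. indep2 s x y \<and> W = line s x y" using xy B(2) independent_pair span_pair by blast
  next
    assume "\<exists>x y. indep2 s x y \<and> W = line s x y"
    then obtain x y where xy: "indep2 s x y" "W = line s x y" by blast
    have i: "independent {x, y}" "x \<noteq> y" using independent_pair xy(1) by blast+
    have "span {x, y} = span W" unfolding xy(2) using span_pair span_eq_iff line_subspace by metis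
    then have "dim W = card {x, y}" using i(1) by (rule dim_eq_card)
    then show "subspace W \<and> dim W = 2" using i xy(2) line_subspace by simp
  qed
  then show ?thesis unfolding proj_lines_def by auto
qed

lemma proj_linesE:
  assumes "l \<in> proj_lines s" obtains x y where "indep2 s x y" "l = proj_sub s (line s x y)"
  using assms unfolding proj_lines_eq by blast

lemma proj_linesI: "indep2 s x y \<Longrightarrow> proj_sub s (line s x y) \<in> proj_lines s"
  unfolding proj_lines_eq by blast

lemma mem_proj_line: "z \<noteq> 0 \<Longrightarrow> proj_class s z \<in> proj_sub s (line s x y) \<longleftrightarrow> z \<in> line s x y"
  using proj_class_mem_proj_sub[OF line_subspace] .

lemma proj_line_subset: "l \<in> proj_lines s \<Longrightarrow> l \<subseteq> proj_space s"
  unfolding proj_lines_def proj_sub_def proj_space_eq by auto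

lemma proj_line_through:
  assumes l: "l \<in> proj_lines s" and xy: "indep2 s x y" "proj_class s x \<in> l" "proj_class s y \<in> l"
  shows "l = proj_sub s (line s x y)"
proof -
  obtain u v where uv: "indep2 s u v" "l = proj_sub s (line s u v)" using l by (rule proj_linesE)
  have "x \<in> line s u v" "y \<in> line s u v"
    using xy uv(2) mem_proj_line indep2_nonzero[OF xy(1)] by simp_all
  then show ?thesis using line_eqI[OF _ _ xy(1)] uv(2) by simp
qed

lemma proj_line_unique:
  assumes "l \<in> proj_lines s" "m \<in> proj_lines s" "P \<in> l" "P \<in> m" "Q \<in> l" "Q \<in> m" "P \<noteq> Q"
  shows "l = m"
proof -
  have "P \<in> proj_space s" "Q \<in> proj_space s" using assms proj_line_subset by blast+
  then obtain x y where xy: "x \<noteq> 0" "P = proj_class s x" "y \<noteq> 0" "Q = proj_class s y"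
    by (metis proj_spaceE)
  then have "indep2 s x y" using proj_class_eq_iff[OF xy(1,3)] assms(7) by simp
  then have "l = proj_sub s (line s x y)" "m = proj_sub s (line s x y)"
    by (rule proj_line_through[OF assms(1)] proj_line_through[OF assms(2)]; use assms(3-6) xy in simp)+
  then show ?thesis by simp
qed

lemma dim_at_least_3: assumes "dim_at_least s 3" shows "\<exists>z. z \<notin> line s x y"
proof (rule ccontr)
  assume "\<not> ?thesis"
  then have U: "span {x, y} = UNIV" unfolding span_pair by blast
  then have "\<exists>B. finite B \<and> span B = UNIV" by (intro exI[of _ "{x, y}"]) simp
  then have "3 \<le> dim UNIV" using assms unfolding dim_at_least_def by (rule rev_mp)
  moreover have "dim UNIV \<le> card {x, y}" by (rule dim_le_card) (use U in auto)
  moreover have "card {x, y} \<le> 2" by (simp add: card_insert_if)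
  ultimately show False by simp
qed

end

definition proj_cone :: "('k::field \<Rightarrow> 'v::ab_group_add \<Rightarrow> 'v) \<Rightarrow> 'v set set \<Rightarrow> 'v set" where
  "proj_cone s U = {x. x \<noteq> 0 \<and> proj_class s x \<in> U}"

text \<open>
  Coordinate vectors representing the point \<open>(a : b)\<close> of the projective line over the field.
\<close>

definition vec2 :: "'k \<Rightarrow> 'k \<Rightarrow> 'k::field ^ 2" where
  "vec2 a b = (\<chi> i. if i = 1 then a else b)"

lemma vec2_nth: "vec2 a b $ 1 = a" "vec2 a b $ 2 = b"
  unfolding vec2_def by simp_all

lemma vec2_eta: "vec2 (w $ 1) (w $ 2) = w"
  by (simp add: vec_eq_iff forall_2 vec2_nth)

lemma vec2_eq_0: "vec2 a b = 0 \<longleftrightarrow> a = 0 \<and> b = 0"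
  by (simp add: vec_eq_iff forall_2 vec2_nth)

interpretation plane: lin "(*s) :: 'k::field \<Rightarrow> 'k ^ 2 \<Rightarrow> 'k ^ 2"
  unfolding lin_def by (rule vec.vector_space_axioms)

lemma indep2_vec2: "indep2 (*s) (vec2 a b) (vec2 c d) \<longleftrightarrow> a * d \<noteq> b * c"
proof
  assume i: "indep2 (*s) (vec2 a b) (vec2 c d)"
  show "a * d \<noteq> b * c"
  proof
    assume e: "a * d = b * c"
    have "d *s vec2 a b + (- b) *s vec2 c d = 0" "c *s vec2 a b + (- a) *s vec2 c d = 0"
      using e by (simp_all add: vec_eq_iff forall_2 vec2_nth mult.commute)
    then have "d = 0 \<and> b = 0" "c = 0 \<and> a = 0" using plane.indep2D[OF i] by fastforce+
    then show False using plane.indep2_nonzero[OF i] vec2_eq_0 by blast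
  qed
next
  assume n: "a * d \<noteq> b * c"
  show "indep2 (*s) (vec2 a b) (vec2 c d)" unfolding indep2_def
  proof (intro allI impI)
    fix x y assume "x *s vec2 a b + y *s vec2 c d = 0"
    then have 1: "x * a + y * c = 0" and 2: "x * b + y * d = 0"
      by (simp_all add: vec_eq_iff forall_2 vec2_nth)
    have "x * (a * d - b * c) = d * (x * a + y * c) - c * (x * b + y * d)"
      "y * (a * d - b * c) = a * (x * b + y * d) - b * (x * a + y * c)" by (simp_all add: algebra_simps)
    then have "x * (a * d - b * c) = 0" "y * (a * d - b * c) = 0" unfolding 1 2 by simp_all
    then show "x = 0 \<and> y = 0" using n by simp
  qed
qed

context lin
begin

text \<open>
  A projective isomorphism from the line to the standard one, composed with the parametrisation
  \<open>(a, b) \<mapsto> a x + b y\<close>, is an element of \<open>PGL\<^sub>2\<close> with matrix \<open>M\<close>. By stability of the family \<open>\<S>\<close> under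
  the inverse of \<open>M\<close>, the parameters of points outside \<open>U\<close> are contained in a member of \<open>\<S>\<close>.
\<close>

lemma line_coordinates:
  assumes st: "PGL2_stable \<S>" and am: "ample \<S> s U" and i: "indep2 s x y"
    and m: "line s x y \<inter> proj_cone s U \<noteq> {}"
  shows "\<exists>S\<in>\<S>. \<forall>a b. a \<noteq> 0 \<or> b \<noteq> 0 \<longrightarrow> a \<cdot> x + b \<cdot> y \<notin> proj_cone s U \<longrightarrow> proj_class (*s) (vec2 a b) \<in> S"
proof -
  let ?L = "line s x y"
  let ?l = "proj_sub s ?L"
  obtain z where z: "z \<in> ?L" "z \<noteq> 0" "proj_class s z \<in> U" using m unfolding proj_cone_def by blast
  have "?l \<inter> U \<noteq> {}" using z mem_proj_line by blast
  then have "?l - (?l \<inter> U) \<in> line_family \<S> s ?l"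
    using am proj_linesI[OF i] unfolding ample_def by blast
  then obtain \<beta> where \<beta>: "\<beta> \<in> line_isos s ?l" "\<beta> ` (?l - (?l \<inter> U)) \<in> \<S>" unfolding line_family_def by blast
  obtain W f where W: "subspace W" "?l = proj_sub s W" and f: "bij_betw f W UNIV"
    and f_add: "\<And>x y. x \<in> W \<Longrightarrow> y \<in> W \<Longrightarrow> f (x + y) = f x + f y"
    and f_scale: "\<And>a x. x \<in> W \<Longrightarrow> f (a \<cdot> x) = a *s f x"
    and \<beta>f: "\<And>x. x \<in> W \<Longrightarrow> x \<noteq> 0 \<Longrightarrow> \<beta> (proj_class s x) = proj_class (*s) (f x)"
    using \<beta>(1) unfolding line_isos_def mem_Collect_eq by (elim exE conjE) (simp add: Ball_def)
  have WL: "W = ?L" using proj_sub_inj[OF W(1) line_subspace] W(2) by simp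
  have xW: "x \<in> W" "y \<in> W" unfolding WL by (rule line_left line_right)+
  define M :: "'k ^ 2 ^ 2" where "M = (\<chi> i j. if j = 1 then f x $ i else f y $ i)"
  have M: "M *v vec2 a b = f (a \<cdot> x + b \<cdot> y)" for a b
  proof -
    have "f (a \<cdot> x + b \<cdot> y) = a *s f x + b *s f y"
      using f_add f_scale xW subspace_scale[OF W(1)] by simp
    moreover have "M *v vec2 a b = a *s f x + b *s f y"
      by (simp add: vec_eq_iff matrix_vector_mult_def M_def sum_2 vec2_nth mult.commute)
    ultimately show ?thesis by simp
  qed
  have f0: "f v = 0 \<Longrightarrow> v \<in> W \<Longrightarrow> v = 0" for v
  proof -
    assume v: "f v = 0" "v \<in> W"
    have "f 0 = 0" using f_scale[OF xW(1), of 0] by simp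
    then show "v = 0" using v f subspace_0[OF W(1)] unfolding bij_betw_def inj_on_def by metis
  qed
  have "\<exists>A. A ** M = mat 1"
  proof -
    have "w = 0" if "M *v w = 0" for w
    proof -
      have "f ((w $ 1) \<cdot> x + (w $ 2) \<cdot> y) = 0" using that M[of "w $ 1" "w $ 2"] by (simp add: vec2_eta)
      then have "(w $ 1) \<cdot> x + (w $ 2) \<cdot> y = 0" using f0 lineI unfolding WL by blast
      then have "vec2 (w $ 1) (w $ 2) = 0" using indep2D[OF i] vec2_eq_0 by blast
      then show "w = 0" by (simp add: vec2_eta)
    qed
    then show ?thesis by (simp add: matrix_left_invertible_ker)
  qed
  then obtain A where A: "A ** M = mat 1" by blast
  then have Ainv: "invertible A" unfolding invertible_def using matrix_left_right_inverse[of A M] by blast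
  let ?g = "(`) ((*v) A)"
  have g: "?g (proj_class (*s) w) = proj_class (*s) (A *v w)" if w: "w \<noteq> 0" for w
  proof -
    have Aw: "A *v v \<noteq> 0" if "v \<noteq> 0" for v
    proof
      assume "A *v v = 0"
      moreover obtain B where "B ** A = mat 1" using Ainv unfolding invertible_def by blast
      ultimately show False using that matrix_vector_mul_assoc[of B A v] by simp
    qed
    show ?thesis
    proof (intro set_eqI iffI)
      fix q assume "q \<in> ?g (proj_class (*s) w)"
      then obtain a where "a \<noteq> 0" "q = A *v (a *s w)"
        unfolding proj_class_def proj_rel_def by auto
      then show "q \<in> proj_class (*s) (A *v w)" using Aw w
        unfolding proj_class_def proj_rel_def by (auto simp: matrix_vector_mult_scaleR vector_scalar_commute)
    next
      fix q assume "q \<in> proj_class (*s) (A *v w)"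
      then obtain a where a: "a \<noteq> 0" "q = a *s (A *v w)"
        unfolding proj_class_def proj_rel_def by auto
      then have "q = A *v (a *s w)" by (simp add: vector_scalar_commute)
      moreover have "a *s w \<in> proj_class (*s) w" using a w unfolding proj_class_def proj_rel_def by auto
      ultimately show "q \<in> ?g (proj_class (*s) w)" by blast
    qed
  qed
  have "?g \<in> PGL2" unfolding PGL2_def using Ainv g by blast
  then have S: "?g ` \<beta> ` (?l - (?l \<inter> U)) \<in> \<S>" using st \<beta>(2) unfolding PGL2_stable_def by blast
  have "proj_class (*s) (vec2 a b) \<in> ?g ` \<beta> ` (?l - (?l \<inter> U))"
    if ab: "a \<noteq> 0 \<or> b \<noteq> 0" "a \<cdot> x + b \<cdot> y \<notin> proj_cone s U" for a b
  proof -
    let ?z = "a \<cdot> x + b \<cdot> y"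
    have zW: "?z \<in> W" unfolding WL by (rule lineI)
    have z: "?z \<noteq> 0" using indep2D[OF i] ab(1) by blast
    have "proj_class s ?z \<in> ?l - (?l \<inter> U)" using ab(2) z mem_proj_line[OF z] lineI unfolding proj_cone_def by blast
    moreover have "?g (\<beta> (proj_class s ?z)) = proj_class (*s) (vec2 a b)"
    proof -
      have "f ?z \<noteq> 0" using f0 zW z by blast
      then have "?g (\<beta> (proj_class s ?z)) = proj_class (*s) (A *v f ?z)" using g \<beta>f[OF zW z] by simp
      also have "A *v f ?z = vec2 a b" using M[of a b] A by (simp flip: M add: matrix_vector_mul_assoc)
      finally show ?thesis .
    qed
    ultimately show ?thesis by (metis imageI)
  qed
  then show ?thesis using S by blast
qed

text \<open>
  The parameters to be avoided on the three lines are covered by three members of \<open>\<S>\<close>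
  (\<open>line_coordinates\<close>) and two points, which by admissibility do not exhaust the projective line.
\<close>

lemma ample_cone_of_ample:
  assumes ad: "admissible 3 2 \<S>" and am: "ample \<S> s U" and d: "dim_at_least s 3"
  shows "ample_cone s (proj_cone s U)"
proof
  show "0 \<notin> proj_cone s U" unfolding proj_cone_def by simp
  show "a \<cdot> x \<in> proj_cone s U" if "x \<in> proj_cone s U" "a \<noteq> 0" for x a
    using that proj_class_scale[of a x] unfolding proj_cone_def by simp
  show "proj_cone s U \<noteq> {}"
  proof -
    obtain P where P: "P \<in> U" "P \<in> proj_space s" using am unfolding ample_def by blast
    then show ?thesis unfolding proj_cone_def by (auto elim: proj_spaceE)
  qed
  show "\<exists>z. z \<notin> line s x y" for x y using dim_at_least_3[OF d] .
  have st: "PGL2_stable \<S>" using ad unfolding admissible_def by blast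
  fix x1 y1 x2 y2 x3 y3 and c1 d1 c2 d2 :: 'k
  assume i: "indep2 s x1 y1" "indep2 s x2 y2" "indep2 s x3 y3"
    and m: "line s x1 y1 \<inter> proj_cone s U \<noteq> {}" "line s x2 y2 \<inter> proj_cone s U \<noteq> {}" "line s x3 y3 \<inter> proj_cone s U \<noteq> {}"
    and c: "c1 \<noteq> 0 \<or> d1 \<noteq> 0" "c2 \<noteq> 0 \<or> d2 \<noteq> 0"
  note co = line_coordinates[OF st am]
  obtain S1 where S1: "S1 \<in> \<S>" "\<And>a b. a \<noteq> 0 \<or> b \<noteq> 0 \<Longrightarrow> a \<cdot> x1 + b \<cdot> y1 \<notin> proj_cone s U \<Longrightarrow> proj_class (*s) (vec2 a b) \<in> S1"
    using co[OF i(1) m(1)] by metis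
  obtain S2 where S2: "S2 \<in> \<S>" "\<And>a b. a \<noteq> 0 \<or> b \<noteq> 0 \<Longrightarrow> a \<cdot> x2 + b \<cdot> y2 \<notin> proj_cone s U \<Longrightarrow> proj_class (*s) (vec2 a b) \<in> S2"
    using co[OF i(2) m(2)] by metis
  obtain S3 where S3: "S3 \<in> \<S>" "\<And>a b. a \<noteq> 0 \<or> b \<noteq> 0 \<Longrightarrow> a \<cdot> x3 + b \<cdot> y3 \<notin> proj_cone s U \<Longrightarrow> proj_class (*s) (vec2 a b) \<in> S3"
    using co[OF i(3) m(3)] by metis
  let ?S = "\<lambda>i::nat. if i = 0 then S1 else if i = 1 then S2 else S3"
  let ?p = "\<lambda>i::nat. proj_class (*s) (if i = 0 then vec2 c1 d1 else vec2 c2 d2)"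
  have cn: "vec2 c1 d1 \<noteq> 0" "vec2 c2 d2 \<noteq> 0" using c vec2_eq_0 by blast+
  have "(\<Union>i<3. ?S i) \<union> ?p ` {..<2} \<subset> proj_line1"
    by (rule ad[unfolded admissible_def, THEN conjunct2, rule_format, of 3 2 ?S ?p])
      (use S1(1) S2(1) S3(1) cn in \<open>simp_all add: plane.proj_space_eq\<close>)
  then obtain Q where Q: "Q \<in> proj_line1" "Q \<notin> (\<Union>i<3. ?S i)" "Q \<notin> ?p ` {..<2}" by blast
  have Q1: "Q \<notin> S1" using Q(2) by force
  have Q2: "Q \<notin> S2"
  proof
    assume "Q \<in> S2"
    then have "Q \<in> ?S 1" by simp
    moreover have "(1::nat) \<in> {..<3}" by simp
    ultimately show False using Q(2) by blast
  qed
  have Q3: "Q \<notin> S3"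
  proof
    assume "Q \<in> S3"
    then have "Q \<in> ?S 2" by simp
    moreover have "(2::nat) \<in> {..<3}" by simp
    ultimately show False using Q(2) by blast
  qed
  have P1: "Q \<noteq> proj_class (*s) (vec2 c1 d1)" using Q(3) by force
  have P2: "Q \<noteq> proj_class (*s) (vec2 c2 d2)"
  proof
    assume "Q = proj_class (*s) (vec2 c2 d2)"
    then have "Q = ?p 1" by simp
    moreover have "(1::nat) \<in> {..<2}" by simp
    ultimately show False using Q(3) by blast
  qed
  obtain w where w: "w \<noteq> 0" "Q = proj_class (*s) w" using Q(1) by (rule plane.proj_spaceE)
  define a b where "a = w $ 1" and "b = w $ 2"
  have w': "w = vec2 a b" unfolding a_def b_def by (simp add: vec2_eta)
  have ab: "a \<noteq> 0 \<or> b \<noteq> 0" using w(1) w' vec2_eq_0 by blast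
  have "a \<cdot> x1 + b \<cdot> y1 \<in> proj_cone s U" "a \<cdot> x2 + b \<cdot> y2 \<in> proj_cone s U" "a \<cdot> x3 + b \<cdot> y3 \<in> proj_cone s U"
    using S1(2)[OF ab] S2(2)[OF ab] S3(2)[OF ab] Q1 Q2 Q3 w(2) w' by blast+
  moreover have "a * d1 \<noteq> b * c1" "a * d2 \<noteq> b * c2"
    using P1 P2 plane.proj_class_eq_iff[OF w(1) cn(1)] plane.proj_class_eq_iff[OF w(1) cn(2)] w(2)
    by (simp_all add: w' indep2_vec2)
  ultimately show "\<exists>a b. a \<cdot> x1 + b \<cdot> y1 \<in> proj_cone s U \<and> a \<cdot> x2 + b \<cdot> y2 \<in> proj_cone s U \<and> a \<cdot> x3 + b \<cdot> y3 \<in> proj_cone s U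
      \<and> a * d1 \<noteq> b * c1 \<and> a * d2 \<noteq> b * c2" by blast
qed

end

section \<open>Partial maps of projective spaces and their extensions\<close>

locale projective_partial_map = V1: ample_cone s1 "proj_cone s1 U1" + V2: lin s2
  for s1 :: "'k1::field \<Rightarrow> 'v1::ab_group_add \<Rightarrow> 'v1" (infixr "\<cdot>\<^sub>1" 75) and U1
    and s2 :: "'k2::field \<Rightarrow> 'v2::ab_group_add \<Rightarrow> 'v2" (infixr "\<cdot>\<^sub>2" 75) and U2 +
  fixes \<sigma> :: "'v1 set \<Rightarrow> 'v2 set" and \<tau> :: "'v1 set set \<Rightarrow> 'v2 set set"
  assumes U1: "U1 \<subseteq> proj_space s1" and U2: "U2 \<subseteq> proj_space s2"
    and \<sigma>_bij: "bij_betw \<sigma> U1 U2"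
    and \<tau>_bij: "bij_betw \<tau> (lines_meeting s1 U1) (lines_meeting s2 U2)"
    and \<tau>_\<sigma>: "\<forall>l\<in>lines_meeting s1 U1. \<tau> l \<inter> U2 = \<sigma> ` (l \<inter> U1)"
begin

lemma \<tau>_line: "l \<in> lines_meeting s1 U1 \<Longrightarrow> \<tau> l \<in> proj_lines s2"
  using \<tau>_bij unfolding bij_betw_def lines_meeting_def by blast

lemma \<sigma>_mem_\<tau>:
  assumes "l \<in> lines_meeting s1 U1" "P \<in> U1" shows "\<sigma> P \<in> \<tau> l \<longleftrightarrow> P \<in> l"
proof -
  have "\<sigma> P \<in> \<tau> l \<longleftrightarrow> \<sigma> P \<in> \<sigma> ` (l \<inter> U1)"
    using \<tau>_\<sigma> assms \<sigma>_bij unfolding bij_betw_def by blast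
  also have "\<dots> \<longleftrightarrow> P \<in> l" using \<sigma>_bij assms(2) unfolding bij_betw_def inj_on_def by blast
  finally show ?thesis .
qed

text \<open>
  A line that meets \<open>U1\<close> is spanned by two of its points in \<open>U1\<close>, so \<open>\<sigma>\<close> determines its image.
\<close>

lemma lines_meeting_basis:
  assumes "l \<in> lines_meeting s1 U1"
  obtains x y where "x \<in> proj_cone s1 U1" "y \<in> proj_cone s1 U1" "indep2 s1 x y" "l = proj_sub s1 (line s1 x y)"
proof -
  obtain u v where uv: "indep2 s1 u v" "l = proj_sub s1 (line s1 u v)"
    using assms V1.proj_linesE unfolding lines_meeting_def by blast
  obtain P where P: "P \<in> l" "P \<in> U1" using assms unfolding lines_meeting_def by blast
  obtain z where z: "z \<noteq> 0" "P = proj_class s1 z" using P(2) U1 V1.proj_spaceE by blast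
  have "z \<in> line s1 u v \<inter> proj_cone s1 U1" using V1.mem_proj_line[OF z(1)] P z uv(2) unfolding proj_cone_def by blast
  then have "line s1 u v \<inter> proj_cone s1 U1 \<noteq> {}" by blast
  from V1.cone_line_basis[OF uv(1) this] obtain x y
    where "x \<in> proj_cone s1 U1" "y \<in> proj_cone s1 U1" "indep2 s1 x y" "line s1 x y = line s1 u v" by blast
  then show thesis using that[of x y] uv(2) by simp
qed

lemma line_meeting_cone:
  assumes "x \<in> proj_cone s1 U1" "indep2 s1 x y"
  shows "proj_sub s1 (line s1 x y) \<in> lines_meeting s1 U1"
  using assms V1.proj_linesI V1.mem_proj_line[of x x y] V1.line_left unfolding lines_meeting_def proj_cone_def by blast

text \<open>
  Collinearity of points of \<open>U1\<close> can be read off from the lines that meet \<open>U1\<close>, on which \<open>\<sigma>\<close> and \<open>\<tau>\<close>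
  are compatible in both directions.
\<close>

lemma cone_morphism_lift:
  assumes h: "\<And>x. x \<in> proj_cone s1 U1 \<Longrightarrow> h x \<noteq> 0 \<and> proj_class s2 (h x) = \<sigma> (proj_class s1 x)"
  shows "cone_morphism s1 (proj_cone s1 U1) s2 h"
proof -
  let ?C = "proj_cone s1 U1"
  have i2: "indep2 s2 (h x) (h y) \<longleftrightarrow> indep2 s1 x y" if xy: "x \<in> ?C" "y \<in> ?C" for x y
  proof -
    have "indep2 s2 (h x) (h y) \<longleftrightarrow> \<sigma> (proj_class s1 x) \<noteq> \<sigma> (proj_class s1 y)"
      using V2.proj_class_eq_iff[of "h x" "h y"] h[OF xy(1)] h[OF xy(2)] by simp
    also have "\<dots> \<longleftrightarrow> proj_class s1 x \<noteq> proj_class s1 y"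
      using inj_on_eq_iff[OF bij_betw_imp_inj_on[OF \<sigma>_bij]] xy unfolding proj_cone_def by simp
    also have "\<dots> \<longleftrightarrow> indep2 s1 x y" using V1.proj_class_eq_iff[of x y] xy unfolding proj_cone_def by simp
    finally show ?thesis .
  qed
  have i3: "indep3 s2 (h x) (h y) (h z) \<longleftrightarrow> indep3 s1 x y z" if xyz: "x \<in> ?C" "y \<in> ?C" "z \<in> ?C" for x y z
  proof (cases "indep2 s1 x y")
    case False
    then show ?thesis using i2[OF xyz(1,2)] V1.indep3_imp_indep2 V2.indep3_imp_indep2 by blast
  next
    case True
    let ?l = "proj_sub s1 (line s1 x y)"
    have l: "?l \<in> lines_meeting s1 U1" by (rule line_meeting_cone[OF xyz(1) True])
    have mem: "proj_class s2 (h w) \<in> \<tau> ?l \<longleftrightarrow> w \<in> line s1 x y" if "w \<in> ?C" for w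
      using \<sigma>_mem_\<tau>[OF l, of "proj_class s1 w"] V1.mem_proj_line[of w x y] h[OF that] that unfolding proj_cone_def by simp
    have ixy: "indep2 s2 (h x) (h y)" using i2 xyz True by blast
    have "\<tau> ?l = proj_sub s2 (line s2 (h x) (h y))"
      by (rule V2.proj_line_through[OF \<tau>_line[OF l] ixy]) (use mem xyz V1.line_left V1.line_right in blast)+
    then have "h z \<in> line s2 (h x) (h y) \<longleftrightarrow> z \<in> line s1 x y"
      using mem[OF xyz(3)] V2.mem_proj_line[of "h z"] h[OF xyz(3)] by simp
    then show ?thesis using V1.indep3_iff[OF True] V2.indep3_iff[OF ixy] by blast
  qed
  show ?thesis
    by unfold_locales (use i2 i3 in auto)
qed

text \<open>
  Let \<open>P\<close> be the intersection of two lines that meet \<open>U1\<close>. Both extensions send \<open>P\<close> to points of the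
  images of these lines under \<open>\<tau>\<close>. As \<open>\<tau>\<close> is injective, the images are distinct and have only one
  point in common.
\<close>

lemma extension_unique:
  assumes c: "collineation s1 s2 \<sigma>' \<tau>'" "restricts_to s1 U1 \<sigma>' \<tau>' \<sigma> \<tau>"
    and c': "collineation s1 s2 \<sigma>'' \<tau>''" "restricts_to s1 U1 \<sigma>'' \<tau>'' \<sigma> \<tau>"
    and P: "P \<in> proj_space s1"
  shows "\<sigma>'' P = \<sigma>' P"
proof (rule ccontr)
  assume ne: "\<sigma>'' P \<noteq> \<sigma>' P"
  obtain p where p: "p \<noteq> 0" "P = proj_class s1 p" using P by (rule V1.proj_spaceE)
  obtain x y u v where *: "x \<in> proj_cone s1 U1" "y \<in> proj_cone s1 U1" "u \<in> proj_cone s1 U1" "v \<in> proj_cone s1 U1"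
    "indep2 s1 x y" "indep2 s1 u v" "p \<in> line s1 x y" "p \<in> line s1 u v" "u \<notin> line s1 x y"
    using V1.two_lines[OF p(1)] by metis
  let ?l = "proj_sub s1 (line s1 x y)" and ?m = "proj_sub s1 (line s1 u v)"
  have lm: "?l \<in> lines_meeting s1 U1" "?m \<in> lines_meeting s1 U1" using line_meeting_cone * by blast+
  have Pl: "P \<in> ?l" "P \<in> ?m" using V1.mem_proj_line p * by simp_all
  have im: "\<sigma>' P \<in> \<tau> l \<and> \<sigma>'' P \<in> \<tau> l" if "l \<in> lines_meeting s1 U1" "P \<in> l" for l
  proof -
    have "l \<in> proj_lines s1" using that unfolding lines_meeting_def by blast
    then have "\<tau>' l = \<sigma>' ` l" "\<tau>'' l = \<sigma>'' ` l" using c(1) c'(1) unfolding collineation_def by blast+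
    moreover have "\<tau>' l = \<tau> l" "\<tau>'' l = \<tau> l" using c(2) c'(2) that unfolding restricts_to_def by blast+
    ultimately show ?thesis using that(2) by (metis imageI)
  qed
  have "\<tau> ?l = \<tau> ?m"
    using V2.proj_line_unique[OF \<tau>_line[OF lm(1)] \<tau>_line[OF lm(2)] _ _ _ _ ne] im[OF lm(1) Pl(1)] im[OF lm(2) Pl(2)] by blast
  then have "?l = ?m" using inj_on_eq_iff[OF bij_betw_imp_inj_on[OF \<tau>_bij]] lm by simp
  then have "line s1 x y = line s1 u v" using V1.proj_sub_inj V1.line_subspace by blast
  then show False using *(9) V1.line_left by blast
qed

text \<open>
  On a line that meets \<open>U1\<close> both \<open>\<tau>'\<close> and \<open>\<tau>\<close> give a line through the images of two points of \<open>U1\<close>.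
\<close>

lemma restricts_if_extends_points:
  assumes c: "collineation s1 s2 \<sigma>' \<tau>'" and \<sigma>': "\<And>P. P \<in> U1 \<Longrightarrow> \<sigma>' P = \<sigma> P"
  shows "restricts_to s1 U1 \<sigma>' \<tau>' \<sigma> \<tau>"
  unfolding restricts_to_def
proof (intro conjI ballI)
  fix l assume l: "l \<in> lines_meeting s1 U1"
  obtain x y where xy: "x \<in> proj_cone s1 U1" "y \<in> proj_cone s1 U1" "indep2 s1 x y" "l = proj_sub s1 (line s1 x y)"
    using lines_meeting_basis[OF l] .
  let ?P = "proj_class s1 x" and ?Q = "proj_class s1 y"
  have nz: "x \<noteq> 0" "y \<noteq> 0" and U: "?P \<in> U1" "?Q \<in> U1" using xy unfolding proj_cone_def by blast+
  have PQl: "?P \<in> l" "?Q \<in> l"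
    unfolding xy(4) using V1.mem_proj_line nz V1.line_left V1.line_right by blast+
  have "?P \<noteq> ?Q" using V1.proj_class_eq_iff[OF nz] xy(3) by blast
  then have ne: "\<sigma> ?P \<noteq> \<sigma> ?Q" using inj_on_eq_iff[OF bij_betw_imp_inj_on[OF \<sigma>_bij]] U by simp
  have l': "l \<in> proj_lines s1" using l unfolding lines_meeting_def by blast
  have t: "\<tau>' l = \<sigma>' ` l" "\<tau>' l \<in> proj_lines s2"
    using c l' unfolding collineation_def bij_betw_def by blast+
  have "\<sigma> ?P \<in> \<tau>' l" "\<sigma> ?Q \<in> \<tau>' l" using \<sigma>'[OF U(1)] \<sigma>'[OF U(2)] PQl t(1) by (metis imageI)+
  moreover have "\<sigma> ?P \<in> \<tau> l" "\<sigma> ?Q \<in> \<tau> l" using \<sigma>_mem_\<tau>[OF l] U PQl by blast+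
  ultimately show "\<tau>' l = \<tau> l" using V2.proj_line_unique[OF t(2) \<tau>_line[OF l] _ _ _ _ ne] by blast
qed (rule \<sigma>')

end

locale semilinear_map_iso = V1: lin s1 + V2: lin s2
  for s1 :: "'k1::field \<Rightarrow> 'v1::ab_group_add \<Rightarrow> 'v1" (infixr "\<cdot>\<^sub>1" 75)
    and s2 :: "'k2::field \<Rightarrow> 'v2::ab_group_add \<Rightarrow> 'v2" (infixr "\<cdot>\<^sub>2" 75) +
  fixes \<mu> and lam
  assumes semi: "semilinear_iso s1 s2 \<mu> lam"
begin

lemma bij: "bij \<mu>" "bij lam"
  and lam_add: "lam (x + y) = lam x + lam y" and lam_scale: "lam (a \<cdot>\<^sub>1 x) = \<mu> a \<cdot>\<^sub>2 lam x"
  and \<mu>_add: "\<mu> (a + b) = \<mu> a + \<mu> b"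
  using semi unfolding semilinear_iso_def by blast+

lemma lam_zero: "lam 0 = 0"
  using lam_add[of 0 0] by (metis add_cancel_right_right)

lemma \<mu>_zero: "\<mu> 0 = 0"
  using \<mu>_add[of 0 0] by (metis add_cancel_right_right)

lemma lam_eq_0: "lam x = 0 \<longleftrightarrow> x = 0"
  using bij(2) lam_zero by (metis bij_pointE)

lemma \<mu>_eq_0: "\<mu> a = 0 \<longleftrightarrow> a = 0"
  using bij(1) \<mu>_zero by (metis bij_pointE)

lemma ex_scalar: "\<exists>a. \<mu> a = b"
  using bij(1) by (metis bij_pointE)

lemma lam_line: "lam ` line s1 x y = line s2 (lam x) (lam y)"
proof (intro set_eqI iffI)
  fix w assume "w \<in> lam ` line s1 x y"
  then obtain a b where "w = lam (a \<cdot>\<^sub>1 x + b \<cdot>\<^sub>1 y)" by (auto elim: V1.lineE)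
  then show "w \<in> line s2 (lam x) (lam y)" by (simp add: lam_add lam_scale V2.lineI)
next
  fix w assume "w \<in> line s2 (lam x) (lam y)"
  then obtain a b where "w = a \<cdot>\<^sub>2 lam x + b \<cdot>\<^sub>2 lam y" by (rule V2.lineE)
  moreover obtain a' b' where "\<mu> a' = a" "\<mu> b' = b" using ex_scalar by blast
  ultimately have "w = lam (a' \<cdot>\<^sub>1 x + b' \<cdot>\<^sub>1 y)" by (simp add: lam_add lam_scale)
  then show "w \<in> lam ` line s1 x y" using V1.lineI by blast
qed

lemma lam_indep2: "indep2 s2 (lam x) (lam y) \<longleftrightarrow> indep2 s1 x y"
proof -
  have "indep2 s2 (lam x) (lam y) \<longleftrightarrow> (\<forall>a b. \<mu> a \<cdot>\<^sub>2 lam x + \<mu> b \<cdot>\<^sub>2 lam y = 0 \<longrightarrow> \<mu> a = 0 \<and> \<mu> b = 0)"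
    unfolding indep2_def using ex_scalar by metis
  also have "\<dots> \<longleftrightarrow> (\<forall>a b. a \<cdot>\<^sub>1 x + b \<cdot>\<^sub>1 y = 0 \<longrightarrow> a = 0 \<and> b = 0)"
    using lam_eq_0 by (simp add: \<mu>_eq_0 flip: lam_scale lam_add)
  finally show ?thesis unfolding indep2_def .
qed

lemma lam_class: assumes "x \<noteq> 0" shows "lam ` proj_class s1 x = proj_class s2 (lam x)"
proof (intro set_eqI iffI)
  fix w assume "w \<in> lam ` proj_class s1 x"
  then obtain y where "y \<in> proj_class s1 x" "w = lam y" by blast
  then show "w \<in> proj_class s2 (lam x)"
    unfolding V1.mem_proj_class V2.mem_proj_class using lam_eq_0 lam_indep2 by simp
next
  fix w assume w: "w \<in> proj_class s2 (lam x)"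
  obtain y where "w = lam y" using bij(2) by (metis bij_pointE)
  then show "w \<in> lam ` proj_class s1 x"
    using w unfolding V1.mem_proj_class V2.mem_proj_class using lam_eq_0 lam_indep2 V1.mem_proj_class by auto
qed

lemma lam_proj_sub:
  "(`) lam ` proj_sub s1 (line s1 x y) = proj_sub s2 (line s2 (lam x) (lam y))"
proof -
  have "(`) lam ` proj_sub s1 (line s1 x y) = (\<lambda>z. proj_class s2 (lam z)) ` (line s1 x y - {0})"
    unfolding proj_sub_def image_image by (intro image_cong refl) (use lam_class in auto)
  also have "\<dots> = proj_class s2 ` (lam ` (line s1 x y - {0}))" by (simp add: image_image)
  also have "lam ` (line s1 x y - {0}) = line s2 (lam x) (lam y) - {0}"
    unfolding lam_line[symmetric] using lam_eq_0 by auto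
  finally show ?thesis unfolding proj_sub_def .
qed

lemma induced_collineation: "collineation s1 s2 ((`) lam) ((`) ((`) lam))"
proof -
  have inj: "inj ((`) lam)" using bij(2) by (auto simp: bij_def inj_on_def inj_image_eq_iff)
  then have inj2: "inj ((`) ((`) lam))" by (auto simp: inj_on_def inj_image_eq_iff)
  have surj: "\<exists>x. lam x = w" for w using bij(2) by (metis bij_pointE)
  have "(`) lam ` proj_space s1 = proj_space s2"
  proof -
    have "(`) lam ` proj_space s1 = proj_class s2 ` (lam ` (UNIV - {0}))"
      unfolding V1.proj_space_eq image_image by (intro image_cong refl) (use lam_class in auto)
    also have "lam ` (UNIV - {0}) = UNIV - {0}"
      using image_set_diff[OF bij_is_inj[OF bij(2)], of UNIV "{0}"] bij_is_surj[OF bij(2)] lam_zero by simp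
    finally show ?thesis unfolding V2.proj_space_eq .
  qed
  moreover have "(`) ((`) lam) ` proj_lines s1 = proj_lines s2"
  proof (intro set_eqI iffI)
    fix l assume "l \<in> (`) ((`) lam) ` proj_lines s1"
    then obtain x y where "indep2 s1 x y" "l = (`) lam ` proj_sub s1 (line s1 x y)"
      by (auto elim: V1.proj_linesE)
    then show "l \<in> proj_lines s2" using lam_proj_sub V2.proj_linesI lam_indep2 by simp
  next
    fix l assume "l \<in> proj_lines s2"
    then obtain x y where xy: "indep2 s2 x y" "l = proj_sub s2 (line s2 x y)" by (rule V2.proj_linesE)
    obtain x' y' where x': "lam x' = x" "lam y' = y" using surj by metis
    have "proj_sub s1 (line s1 x' y') \<in> proj_lines s1" using xy(1) x' lam_indep2 V1.proj_linesI by blast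
    moreover have "l = (`) lam ` proj_sub s1 (line s1 x' y')" using lam_proj_sub x' xy(2) by simp
    ultimately show "l \<in> (`) ((`) lam) ` proj_lines s1" by blast
  qed
  ultimately show ?thesis unfolding collineation_def bij_betw_def
    using inj inj2 by (auto intro: inj_on_subset)
qed

end

text \<open>
  For every \<open>x\<close> the values \<open>lam' x\<close> and \<open>lam x\<close> differ by a factor. Comparing the factors at \<open>x\<close>, \<open>y\<close> and
  \<open>x + y\<close> shows that they agree at independent vectors, and a third vector links dependent ones.
  Hence there is a single factor \<open>c\<close>, and \<open>a\<close> is the preimage of \<open>c\<close> under \<open>\<mu>\<close>.
\<close>

lemma semilinear_unique:
  assumes l1: "lin s1" and l2: "lin s2" and d: "\<And>x y. \<exists>z. z \<notin> line s1 x y"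
    and s: "semilinear_iso s1 s2 \<mu> lam" and s': "semilinear_iso s1 s2 \<mu>' lam'"
    and same: "\<And>x. x \<noteq> 0 \<Longrightarrow> proj_class s2 (lam' x) = proj_class s2 (lam x)"
  shows "\<mu>' = \<mu> \<and> (\<exists>a. a \<noteq> 0 \<and> (\<forall>x. lam' x = lam (s1 a x)))"
proof -
  interpret A: semilinear_map_iso s1 s2 \<mu> lam
    unfolding semilinear_map_iso_def semilinear_map_iso_axioms_def using l1 l2 s by blast
  interpret B: semilinear_map_iso s1 s2 \<mu>' lam'
    unfolding semilinear_map_iso_def semilinear_map_iso_axioms_def using l1 l2 s' by blast
  have ex_c: "\<exists>c. c \<noteq> 0 \<and> lam' x = s2 c (lam x)" if x: "x \<noteq> 0" for x
  proof -
    have n: "lam x \<noteq> 0" "lam' x \<noteq> 0" using x A.lam_eq_0 B.lam_eq_0 by simp_all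
    have "\<not> indep2 s2 (lam x) (lam' x)" using A.V2.proj_class_eq_iff[OF n] same[OF x] by simp
    then show ?thesis using A.V2.not_indep2E[OF _ n] by metis
  qed
  obtain e where "e \<notin> line s1 0 0" using d by blast
  then have e: "e \<noteq> 0" using A.V1.line_scale[OF A.V1.line_left, of 0 0 0] by auto
  obtain c where c: "c \<noteq> 0" "lam' e = s2 c (lam e)" using ex_c[OF e] by blast
  have transfer: "lam' y = s2 c (lam y)" if i: "indep2 s1 x y" and x: "lam' x = s2 c (lam x)" for x y
  proof -
    obtain b where b: "lam' y = s2 b (lam y)" using ex_c A.V1.indep2_nonzero[OF i] by blast
    have "x + y \<noteq> 0" using A.V1.indep2D[OF i, of 1 1] by auto
    then obtain d where "lam' (x + y) = s2 d (lam (x + y))" using ex_c by blast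
    then have "s2 c (lam x) + s2 b (lam y) = s2 d (lam x) + s2 d (lam y)"
      using x b by (simp add: A.lam_add B.lam_add A.V2.scale_right_distrib)
    moreover have "indep2 s2 (lam x) (lam y)" using A.lam_indep2 i by blast
    ultimately have "c = d \<and> b = d" using A.V2.indep2_eqD by blast
    then show ?thesis using b by simp
  qed
  have all: "lam' x = s2 c (lam x)" for x
  proof (cases "x = 0")
    case True then show ?thesis using A.lam_zero B.lam_zero by simp
  next
    case x: False
    show ?thesis
    proof (cases "indep2 s1 e x")
      case True then show ?thesis using transfer c by blast
    next
      case False
      obtain y where y: "y \<notin> line s1 e e" using d by blast
      have ey: "indep2 s1 e y" by (rule A.V1.indep2_off_line[OF e y])
      have "indep2 s1 y x" using A.V1.par_trans[OF False _ x] ey A.V1.indep2_sym by blast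
      then show ?thesis using transfer[OF _ transfer[OF ey c(2)]] by blast
    qed
  qed
  obtain a where a: "\<mu> a = c" using A.ex_scalar by blast
  have "a \<noteq> 0" using a c(1) A.\<mu>_zero by auto
  moreover have "lam' x = lam (s1 a x)" for x using all a A.lam_scale by simp
  moreover have "\<mu>' = \<mu>"
  proof
    fix b
    have "s2 (\<mu>' b) (lam' e) = s2 c (lam (s1 b e))" using all[of "s1 b e"] B.lam_scale by simp
    also have "\<dots> = s2 (\<mu> b) (lam' e)" using A.lam_scale c(2) by (simp add: mult.commute)
    finally show "\<mu>' b = \<mu> b" using B.lam_eq_0 e A.V2.scale_right_imp_eq by metis
  qed
  ultimately show ?thesis by blast
qed

theorem theorem5p7:
  fixes s1 :: "'k1::field \<Rightarrow> 'v1::ab_group_add \<Rightarrow> 'v1"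
    and s2 :: "'k2::field \<Rightarrow> 'v2::ab_group_add \<Rightarrow> 'v2"
    and U1 :: "'v1 set set" and U2 :: "'v2 set set"
    and \<S>1 :: "('k1 ^ 2) set set set" and \<S>2 :: "('k2 ^ 2) set set set"
    and \<sigma> :: "'v1 set \<Rightarrow> 'v2 set" and \<tau> :: "'v1 set set \<Rightarrow> 'v2 set set"
  assumes "vector_space s1" and "vector_space s2"
    and "dim_at_least s1 3" and "dim_at_least s2 3"
    and "admissible 3 2 \<S>1" and "admissible 3 2 \<S>2"
    and "ample \<S>1 s1 U1" and "ample \<S>2 s2 U2"
    and "bij_betw \<sigma> U1 U2"
    and "bij_betw \<tau> (lines_meeting s1 U1) (lines_meeting s2 U2)"
    and "\<forall>l\<in>lines_meeting s1 U1. \<tau> l \<inter> U2 = \<sigma> ` (l \<inter> U1)"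
  shows "(\<exists>\<sigma>' \<tau>'. collineation s1 s2 \<sigma>' \<tau>' \<and> restricts_to s1 U1 \<sigma>' \<tau>' \<sigma> \<tau> \<and>
            (\<forall>\<sigma>'' \<tau>''. collineation s1 s2 \<sigma>'' \<tau>'' \<and> restricts_to s1 U1 \<sigma>'' \<tau>'' \<sigma> \<tau> \<longrightarrow>
               (\<forall>p\<in>proj_space s1. \<sigma>'' p = \<sigma>' p) \<and> (\<forall>l\<in>proj_lines s1. \<tau>'' l = \<tau>' l))) \<and>
         (\<exists>\<mu> lam. semilinear_iso s1 s2 \<mu> lam \<and> induces s1 s2 U1 lam \<sigma> \<tau>) \<and>
         (\<forall>\<mu> lam \<mu>' lam'. semilinear_iso s1 s2 \<mu> lam \<and> induces s1 s2 U1 lam \<sigma> \<tau> \<and>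
            semilinear_iso s1 s2 \<mu>' lam' \<and> induces s1 s2 U1 lam' \<sigma> \<tau> \<longrightarrow>
            \<mu>' = \<mu> \<and> (\<exists>a. a \<noteq> 0 \<and> (\<forall>x. lam' x = lam (s1 a x))))"
proof -
  have l1: "lin s1" and l2: "lin s2" using assms(1,2) unfolding lin_def .
  let ?C1 = "proj_cone s1 U1" and ?C2 = "proj_cone s2 U2"
  have ac1: "ample_cone s1 ?C1" using lin.ample_cone_of_ample[OF l1 assms(5,7,3)] .
  have ac2: "ample_cone s2 ?C2" using lin.ample_cone_of_ample[OF l2 assms(6,8,4)] .
  have U: "U1 \<subseteq> proj_space s1" "U2 \<subseteq> proj_space s2" using assms(7,8) unfolding ample_def by blast+
  interpret F: projective_partial_map s1 U1 s2 U2 \<sigma> \<tau>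
    unfolding projective_partial_map_def projective_partial_map_axioms_def
    using ac1 l2 U assms(9-11) by blast
  define \<sigma>i where "\<sigma>i = inv_into U1 \<sigma>"
  define \<tau>i where "\<tau>i = inv_into (lines_meeting s1 U1) \<tau>"
  have \<sigma>i: "bij_betw \<sigma>i U2 U1" unfolding \<sigma>i_def by (rule bij_betw_inv_into[OF assms(9)])
  have \<tau>i: "bij_betw \<tau>i (lines_meeting s2 U2) (lines_meeting s1 U1)"
    unfolding \<tau>i_def by (rule bij_betw_inv_into[OF assms(10)])
  have \<sigma>i_\<sigma>: "\<sigma>i (\<sigma> P) = P" if "P \<in> U1" for P
    unfolding \<sigma>i_def using bij_betw_inv_into_left[OF assms(9) that] .
  have \<sigma>_\<sigma>i: "\<sigma> (\<sigma>i P) = P" if "P \<in> U2" for P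
    unfolding \<sigma>i_def using bij_betw_inv_into_right[OF assms(9) that] .
  have \<tau>_\<sigma>i: "\<forall>l\<in>lines_meeting s2 U2. \<tau>i l \<inter> U1 = \<sigma>i ` (l \<inter> U2)"
  proof
    fix l assume l: "l \<in> lines_meeting s2 U2"
    have m: "\<tau>i l \<in> lines_meeting s1 U1" using \<tau>i l unfolding bij_betw_def by blast
    have "\<tau> (\<tau>i l) = l" unfolding \<tau>i_def using bij_betw_inv_into_right[OF assms(10) l] .
    then have "l \<inter> U2 = \<sigma> ` (\<tau>i l \<inter> U1)" using assms(11) m by metis
    then have "\<sigma>i ` (l \<inter> U2) = (\<lambda>P. \<sigma>i (\<sigma> P)) ` (\<tau>i l \<inter> U1)" by (simp add: image_image)
    also have "\<dots> = (\<lambda>P. P) ` (\<tau>i l \<inter> U1)" by (rule image_cong) (simp_all add: \<sigma>i_\<sigma>)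
    finally show "\<tau>i l \<inter> U1 = \<sigma>i ` (l \<inter> U2)" by simp
  qed
  interpret B: projective_partial_map s2 U2 s1 U1 \<sigma>i \<tau>i
    unfolding projective_partial_map_def projective_partial_map_axioms_def
    using ac2 l1 U \<sigma>i \<tau>i \<tau>_\<sigma>i by blast
  have "\<forall>x. \<exists>w. x \<in> ?C1 \<longrightarrow> w \<noteq> 0 \<and> proj_class s2 w = \<sigma> (proj_class s1 x)"
  proof (intro allI)
    fix x
    have "\<sigma> (proj_class s1 x) \<in> proj_space s2" if "x \<in> ?C1"
      using that U(2) assms(9) unfolding proj_cone_def bij_betw_def by blast
    then show "\<exists>w. x \<in> ?C1 \<longrightarrow> w \<noteq> 0 \<and> proj_class s2 w = \<sigma> (proj_class s1 x)"
      using F.V2.proj_spaceE by metis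
  qed
  then obtain h where h: "\<And>x. x \<in> ?C1 \<Longrightarrow> h x \<noteq> 0 \<and> proj_class s2 (h x) = \<sigma> (proj_class s1 x)" by metis
  have "\<forall>y. \<exists>w. y \<in> ?C2 \<longrightarrow> w \<noteq> 0 \<and> proj_class s1 w = \<sigma>i (proj_class s2 y)"
  proof (intro allI)
    fix y
    have "\<sigma>i (proj_class s2 y) \<in> proj_space s1" if "y \<in> ?C2"
      using that U(1) \<sigma>i unfolding proj_cone_def bij_betw_def by blast
    then show "\<exists>w. y \<in> ?C2 \<longrightarrow> w \<noteq> 0 \<and> proj_class s1 w = \<sigma>i (proj_class s2 y)"
      using F.V1.proj_spaceE by metis
  qed
  then obtain h' where h': "\<And>y. y \<in> ?C2 \<Longrightarrow> h' y \<noteq> 0 \<and> proj_class s1 (h' y) = \<sigma>i (proj_class s2 y)" by metis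
  have h_in: "h x \<in> ?C2" if "x \<in> ?C1" for x
    using h[OF that] that assms(9) unfolding proj_cone_def bij_betw_def by blast
  have h'_in: "h' y \<in> ?C1" if "y \<in> ?C2" for y
    using h'[OF that] that \<sigma>i unfolding proj_cone_def bij_betw_def by blast
  interpret I: cone_iso s1 ?C1 s2 ?C2 h h'
  proof (intro cone_iso.intro cone_iso_axioms.intro)
    show "cone_morphism s1 ?C1 s2 h" by (rule F.cone_morphism_lift[OF h])
    show "cone_morphism s2 ?C2 s1 h'" by (rule B.cone_morphism_lift[OF h'])
    show "h x \<in> ?C2" if "x \<in> ?C1" for x using h_in that .
    show "h' y \<in> ?C1" if "y \<in> ?C2" for y using h'_in that .
    show "\<not> indep2 s1 (h' (h x)) x" if x: "x \<in> ?C1" for x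
    proof -
      have "proj_class s1 (h' (h x)) = proj_class s1 x"
        using h'[OF h_in[OF x]] h[OF x] \<sigma>i_\<sigma> x unfolding proj_cone_def by simp
      then show ?thesis using F.V1.proj_class_eq_iff h'[OF h_in[OF x]] x unfolding proj_cone_def by blast
    qed
    show "\<not> indep2 s2 (h (h' y)) y" if y: "y \<in> ?C2" for y
    proof -
      have "proj_class s2 (h (h' y)) = proj_class s2 y"
        using h[OF h'_in[OF y]] h'[OF y] \<sigma>_\<sigma>i y unfolding proj_cone_def by simp
      then show ?thesis using F.V2.proj_class_eq_iff h[OF h'_in[OF y]] y unfolding proj_cone_def by blast
    qed
  qed
  obtain \<mu> lam where sl: "semilinear_iso s1 s2 \<mu> lam"
    and lam_h: "\<And>x. x \<in> ?C1 \<Longrightarrow> \<not> indep2 s2 (lam x) (h x)" using I.semilinear_extension by blast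
  interpret L: semilinear_map_iso s1 s2 \<mu> lam
    unfolding semilinear_map_iso_def semilinear_map_iso_axioms_def using l1 l2 sl by blast
  let ?\<sigma> = "(`) lam" and ?\<tau> = "(`) ((`) lam)"
  have col: "collineation s1 s2 ?\<sigma> ?\<tau>" by (rule L.induced_collineation)
  have res: "restricts_to s1 U1 ?\<sigma> ?\<tau> \<sigma> \<tau>"
  proof (rule F.restricts_if_extends_points[OF col])
    fix P assume P: "P \<in> U1"
    obtain x where x: "x \<noteq> 0" "P = proj_class s1 x" using P U(1) F.V1.proj_spaceE by blast
    have xC: "x \<in> ?C1" using P x unfolding proj_cone_def by simp
    have "proj_class s2 (lam x) = proj_class s2 (h x)"
      using F.V2.proj_class_eq_iff[of "lam x" "h x"] lam_h[OF xC] L.lam_eq_0 x(1) h[OF xC] by blast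
    then show "lam ` P = \<sigma> P" using L.lam_class[OF x(1)] h[OF xC] x(2) by simp
  qed
  have uniq: "\<sigma>'' P = \<sigma>' P"
    if "collineation s1 s2 \<sigma>' \<tau>'" "restricts_to s1 U1 \<sigma>' \<tau>' \<sigma> \<tau>"
      "collineation s1 s2 \<sigma>'' \<tau>''" "restricts_to s1 U1 \<sigma>'' \<tau>'' \<sigma> \<tau>" "P \<in> proj_space s1" for \<sigma>' \<tau>' \<sigma>'' \<tau>'' P
    using F.extension_unique that .
  have extension: "\<exists>\<sigma>' \<tau>'. collineation s1 s2 \<sigma>' \<tau>' \<and> restricts_to s1 U1 \<sigma>' \<tau>' \<sigma> \<tau> \<and>
            (\<forall>\<sigma>'' \<tau>''. collineation s1 s2 \<sigma>'' \<tau>'' \<and> restricts_to s1 U1 \<sigma>'' \<tau>'' \<sigma> \<tau> \<longrightarrow>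
               (\<forall>p\<in>proj_space s1. \<sigma>'' p = \<sigma>' p) \<and> (\<forall>l\<in>proj_lines s1. \<tau>'' l = \<tau>' l))"
  proof (intro exI conjI allI impI)
    fix \<sigma>'' \<tau>'' assume a: "collineation s1 s2 \<sigma>'' \<tau>'' \<and> restricts_to s1 U1 \<sigma>'' \<tau>'' \<sigma> \<tau>"
    show pts: "\<forall>p\<in>proj_space s1. \<sigma>'' p = ?\<sigma> p" using uniq[OF col res] a by blast
    show "\<forall>l\<in>proj_lines s1. \<tau>'' l = ?\<tau> l"
    proof
      fix l assume l: "l \<in> proj_lines s1"
      have "\<tau>'' l = \<sigma>'' ` l" using a l unfolding collineation_def by blast
      also have "\<dots> = ?\<sigma> ` l" by (rule image_cong) (use pts F.V1.proj_line_subset[OF l] in auto)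
      finally show "\<tau>'' l = ?\<tau> l" .
    qed
  qed (rule col, rule res)
  have semilinear: "\<exists>\<mu> lam. semilinear_iso s1 s2 \<mu> lam \<and> induces s1 s2 U1 lam \<sigma> \<tau>"
    unfolding induces_def using sl col res L.lam_class by blast
  have unique: "\<mu>2 = \<mu>1 \<and> (\<exists>a. a \<noteq> 0 \<and> (\<forall>x. lam2 x = lam1 (s1 a x)))"
    if s: "semilinear_iso s1 s2 \<mu>1 lam1" "semilinear_iso s1 s2 \<mu>2 lam2"
      and i1: "induces s1 s2 U1 lam1 \<sigma> \<tau>" and i2: "induces s1 s2 U1 lam2 \<sigma> \<tau>" for \<mu>1 lam1 \<mu>2 lam2
  proof (rule semilinear_unique[OF l1 l2 F.V1.dim3 s])
    fix x :: 'v1 assume x: "x \<noteq> 0"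
    obtain \<sigma>' \<tau>' where 1: "collineation s1 s2 \<sigma>' \<tau>'" "restricts_to s1 U1 \<sigma>' \<tau>' \<sigma> \<tau>"
      "\<sigma>' (proj_class s1 x) = proj_class s2 (lam1 x)" using i1 x unfolding induces_def by blast
    obtain \<sigma>'' \<tau>'' where 2: "collineation s1 s2 \<sigma>'' \<tau>''" "restricts_to s1 U1 \<sigma>'' \<tau>'' \<sigma> \<tau>"
      "\<sigma>'' (proj_class s1 x) = proj_class s2 (lam2 x)" using i2 x unfolding induces_def by blast
    have "proj_class s1 x \<in> proj_space s1" using x unfolding F.V1.proj_space_eq by blast
    from uniq[OF 1(1,2) 2(1,2) this] show "proj_class s2 (lam2 x) = proj_class s2 (lam1 x)"
      using 1(3) 2(3) by simp
  qed
  show ?thesis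
    by (rule conjI[OF extension conjI[OF semilinear]], intro allI impI, elim conjE, rule unique)
qed

end
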